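(* Let $C$ be a diamond category. For each pro-isomorphism class $X$ of $C$, there exists a small pro-object $Y$ of $C$, unique up to isomorphism, such that $Y^{\mathcal{L}}\cong X^{\mathcal{L}}$ for each level $\mathcal{L}$. In other words, the map from the set of isomorphism classes of small pro-objects to the set $\mathcal{P}$ of pro-isomorphism classes that sends $Y$ to $(Y^{\mathcal{L}})_{\mathcal{L}}$ is a bijection.
   Context: Category notions. Let $C$ be a small category. A quotient of an object $G$ is a pair $(F,\pi)$ of an object $F$ and an epimorphism $\pi:G\to F$; quotients $(F,\pi),(F',\pi')$ are isomorphic if there is an isomorphism $\rho:F\to F'$ with $\pi'=\rho\pi$. Isomorphism classes of quotients of $G$ form a poset, where $H\ge F$ if there is $h:H\to F$ compatible with the morphisms from $G$; joins $\vee$ and meets $\wedge$ of quotients of $G$ are taken in this poset. A lattice (poset in which any two elements have a join and a meet) is modular if $a\le b$ implies $a\vee(x\wedge b)=(a\vee x)\wedge b$ for all $x$. For $F$ a quotient of $G$, $[F,G]$ is the poset of isomorphism classes of quotients of $G$ that are $\ge F$. An object is minimal if it has only one quotient (itself). A set $\mathcal{S}$ of objects, stable under isomorphism (equivalently a set of isomorphism classes), is downward-closed if every quotient of an object of $\mathcal{S}$ is in $\mathcal{S}$; it is join-closed if whenever $H,F\in\mathcal{S}$ are quotients of some object $G$ and $H\vee F$ exists, $H\vee F\in\mathcal{S}$. A level is a set of isomorphism classes generated by a finite set $B$ of isomorphism classes, i.e. the smallest downward-closed join-closed set containing $B$ and every minimal object. An epimorphism $G\to F$ is simple if it is not an isomorphism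 and $[F,G]$ contains only $F$ and $G$. A diamond category is a small category $C$ such that: (1) for each object $G$, the set of isomorphism classes of quotients of $G$ is a finite modular lattice; (2) each object has finite automorphism group; (3) for each level $\mathcal{L}$ and each $G\in\mathcal{L}$, there are finitely many elements of $\mathcal{L}$ with a simple epimorphism to $G$; (4) $C$ has at most countably many isomorphism classes of minimal objects. The paper never considers morphisms of $C$ that are not epimorphisms, and allows non-epimorphisms to be removed from $C$ for convenience. For a level $\mathcal{L}$ and an object $G$, $G^{\mathcal{L}}$ is the maximal quotient of $G$ in $\mathcal{L}$ (join of all quotients of $G$ in $\mathcal{L}$). A pro-isomorphism class $X$ of $C$ is, for each level $\mathcal{L}$, an isomorphism class $X^{\mathcal{L}}\in\mathcal{L}$ such that whenever $\mathcal{L}\subset\mathcal{L}'$ we have $(X^{\mathcal{L}'})^{\mathcal{L}}\cong X^{\mathcal{L}}$. A pro-object of $C$ is a functor $\mathcal{F}:I\to C$ from a small cofiltered category $I$ (any two objects of $I$ receive morphisms from a common object, and for any two parallel morphisms $f,g:A\to B$ in $I$ there is a morphism $h$ into $A$ with $fh=gh$), with morphisms $\mathrm{Hom}((I,\mathcal{F}),(J,\mathcal{G}))=\varprojlim_{j\in J}\varinjlim_{i\in I}\mathrm{Hom}(\mathcal{F}(i),\mathcal{G}(j))$. An object of $C$ is viewed as a pro-object via a category with one object and only the identity morphism. A pro-object is small if it is isomorphic to some $(I,\mathcal{F})$ with $\mathcal{F}(f)$ an epimorphism for every morphism $f$ of $I$, and for each $G\in C$ the set of epimorphisms from $(I,\mathcal{F})$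 to $G$ is finite. For a small pro-object $Y$ and a level $\mathcal{L}$, $Y^{\mathcal{L}}$ denotes the maximal quotient of $Y$ in $\mathcal{L}$: an object of $\mathcal{L}$ that is a quotient of $Y$ (with an epimorphism from $Y$) through which every other quotient of $Y$ in $\mathcal{L}$ factors; it exists for every small pro-object and every level. *)

theory Defs
  imports "HOL-Algebra.Lattice" "HOL-Library.Countable_Set"
begin

section \<open>Categories\<close>

text \<open>
  A category whose objects and arrows form sets, hence a small category.
  \<open>Comp C g f\<close> is the composite of first \<open>f\<close>, then \<open>g\<close>.
\<close>

record ('o, 'm) cat =
  Obj :: "'o set"
  Arr :: "'m set"
  Dom :: "'m \<Rightarrow> 'o"
  Cod :: "'m \<Rightarrow> 'o"
  Ident :: "'o \<Rightarrow> 'm"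
  Comp :: "'m \<Rightarrow> 'm \<Rightarrow> 'm"

definition hom :: "('o, 'm) cat \<Rightarrow> 'o \<Rightarrow> 'o \<Rightarrow> 'm set" where
  "hom C A B = {f \<in> Arr C. Dom C f = A \<and> Cod C f = B}"

locale category =
  fixes C :: "('o, 'm) cat"
  assumes Dom_Obj: "f \<in> Arr C \<Longrightarrow> Dom C f \<in> Obj C"
    and Cod_Obj: "f \<in> Arr C \<Longrightarrow> Cod C f \<in> Obj C"
    and Ident_hom: "A \<in> Obj C \<Longrightarrow> Ident C A \<in> hom C A A"
    and Comp_hom: "f \<in> hom C A B \<Longrightarrow> g \<in> hom C B D \<Longrightarrow> Comp C g f \<in> hom C A D"
    and Comp_Ident_right: "f \<in> hom C A B \<Longrightarrow> Comp C f (Ident C A) = f"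
    and Comp_Ident_left: "f \<in> hom C A B \<Longrightarrow> Comp C (Ident C B) f = f"
    and Comp_assoc: "f \<in> hom C A B \<Longrightarrow> g \<in> hom C B D \<Longrightarrow> h \<in> hom C D E \<Longrightarrow>
      Comp C h (Comp C g f) = Comp C (Comp C h g) f"

definition epi :: "('o, 'm) cat \<Rightarrow> 'm \<Rightarrow> bool" where
  "epi C p \<longleftrightarrow> p \<in> Arr C \<and>
    (\<forall>B. \<forall>g \<in> hom C (Cod C p) B. \<forall>h \<in> hom C (Cod C p) B.
      Comp C g p = Comp C h p \<longrightarrow> g = h)"

definition iso :: "('o, 'm) cat \<Rightarrow> 'm \<Rightarrow> bool" where
  "iso C f \<longleftrightarrow> f \<in> Arr C \<and>
    (\<exists>g \<in> hom C (Cod C f) (Dom C f).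
      Comp C g f = Ident C (Dom C f) \<and> Comp C f g = Ident C (Cod C f))"

definition isomorphic :: "('o, 'm) cat \<Rightarrow> 'o \<Rightarrow> 'o \<Rightarrow> bool" where
  "isomorphic C A B \<longleftrightarrow> (\<exists>f \<in> hom C A B. iso C f)"

definition iso_class :: "('o, 'm) cat \<Rightarrow> 'o \<Rightarrow> 'o set" where
  "iso_class C A = {B \<in> Obj C. isomorphic C A B}"


section \<open>Quotients\<close>

text \<open>A quotient \<open>(F, p)\<close> of \<open>G\<close> is represented by \<open>p\<close> alone, since \<open>F = Cod C p\<close>.\<close>

definition quotients :: "('o, 'm) cat \<Rightarrow> 'o \<Rightarrow> 'm set" where
  "quotients C G = {p. epi C p \<and> Dom C p = G}"

definition quot_iso :: "('o, 'm) cat \<Rightarrow> 'm \<Rightarrow> 'm \<Rightarrow> bool" where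
  "quot_iso C p q \<longleftrightarrow> (\<exists>r \<in> hom C (Cod C p) (Cod C q). iso C r \<and> q = Comp C r p)"

definition quot_le :: "('o, 'm) cat \<Rightarrow> 'm \<Rightarrow> 'm \<Rightarrow> bool" where
  "quot_le C q p \<longleftrightarrow> (\<exists>h \<in> hom C (Cod C p) (Cod C q). q = Comp C h p)"

definition quot_class :: "('o, 'm) cat \<Rightarrow> 'm \<Rightarrow> 'm set" where
  "quot_class C p = {q \<in> quotients C (Dom C p). quot_iso C p q}"

definition quot_poset :: "('o, 'm) cat \<Rightarrow> 'o \<Rightarrow> 'm set gorder" where
  "quot_poset C G =
    \<lparr>carrier = quot_class C ` quotients C G, eq = (=),
     le = (\<lambda>a b. \<exists>q \<in> a. \<exists>p \<in> b. quot_le C q p)\<rparr>"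

text \<open>The poset written \<open>[F, G]\<close> for the quotient \<open>(F, p)\<close> of \<open>G\<close>.\<close>

definition quot_interval :: "('o, 'm) cat \<Rightarrow> 'm \<Rightarrow> 'm set set" where
  "quot_interval C p =
    {a \<in> carrier (quot_poset C (Dom C p)). quot_class C p \<sqsubseteq>\<^bsub>quot_poset C (Dom C p)\<^esub> a}"

definition simple_epi :: "('o, 'm) cat \<Rightarrow> 'm \<Rightarrow> bool" where
  "simple_epi C p \<longleftrightarrow> epi C p \<and> \<not> iso C p \<and>
    quot_interval C p = {quot_class C p, quot_class C (Ident C (Dom C p))}"

definition minimal_object :: "('o, 'm) cat \<Rightarrow> 'o \<Rightarrow> bool" where
  "minimal_object C G \<longleftrightarrow> G \<in> Obj C \<and>
    carrier (quot_poset C G) = {quot_class C (Ident C G)}"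

locale modular_lattice = lattice L for L :: "('a, 'b) gorder_scheme" (structure) +
  assumes modular: "a \<in> carrier L \<Longrightarrow> b \<in> carrier L \<Longrightarrow> x \<in> carrier L \<Longrightarrow> a \<sqsubseteq> b \<Longrightarrow>
    a \<squnion> (x \<sqinter> b) = (a \<squnion> x) \<sqinter> b"


section \<open>Levels\<close>

text \<open>Sets of isomorphism classes are represented by isomorphism-stable sets of objects.\<close>

definition iso_stable :: "('o, 'm) cat \<Rightarrow> 'o set \<Rightarrow> bool" where
  "iso_stable C S \<longleftrightarrow> S \<subseteq> Obj C \<and> (\<forall>G \<in> S. iso_class C G \<subseteq> S)"

definition downward_closed :: "('o, 'm) cat \<Rightarrow> 'o set \<Rightarrow> bool" where
  "downward_closed C S \<longleftrightarrow> (\<forall>G \<in> S. \<forall>p \<in> quotients C G. Cod C p \<in> S)"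

definition join_closed :: "('o, 'm) cat \<Rightarrow> 'o set \<Rightarrow> bool" where
  "join_closed C S \<longleftrightarrow>
    (\<forall>G \<in> Obj C. \<forall>p \<in> quotients C G. \<forall>q \<in> quotients C G. \<forall>j \<in> quotients C G.
      Cod C p \<in> S \<longrightarrow> Cod C q \<in> S \<longrightarrow>
      least (quot_poset C G) (quot_class C j)
        (Upper (quot_poset C G) {quot_class C p, quot_class C q}) \<longrightarrow>
      Cod C j \<in> S)"

definition level_generated :: "('o, 'm) cat \<Rightarrow> 'o set \<Rightarrow> 'o set" where
  "level_generated C B =
    \<Inter> {S. iso_stable C S \<and> downward_closed C S \<and> join_closed C S \<and>
         B \<subseteq> S \<and> {G. minimal_object C G} \<subseteq> S}"

definition levels :: "('o, 'm) cat \<Rightarrow> 'o set set" where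
  "levels C = {level_generated C B |B. finite B \<and> B \<subseteq> Obj C}"

locale diamond_category = category C for C :: "('o, 'm) cat" +
  assumes finite_quotients: "G \<in> Obj C \<Longrightarrow> finite (carrier (quot_poset C G))"
    and modular_quotients: "G \<in> Obj C \<Longrightarrow> modular_lattice (quot_poset C G)"
    and finite_automorphisms: "G \<in> Obj C \<Longrightarrow> finite {f \<in> hom C G G. iso C f}"
    and finite_simple_epis: "L \<in> levels C \<Longrightarrow> G \<in> L \<Longrightarrow>
      finite {iso_class C H |H. H \<in> L \<and> (\<exists>p \<in> hom C H G. simple_epi C p)}"
    and countable_minimal: "countable (iso_class C ` {G. minimal_object C G})"

text \<open>
  The maximal quotient of \<open>G\<close> with target in \<open>S\<close>. In a diamond category it is the join of all
  quotients of \<open>G\<close> with target in \<open>S\<close>, if \<open>S\<close> is a level.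
\<close>

definition max_quotient :: "('o, 'm) cat \<Rightarrow> 'o set \<Rightarrow> 'o \<Rightarrow> 'm \<Rightarrow> bool" where
  "max_quotient C S G p \<longleftrightarrow> p \<in> quotients C G \<and> Cod C p \<in> S \<and>
    (\<forall>q \<in> quotients C G. Cod C q \<in> S \<longrightarrow> quot_le C q p)"

text \<open>The isomorphism class of the maximal quotient of \<open>G\<close> in the level \<open>L\<close>.\<close>

definition level_quotient :: "('o, 'm) cat \<Rightarrow> 'o set \<Rightarrow> 'o \<Rightarrow> 'o set" where
  "level_quotient C L G = {Cod C p |p. max_quotient C L G p}"

definition pro_iso_classes :: "('o, 'm) cat \<Rightarrow> ('o set \<Rightarrow> 'o set) set" where
  "pro_iso_classes C =
    {X \<in> (\<Pi>\<^sub>E L \<in> levels C. iso_class C ` L).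
      \<forall>L \<in> levels C. \<forall>L' \<in> levels C. L \<subseteq> L' \<longrightarrow>
        (\<forall>G \<in> X L'. level_quotient C L G = X L)}"


section \<open>Pro-objects\<close>

text \<open>
  Nonemptiness is part of the standard notion: the empty diagram would be a pro-object without
  any quotient in \<open>C\<close>.
\<close>

locale cofiltered_category = category I for I :: "('i, 'j) cat" +
  assumes nonempty: "Obj I \<noteq> {}"
    and common_source: "a \<in> Obj I \<Longrightarrow> b \<in> Obj I \<Longrightarrow>
      \<exists>c \<in> Obj I. hom I c a \<noteq> {} \<and> hom I c b \<noteq> {}"
    and equalized: "f \<in> hom I a b \<Longrightarrow> g \<in> hom I a b \<Longrightarrow>
      \<exists>c \<in> Obj I. \<exists>h \<in> hom I c a. Comp I f h = Comp I g h"

record ('i, 'j, 'o, 'm) pro_obj =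
  idx :: "('i, 'j) cat"
  on_obj :: "'i \<Rightarrow> 'o"
  on_arr :: "'j \<Rightarrow> 'm"

locale pro_object = C: category C + I: cofiltered_category "idx Y"
  for C :: "('o, 'm) cat" and Y :: "('i, 'j, 'o, 'm) pro_obj" +
  assumes on_obj: "i \<in> Obj (idx Y) \<Longrightarrow> on_obj Y i \<in> Obj C"
    and on_arr: "u \<in> hom (idx Y) i i' \<Longrightarrow> on_arr Y u \<in> hom C (on_obj Y i) (on_obj Y i')"
    and on_Ident: "i \<in> Obj (idx Y) \<Longrightarrow> on_arr Y (Ident (idx Y) i) = Ident C (on_obj Y i)"
    and on_Comp: "u \<in> hom (idx Y) i i' \<Longrightarrow> v \<in> hom (idx Y) i' i'' \<Longrightarrow>
      on_arr Y (Comp (idx Y) v u) = Comp C (on_arr Y v) (on_arr Y u)"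

text \<open>
  The colimit of the sets \<open>hom C (on_obj Y i) A\<close> over the filtered category opposite to \<open>idx Y\<close>:
  a germ is an equivalence class of pairs \<open>(i, f)\<close> with \<open>f\<close> in \<open>hom C (on_obj Y i) A\<close>.
\<close>

definition germ :: "('o, 'm) cat \<Rightarrow> ('i, 'j, 'o, 'm) pro_obj \<Rightarrow> 'i \<Rightarrow> 'm \<Rightarrow> ('i \<times> 'm) set" where
  "germ C Y i f =
    {(i', f'). i' \<in> Obj (idx Y) \<and> f' \<in> hom C (on_obj Y i') (Cod C f) \<and>
      (\<exists>k \<in> Obj (idx Y). \<exists>u \<in> hom (idx Y) k i. \<exists>v \<in> hom (idx Y) k i'.
        Comp C f (on_arr Y u) = Comp C f' (on_arr Y v))}"

definition germs :: "('o, 'm) cat \<Rightarrow> ('i, 'j, 'o, 'm) pro_obj \<Rightarrow> 'o \<Rightarrow> ('i \<times> 'm) set set" where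
  "germs C Y A = {germ C Y i f |i f. i \<in> Obj (idx Y) \<and> f \<in> hom C (on_obj Y i) A}"

text \<open>The map that \<open>g\<close> induces between two such colimits.\<close>

definition germ_post ::
  "('o, 'm) cat \<Rightarrow> ('i, 'j, 'o, 'm) pro_obj \<Rightarrow> 'm \<Rightarrow> ('i \<times> 'm) set \<Rightarrow> ('i \<times> 'm) set" where
  "germ_post C Y g a = (\<Union>(i, f) \<in> a. germ C Y i (Comp C g f))"

definition pro_hom ::
  "('o, 'm) cat \<Rightarrow> ('i, 'j, 'o, 'm) pro_obj \<Rightarrow> ('i, 'j, 'o, 'm) pro_obj \<Rightarrow>
    ('i \<Rightarrow> ('i \<times> 'm) set) set" where
  "pro_hom C Y Z =
    {\<phi> \<in> (\<Pi>\<^sub>E j \<in> Obj (idx Z). germs C Y (on_obj Z j)).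
      \<forall>w \<in> Arr (idx Z).
        \<phi> (Cod (idx Z) w) = germ_post C Y (on_arr Z w) (\<phi> (Dom (idx Z) w))}"

definition pro_ident ::
  "('o, 'm) cat \<Rightarrow> ('i, 'j, 'o, 'm) pro_obj \<Rightarrow> 'i \<Rightarrow> ('i \<times> 'm) set" where
  "pro_ident C Y = (\<lambda>i \<in> Obj (idx Y). germ C Y i (Ident C (on_obj Y i)))"

definition pro_comp ::
  "('o, 'm) cat \<Rightarrow> ('i, 'j, 'o, 'm) pro_obj \<Rightarrow> ('i, 'j, 'o, 'm) pro_obj \<Rightarrow>
    ('i \<Rightarrow> ('i \<times> 'm) set) \<Rightarrow> ('i \<Rightarrow> ('i \<times> 'm) set) \<Rightarrow> 'i \<Rightarrow> ('i \<times> 'm) set" where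
  "pro_comp C Y W \<psi> \<phi> =
    (\<lambda>k \<in> Obj (idx W). \<Union>(j, g) \<in> \<psi> k. germ_post C Y g (\<phi> j))"

text \<open>
  The category of pro-objects whose index categories have their objects in the type \<open>'i\<close> and
  their arrows in the type \<open>'j\<close>. These two types play the role of the universe that bounds
  the size of the index categories. In types of the form \<open>'o set + 'i\<close> and
  \<open>('o set \<times> 'o set) + 'j\<close>, with \<open>'i\<close> and \<open>'j\<close> arbitrary, the left summands leave room for
  the poset of levels as an index category, and the right ones for any other index category.
\<close>

definition pro_cat ::
  "('o, 'm) cat \<Rightarrow>
    (('i, 'j, 'o, 'm) pro_obj,
     ('i, 'j, 'o, 'm) pro_obj \<times> ('i, 'j, 'o, 'm) pro_obj \<times> ('i \<Rightarrow> ('i \<times> 'm) set)) cat" where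
  "pro_cat C =
    \<lparr>Obj = {Y. pro_object C Y},
     Arr = {(Y, Z, \<phi>). pro_object C Y \<and> pro_object C Z \<and> \<phi> \<in> pro_hom C Y Z},
     Dom = (\<lambda>(Y, Z, \<phi>). Y),
     Cod = (\<lambda>(Y, Z, \<phi>). Z),
     Ident = (\<lambda>Y. (Y, Y, pro_ident C Y)),
     Comp = (\<lambda>(Z', W, \<psi>) (Y, Z, \<phi>). (Y, W, pro_comp C Y W \<psi> \<phi>))\<rparr>"

text \<open>An object of \<open>C\<close> as a pro-object; \<open>undefined\<close> serves as the only index.\<close>

definition const_pro :: "('o, 'm) cat \<Rightarrow> 'o \<Rightarrow> ('i, 'j, 'o, 'm) pro_obj" where
  "const_pro C G =
    \<lparr>idx = \<lparr>Obj = {undefined}, Arr = {undefined}, Dom = (\<lambda>_. undefined), Cod = (\<lambda>_. undefined),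
            Ident = (\<lambda>_. undefined), Comp = (\<lambda>_ _. undefined)\<rparr>,
     on_obj = (\<lambda>_. G), on_arr = (\<lambda>_. Ident C G)\<rparr>"

definition small_pro_object :: "('o, 'm) cat \<Rightarrow> ('i, 'j, 'o, 'm) pro_obj \<Rightarrow> bool" where
  "small_pro_object C Y \<longleftrightarrow>
    (\<exists>Z :: ('i, 'j, 'o, 'm) pro_obj. isomorphic (pro_cat C) Y Z \<and>
      (\<forall>u \<in> Arr (idx Z). epi C (on_arr Z u)) \<and>
      (\<forall>G \<in> Obj C. finite {p \<in> hom (pro_cat C) Z (const_pro C G). epi (pro_cat C) p}))"

definition pro_level_quotient ::
  "('o, 'm) cat \<Rightarrow> 'o set \<Rightarrow> ('i, 'j, 'o, 'm) pro_obj \<Rightarrow> 'o set" where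
  "pro_level_quotient C L Y =
    {G \<in> L. \<exists>p. max_quotient (pro_cat C) (const_pro C ` L) Y p \<and>
                Cod (pro_cat C) p = const_pro C G}"

definition pro_level_quotients ::
  "('o, 'm) cat \<Rightarrow> ('i, 'j, 'o, 'm) pro_obj \<Rightarrow> 'o set \<Rightarrow> 'o set" where
  "pro_level_quotients C Y = (\<lambda>L \<in> levels C. pro_level_quotient C L Y)"

definition small_pro_classes :: "('o, 'm) cat \<Rightarrow> ('i, 'j, 'o, 'm) pro_obj set set" where
  "small_pro_classes C =
    {Y. small_pro_object C Y} //
    {(Y, Z). small_pro_object C Y \<and> small_pro_object C Z \<and> isomorphic (pro_cat C) Y Z}"


section \<open>The pro-category is a category\<close>

context category
begin

lemma hom_Obj: "f \<in> hom C A B \<Longrightarrow> A \<in> Obj C" "f \<in> hom C A B \<Longrightarrow> B \<in> Obj C"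
  using Dom_Obj Cod_Obj by (auto simp: hom_def)

end

lemma hom_Cod: "f \<in> hom C A B \<Longrightarrow> Cod C f = B"
  by (simp add: hom_def)

context pro_object
begin

abbreviation "I \<equiv> idx Y"

lemma common_source3:
  assumes "f \<in> hom C (on_obj Y i) A" and "u \<in> hom I k i" and "v \<in> hom I k' i"
  obtains l a b where "l \<in> Obj I" "a \<in> hom I l k" "b \<in> hom I l k'"
    "Comp I u a = Comp I v b"
proof -
  have k: "k \<in> Obj I" "k' \<in> Obj I" using assms I.hom_Obj by blast+
  obtain c a b where c: "c \<in> Obj I" "a \<in> hom I c k" "b \<in> hom I c k'"
    using I.common_source[OF k] by blast
  have "Comp I u a \<in> hom I c i" "Comp I v b \<in> hom I c i"
    using I.Comp_hom c assms by blast+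
  then obtain d h where d: "d \<in> Obj I" "h \<in> hom I d c"
    "Comp I (Comp I u a) h = Comp I (Comp I v b) h"
    using I.equalized by blast
  have "Comp I u (Comp I a h) = Comp I v (Comp I b h)"
    using d c assms I.Comp_assoc by metis
  moreover have "Comp I a h \<in> hom I d k" "Comp I b h \<in> hom I d k'"
    using d c I.Comp_hom by blast+
  ultimately show ?thesis using that d by blast
qed

lemma germ_self:
  assumes "i \<in> Obj I" "f \<in> hom C (on_obj Y i) A"
  shows "(i, f) \<in> germ C Y i f"
proof -
  have "Ident I i \<in> hom I i i" using assms I.Ident_hom by blast
  thus ?thesis using assms hom_Cod[OF assms(2)] unfolding germ_def by auto
qed

lemma germ_memD:
  assumes "f \<in> hom C (on_obj Y i) A" "(i', f') \<in> germ C Y i f"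
  shows "i' \<in> Obj I" "f' \<in> hom C (on_obj Y i') A"
  using assms hom_Cod[OF assms(1)] unfolding germ_def by auto

lemma germ_sym:
  assumes f: "f \<in> hom C (on_obj Y i) A" and i: "i \<in> Obj I" and m: "(i', f') \<in> germ C Y i f"
  shows "(i, f) \<in> germ C Y i' f'"
proof -
  have "f' \<in> hom C (on_obj Y i') A" using germ_memD[OF f m] by blast
  hence c: "Cod C f' = A" using hom_Cod by metis
  from m obtain k u v where "k \<in> Obj I" "u \<in> hom I k i" "v \<in> hom I k i'"
    "Comp C f (on_arr Y u) = Comp C f' (on_arr Y v)"
    unfolding germ_def by auto
  thus ?thesis using f i c unfolding germ_def by force
qed

lemma germ_trans:
  assumes f: "f \<in> hom C (on_obj Y i) A" and i: "i \<in> Obj I" and m: "(i', f') \<in> germ C Y i f"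
    and n: "(i'', f'') \<in> germ C Y i' f'"
  shows "(i'', f'') \<in> germ C Y i f"
proof -
  have f': "f' \<in> hom C (on_obj Y i') A" using germ_memD[OF f m] by blast
  have f'': "f'' \<in> hom C (on_obj Y i'') A" "i'' \<in> Obj I" using germ_memD[OF f' n] by blast+
  from m obtain k u v where k: "k \<in> Obj I" "u \<in> hom I k i" "v \<in> hom I k i'"
    "Comp C f (on_arr Y u) = Comp C f' (on_arr Y v)"
    unfolding germ_def by auto
  from n obtain k' u' v' where k': "k' \<in> Obj I" "u' \<in> hom I k' i'" "v' \<in> hom I k' i''"
    "Comp C f' (on_arr Y u') = Comp C f'' (on_arr Y v')"
    unfolding germ_def by auto
  obtain l a b where l: "l \<in> Obj I" "a \<in> hom I l k" "b \<in> hom I l k'"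
    "Comp I v a = Comp I u' b"
    using common_source3[OF f' k(3) k'(2)] .
  have "Comp C f (on_arr Y (Comp I u a)) = Comp C (Comp C f (on_arr Y u)) (on_arr Y a)"
    using on_Comp[OF l(2) k(2)] C.Comp_assoc[OF on_arr[OF l(2)] on_arr[OF k(2)] f] by simp
  also have "\<dots> = Comp C f' (on_arr Y (Comp I v a))"
    using k(4) on_Comp[OF l(2) k(3)] C.Comp_assoc[OF on_arr[OF l(2)] on_arr[OF k(3)] f'] by simp
  also have "\<dots> = Comp C (Comp C f' (on_arr Y u')) (on_arr Y b)"
    using l(4) on_Comp[OF l(3) k'(2)] C.Comp_assoc[OF on_arr[OF l(3)] on_arr[OF k'(2)] f'] by simp
  also have "\<dots> = Comp C f'' (on_arr Y (Comp I v' b))"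
    using k'(4) on_Comp[OF l(3) k'(3)] C.Comp_assoc[OF on_arr[OF l(3)] on_arr[OF k'(3)] f''(1)]
    by simp
  finally have "Comp C f (on_arr Y (Comp I u a)) = Comp C f'' (on_arr Y (Comp I v' b))" .
  moreover have "Comp I u a \<in> hom I l i" "Comp I v' b \<in> hom I l i''"
    using I.Comp_hom l k k' by blast+
  ultimately show ?thesis using l(1) f'' hom_Cod[OF f] unfolding germ_def by auto
qed

lemma germ_eqI:
  assumes f: "f \<in> hom C (on_obj Y i) A" and i: "i \<in> Obj I" and m: "(i', f') \<in> germ C Y i f"
  shows "germ C Y i' f' = germ C Y i f"
proof -
  note f' = germ_memD[OF f m]
  note m' = germ_sym[OF f i m]
  show ?thesis
    using germ_trans[OF f i m] germ_trans[OF f'(2) f'(1) m'] by auto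
qed

lemma germ_precomp:
  assumes f: "f \<in> hom C (on_obj Y i) A" and i: "i \<in> Obj I" and u: "u \<in> hom I k i"
  shows "germ C Y k (Comp C f (on_arr Y u)) = germ C Y i f"
proof (rule germ_eqI[OF f i])
  have k: "k \<in> Obj I" using I.hom_Obj u by blast
  have h: "Comp C f (on_arr Y u) \<in> hom C (on_obj Y k) A" using C.Comp_hom on_arr u f by blast
  have "Comp C f (on_arr Y u) = Comp C (Comp C f (on_arr Y u)) (on_arr Y (Ident I k))"
    using on_Ident k C.Comp_Ident_right[OF h] by simp
  thus "(k, Comp C f (on_arr Y u)) \<in> germ C Y i f"
    using k u h I.Ident_hom[OF k] hom_Cod[OF f] unfolding germ_def by auto
qed

lemma germ_post_mem:
  assumes f: "f \<in> hom C (on_obj Y i) A" and i: "i \<in> Obj I" and m: "(i', f') \<in> germ C Y i f"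
    and g: "g \<in> hom C A B"
  shows "germ C Y i' (Comp C g f') = germ C Y i (Comp C g f)"
proof -
  note f' = germ_memD[OF f m]
  from m obtain k u v where k: "k \<in> Obj I" "u \<in> hom I k i" "v \<in> hom I k i'"
    "Comp C f (on_arr Y u) = Comp C f' (on_arr Y v)"
    unfolding germ_def by auto
  have "germ C Y i (Comp C g f) = germ C Y k (Comp C (Comp C g f) (on_arr Y u))"
    using germ_precomp[OF C.Comp_hom[OF f g] i k(2)] by simp
  also have "\<dots> = germ C Y k (Comp C (Comp C g f') (on_arr Y v))"
    using k(4) C.Comp_assoc[OF on_arr[OF k(2)] f g] C.Comp_assoc[OF on_arr[OF k(3)] f'(2) g]
    by simp
  also have "\<dots> = germ C Y i' (Comp C g f')"
    using germ_precomp[OF C.Comp_hom[OF f'(2) g] f'(1) k(3)] by simp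
  finally show ?thesis by simp
qed

lemma germ_post_germ:
  assumes f: "f \<in> hom C (on_obj Y i) A" and i: "i \<in> Obj I" and g: "g \<in> hom C A B"
  shows "germ_post C Y g (germ C Y i f) = germ C Y i (Comp C g f)"
proof -
  have "(case x of (i', f') \<Rightarrow> germ C Y i' (Comp C g f')) = germ C Y i (Comp C g f)"
    if "x \<in> germ C Y i f" for x
    using germ_post_mem[OF f i _ g] that by (cases x) simp
  thus ?thesis using germ_self[OF i f] unfolding germ_post_def by (intro UN_constant_eq) auto
qed

lemma germsE:
  assumes "a \<in> germs C Y A"
  obtains i f where "i \<in> Obj I" "f \<in> hom C (on_obj Y i) A" "a = germ C Y i f"
  using assms unfolding germs_def by blast

lemma germsI: "i \<in> Obj I \<Longrightarrow> f \<in> hom C (on_obj Y i) A \<Longrightarrow> germ C Y i f \<in> germs C Y A"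
  unfolding germs_def by blast

lemma germ_post_germs:
  assumes "a \<in> germs C Y A" "g \<in> hom C A B"
  shows "germ_post C Y g a \<in> germs C Y B"
proof -
  obtain i f where f: "i \<in> Obj I" "f \<in> hom C (on_obj Y i) A" and a: "a = germ C Y i f"
    using germsE[OF assms(1)] .
  show ?thesis
    using germ_post_germ[OF f(2,1) assms(2)] germsI[OF f(1) C.Comp_hom[OF f(2) assms(2)]] a by simp
qed

lemma germ_post_comp:
  assumes "a \<in> germs C Y A" "g \<in> hom C A B" "h \<in> hom C B D"
  shows "germ_post C Y h (germ_post C Y g a) = germ_post C Y (Comp C h g) a"
proof -
  obtain i f where f: "i \<in> Obj I" "f \<in> hom C (on_obj Y i) A" and a: "a = germ C Y i f"
    using germsE[OF assms(1)] .
  show ?thesis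
    using germ_post_germ[OF f(2,1) assms(2)]
      germ_post_germ[OF C.Comp_hom[OF f(2) assms(2)] f(1) assms(3)]
      germ_post_germ[OF f(2,1) C.Comp_hom[OF assms(2,3)]] C.Comp_assoc[OF f(2) assms(2,3)] a
    by simp
qed

lemma pro_ident_hom: "pro_ident C Y \<in> pro_hom C Y Y"
proof -
  have "pro_ident C Y (Cod I w) = germ_post C Y (on_arr Y w) (pro_ident C Y (Dom I w))"
    if w: "w \<in> Arr I" for w
  proof -
    have h: "w \<in> hom I (Dom I w) (Cod I w)" using w by (simp add: hom_def)
    note o = I.hom_Obj[OF h] and h' = on_arr[OF h]
    note i = C.Ident_hom[OF on_obj[OF o(1)]] C.Ident_hom[OF on_obj[OF o(2)]]
    have "germ_post C Y (on_arr Y w) (pro_ident C Y (Dom I w)) = germ C Y (Dom I w) (on_arr Y w)"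
      using germ_post_germ[OF i(1) o(1) h'] C.Comp_Ident_right[OF h'] o by (simp add: pro_ident_def)
    also have "\<dots> = germ C Y (Cod I w) (Ident C (on_obj Y (Cod I w)))"
      using germ_precomp[OF i(2) o(2) h] C.Comp_Ident_left[OF h'] by simp
    finally show ?thesis using o by (simp add: pro_ident_def)
  qed
  moreover have "pro_ident C Y \<in> (\<Pi>\<^sub>E j \<in> Obj I. germs C Y (on_obj Y j))"
    using germsI C.Ident_hom on_obj unfolding pro_ident_def by auto
  ultimately show ?thesis unfolding pro_hom_def by blast
qed

end

lemma pro_homD:
  assumes "\<phi> \<in> pro_hom C Y Z"
  shows "j \<in> Obj (idx Z) \<Longrightarrow> \<phi> j \<in> germs C Y (on_obj Z j)"
    and "w \<in> hom (idx Z) j j' \<Longrightarrow> \<phi> j' = germ_post C Y (on_arr Z w) (\<phi> j)"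
    and "\<phi> \<in> extensional (Obj (idx Z))"
  using assms unfolding pro_hom_def hom_def by (auto simp: PiE_iff)

lemma pro_comp_germ:
  assumes Y: "pro_object C Y" and Z: "pro_object C Z" and \<phi>: "\<phi> \<in> pro_hom C Y Z"
    and k: "k \<in> Obj (idx W)" and j: "j \<in> Obj (idx Z)" and g: "g \<in> hom C (on_obj Z j) B"
    and \<psi>: "\<psi> k = germ C Z j g"
  shows "pro_comp C Y W \<psi> \<phi> k = germ_post C Y g (\<phi> j)"
proof -
  interpret Y: pro_object C Y by fact
  interpret Z: pro_object C Z by fact
  have "germ_post C Y g' (\<phi> j') = germ_post C Y g (\<phi> j)" if m: "(j', g') \<in> germ C Z j g" for j' g'
  proof -
    note g' = Z.germ_memD[OF g m]
    from m obtain l u v where l: "l \<in> Obj Z.I" "u \<in> hom Z.I l j" "v \<in> hom Z.I l j'"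
      "Comp C g (on_arr Z u) = Comp C g' (on_arr Z v)"
      unfolding germ_def by auto
    have "germ_post C Y g (\<phi> j) = germ_post C Y (Comp C g (on_arr Z u)) (\<phi> l)"
      using pro_homD(2)[OF \<phi> l(2)]
        Y.germ_post_comp[OF pro_homD(1)[OF \<phi> l(1)] Z.on_arr[OF l(2)] g] by simp
    also have "\<dots> = germ_post C Y g' (\<phi> j')"
      using l(4) pro_homD(2)[OF \<phi> l(3)]
        Y.germ_post_comp[OF pro_homD(1)[OF \<phi> l(1)] Z.on_arr[OF l(3)] g'(2)] by simp
    finally show ?thesis by simp
  qed
  hence "(case x of (j', g') \<Rightarrow> germ_post C Y g' (\<phi> j')) = germ_post C Y g (\<phi> j)"
    if "x \<in> germ C Z j g" for x
    using that by (cases x) simp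
  hence "(\<Union>(j', g') \<in> germ C Z j g. germ_post C Y g' (\<phi> j')) = germ_post C Y g (\<phi> j)"
    using Z.germ_self[OF j g] by (intro UN_constant_eq) auto
  thus ?thesis using k \<psi> unfolding pro_comp_def by simp
qed

lemma pro_comp_post:
  assumes Y: "pro_object C Y" and Z: "pro_object C Z" and \<phi>: "\<phi> \<in> pro_hom C Y Z"
    and a: "a \<in> germs C Z A" and h: "h \<in> hom C A B"
  shows "(\<Union>(j, g) \<in> germ_post C Z h a. germ_post C Y g (\<phi> j)) =
    germ_post C Y h (\<Union>(j, g) \<in> a. germ_post C Y g (\<phi> j))"
    and "(\<Union>(j, g) \<in> a. germ_post C Y g (\<phi> j)) \<in> germs C Y A"
proof -
  interpret Y: pro_object C Y by fact
  interpret Z: pro_object C Z by fact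
  obtain j g where j: "j \<in> Obj Z.I" and g: "g \<in> hom C (on_obj Z j) A" and a: "a = germ C Z j g"
    using Z.germsE[OF a] .
  note hg = Y.C.Comp_hom[OF g h]
  note pj = pro_homD(1)[OF \<phi> j]
  have 1: "(\<Union>(j, g) \<in> a. germ_post C Y g (\<phi> j)) = germ_post C Y g (\<phi> j)"
    using pro_comp_germ[OF Y Z \<phi> j j g, of "\<lambda>_. a"] j a by (simp add: pro_comp_def)
  have 2: "(\<Union>(j, g) \<in> germ_post C Z h a. germ_post C Y g (\<phi> j)) =
      germ_post C Y (Comp C h g) (\<phi> j)"
    using pro_comp_germ[OF Y Z \<phi> j j hg, of "\<lambda>_. germ_post C Z h a"] j
      Z.germ_post_germ[OF g j h] a by (simp add: pro_comp_def)
  show "(\<Union>(j, g) \<in> germ_post C Z h a. germ_post C Y g (\<phi> j)) =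
    germ_post C Y h (\<Union>(j, g) \<in> a. germ_post C Y g (\<phi> j))"
    using 1 2 Y.germ_post_comp[OF pj g h] by simp
  show "(\<Union>(j, g) \<in> a. germ_post C Y g (\<phi> j)) \<in> germs C Y A"
    using 1 Y.germ_post_germs[OF pj g] by simp
qed

lemma pro_comp_hom:
  assumes Y: "pro_object C Y" and Z: "pro_object C Z" and W: "pro_object C W"
    and \<phi>: "\<phi> \<in> pro_hom C Y Z" and \<psi>: "\<psi> \<in> pro_hom C Z W"
  shows "pro_comp C Y W \<psi> \<phi> \<in> pro_hom C Y W"
proof -
  interpret W: pro_object C W by fact
  have k: "pro_comp C Y W \<psi> \<phi> k = (\<Union>(j, g) \<in> \<psi> k. germ_post C Y g (\<phi> j))"
    if "k \<in> Obj W.I" for k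
    using that by (simp add: pro_comp_def)
  have 1: "pro_comp C Y W \<psi> \<phi> \<in> (\<Pi>\<^sub>E k \<in> Obj W.I. germs C Y (on_obj W k))"
    using pro_comp_post(2)[OF Y Z \<phi> pro_homD(1)[OF \<psi>]] W.C.Ident_hom[OF W.on_obj]
    unfolding PiE_iff by (auto simp: k) (simp add: pro_comp_def)
  have "pro_comp C Y W \<psi> \<phi> (Cod W.I w) =
      germ_post C Y (on_arr W w) (pro_comp C Y W \<psi> \<phi> (Dom W.I w))" if w: "w \<in> Arr W.I" for w
  proof -
    have h: "w \<in> hom W.I (Dom W.I w) (Cod W.I w)" using w by (simp add: hom_def)
    note o = W.I.hom_Obj[OF h]
    show ?thesis
      using pro_comp_post(1)[OF Y Z \<phi> pro_homD(1)[OF \<psi> o(1)] W.on_arr[OF h]]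
        pro_homD(2)[OF \<psi> h] by (simp add: k o)
  qed
  with 1 show ?thesis unfolding pro_hom_def by blast
qed

lemma pro_comp_assoc:
  assumes Y: "pro_object C Y" and Z: "pro_object C Z" and W: "pro_object C W"
    and V: "pro_object C V"
    and \<phi>: "\<phi> \<in> pro_hom C Y Z" and \<psi>: "\<psi> \<in> pro_hom C Z W" and \<chi>: "\<chi> \<in> pro_hom C W V"
  shows "pro_comp C Y V \<chi> (pro_comp C Y W \<psi> \<phi>) = pro_comp C Y V (pro_comp C Z V \<chi> \<psi>) \<phi>"
proof (rule ext)
  fix l
  interpret W: pro_object C W by fact
  show "pro_comp C Y V \<chi> (pro_comp C Y W \<psi> \<phi>) l = pro_comp C Y V (pro_comp C Z V \<chi> \<psi>) \<phi> l"
  proof (cases "l \<in> Obj (idx V)")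
    case False
    thus ?thesis by (simp add: pro_comp_def)
  next
    case l: True
    obtain k h where k: "k \<in> Obj W.I" and h: "h \<in> hom C (on_obj W k) (on_obj V l)"
      and c: "\<chi> l = germ C W k h"
      using W.germsE[OF pro_homD(1)[OF \<chi> l]] .
    have "pro_comp C Y V \<chi> (pro_comp C Y W \<psi> \<phi>) l = germ_post C Y h (pro_comp C Y W \<psi> \<phi> k)"
      using pro_comp_germ[where \<psi> = \<chi>, OF Y W pro_comp_hom[OF Y Z W \<phi> \<psi>] l k h c] .
    also have "\<dots> = (\<Union>(j, g) \<in> germ_post C Z h (\<psi> k). germ_post C Y g (\<phi> j))"
      using pro_comp_post(1)[OF Y Z \<phi> pro_homD(1)[OF \<psi> k] h] k by (simp add: pro_comp_def)
    also have "germ_post C Z h (\<psi> k) = pro_comp C Z V \<chi> \<psi> l"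
      using pro_comp_germ[where \<psi> = \<chi>, OF Z W \<psi> l k h c] by simp
    finally show ?thesis using l by (simp add: pro_comp_def)
  qed
qed

lemma pro_comp_ident_left:
  assumes Y: "pro_object C Y" and Z: "pro_object C Z" and \<phi>: "\<phi> \<in> pro_hom C Y Z"
  shows "pro_comp C Y Z (pro_ident C Z) \<phi> = \<phi>"
proof (rule extensionalityI[of _ "Obj (idx Z)"])
  interpret Y: pro_object C Y by fact
  interpret Z: pro_object C Z by fact
  show "pro_comp C Y Z (pro_ident C Z) \<phi> \<in> extensional (Obj Z.I)"
    by (simp add: pro_comp_def)
  show "\<phi> \<in> extensional (Obj Z.I)" using pro_homD(3)[OF \<phi>] .
  fix j assume j: "j \<in> Obj Z.I"
  note i = Y.C.Ident_hom[OF Z.on_obj[OF j]]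
  obtain k f where k: "k \<in> Obj Y.I" "f \<in> hom C (on_obj Y k) (on_obj Z j)" "\<phi> j = germ C Y k f"
    using Y.germsE[OF pro_homD(1)[OF \<phi> j]] .
  have "pro_comp C Y Z (pro_ident C Z) \<phi> j = germ_post C Y (Ident C (on_obj Z j)) (\<phi> j)"
    using pro_comp_germ[OF Y Z \<phi> j j i] j by (simp add: pro_ident_def)
  also have "\<dots> = \<phi> j"
    using k Y.germ_post_germ[OF k(2,1) i] Y.C.Comp_Ident_left[OF k(2)] by simp
  finally show "pro_comp C Y Z (pro_ident C Z) \<phi> j = \<phi> j" .
qed

lemma pro_comp_ident_right:
  assumes Y: "pro_object C Y" and Z: "pro_object C Z" and \<phi>: "\<phi> \<in> pro_hom C Y Z"
  shows "pro_comp C Y Z \<phi> (pro_ident C Y) = \<phi>"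
proof (rule extensionalityI[of _ "Obj (idx Z)"])
  interpret Y: pro_object C Y by fact
  interpret Z: pro_object C Z by fact
  show "pro_comp C Y Z \<phi> (pro_ident C Y) \<in> extensional (Obj Z.I)"
    by (simp add: pro_comp_def)
  show "\<phi> \<in> extensional (Obj Z.I)" using pro_homD(3)[OF \<phi>] .
  fix j assume j: "j \<in> Obj Z.I"
  obtain k f where k: "k \<in> Obj Y.I" "f \<in> hom C (on_obj Y k) (on_obj Z j)" "\<phi> j = germ C Y k f"
    using Y.germsE[OF pro_homD(1)[OF \<phi> j]] .
  note i = Y.C.Ident_hom[OF Y.on_obj[OF k(1)]]
  have "pro_comp C Y Z \<phi> (pro_ident C Y) j = germ_post C Y f (pro_ident C Y k)"
    using pro_comp_germ[where \<psi> = \<phi>, OF Y Y Y.pro_ident_hom j k(1,2,3)] .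
  also have "\<dots> = germ C Y k f"
    using k Y.germ_post_germ[OF i k(1,2)] Y.C.Comp_Ident_right[OF k(2)]
    by (simp add: pro_ident_def)
  finally show "pro_comp C Y Z \<phi> (pro_ident C Y) j = \<phi> j" using k(3) by simp
qed

lemma pro_cat_hom:
  "p \<in> hom (pro_cat C) Y Z \<longleftrightarrow>
    (\<exists>\<phi> \<in> pro_hom C Y Z. pro_object C Y \<and> pro_object C Z \<and> p = (Y, Z, \<phi>))"
  by (auto simp: hom_def pro_cat_def)

lemma category_pro_cat: "category (pro_cat C)"
proof (unfold_locales, goal_cases)
  case (1 f) thus ?case by (auto simp: pro_cat_def)
next
  case (2 f) thus ?case by (auto simp: pro_cat_def)
next
  case (3 A) thus ?case
    unfolding pro_cat_hom by (auto simp: pro_cat_def pro_object.pro_ident_hom)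
next
  case (4 f A B g D) thus ?case
    unfolding pro_cat_hom using pro_comp_hom by (fastforce simp: pro_cat_def)
next
  case (5 f A B) thus ?case
    unfolding pro_cat_hom using pro_comp_ident_right by (fastforce simp: pro_cat_def)
next
  case (6 f A B) thus ?case
    unfolding pro_cat_hom using pro_comp_ident_left by (fastforce simp: pro_cat_def)
next
  case (7 f A B g D h E) thus ?case
    unfolding pro_cat_hom using pro_comp_assoc by (fastforce simp: pro_cat_def)
qed

lemma pro_object_const_pro:
  assumes "category C" "G \<in> Obj C"
  shows "pro_object C (const_pro C G)"
proof -
  interpret category C by fact
  have "category (idx (const_pro C G))"
    by unfold_locales (auto simp: const_pro_def hom_def)
  hence "cofiltered_category (idx (const_pro C G))"
    unfolding cofiltered_category_def cofiltered_category_axioms_def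
    by (auto simp: const_pro_def hom_def)
  moreover have "pro_object_axioms C (const_pro C G)"
    using assms(2) Ident_hom[OF assms(2)] Comp_Ident_left[OF Ident_hom[OF assms(2)]]
    unfolding pro_object_axioms_def by (auto simp: const_pro_def)
  ultimately show ?thesis using assms(1) unfolding pro_object_def by blast
qed

end

theory Submission
  imports Defs "HOL-Analysis.Function_Topology"
begin

text \<open>
  A map from a pro-object \<open>Y\<close> to an object \<open>G\<close> of \<open>C\<close> is a germ, and it is an epimorphism of
  pro-objects if and only if it can be cancelled against arrows of \<open>C\<close> (\<open>epi_to_const_iff\<close>). If
  the transition maps of \<open>Y\<close> are epimorphisms, then finitely many quotients of \<open>Y\<close> are quotients
  of a single object of \<open>C\<close>. All arguments about them thus take place in the finite modular
  lattice of quotients of one object.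

  A small pro-object \<open>Y\<close> determines a pro-isomorphism class. The point is the existence of a
  maximal quotient in a level \<open>L\<close>. The quotients of \<open>Y\<close> in \<open>L\<close> are directed, and it must be
  shown that they do not grow indefinitely. An object has socle length at most \<open>k\<close> if its lattice
  of quotients can be climbed from bottom to top in \<open>k\<close> steps with complemented intervals, as in
  the Loewy series of a module. In a modular lattice the elements of socle length at most \<open>k\<close> form
  an ideal. Hence socle length is bounded on a level, which has finitely many generators
  (\<open>level_bounded_socle_length\<close>). On the other hand, let \<open>S\<close> be a quotient of \<open>Y\<close> in \<open>L\<close> above
  all those of length at most \<open>k\<close>. Up to isomorphism there are finitely many simple epimorphisms
  \<open>T \<rightarrow> S\<close> in \<open>L\<close>, and \<open>Y\<close> has finitely many epimorphisms to each \<open>T\<close>. An upper bound of \<open>S\<close>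
  and all these quotients \<open>T\<close> is above all quotients of length at most \<open>k + 1\<close>
  (\<open>ex_dominates_Suc\<close>). So the bound on \<open>L\<close> is reached after finitely many steps.

  A pro-isomorphism class \<open>X\<close> is realized. Choose an object \<open>obj L\<close> in the class \<open>X L\<close> for each
  level \<open>L\<close>. Between \<open>obj L'\<close> and \<open>obj L\<close> with \<open>L \<subseteq> L'\<close> there are finitely many maximal quotient
  maps, and they can be chosen functorially below any given level. By compactness they can be
  chosen functorially everywhere (\<open>ex_level_system\<close>). The diagram over the directed set of levels
  is the required pro-object.

  It is unique. For a small pro-object \<open>Z\<close> with the same level quotients, compactness yields
  compatible maximal quotient maps from \<open>Z\<close> to all \<open>obj L\<close>. Every object of \<open>C\<close> lies in some level
  \<open>L\<close>, so every quotient map from \<open>Z\<close> to it factors through \<open>obj L\<close>. This gives the inverse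
  morphism (\<open>isomorphic_limit\<close>).
\<close>

section \<open>Finitary constraints on finite domains\<close>

text \<open>
  By Tychonoff's theorem the product of the finite discrete spaces \<open>D v\<close> is compact, and a
  constraint on finitely many coordinates cuts out a closed subset of it. All compatible choices
  below, of maps between objects and of maps out of a pro-object, come from this.
\<close>

lemma finite_constraint_compactness:
  fixes D :: "'v \<Rightarrow> 'a set" and s :: "'c \<Rightarrow> 'v set" and P :: "'c \<Rightarrow> ('v \<Rightarrow> 'a) \<Rightarrow> bool"
  assumes finD: "\<And>v. v \<in> V \<Longrightarrow> finite (D v)"
    and s: "\<And>c. c \<in> K \<Longrightarrow> finite (s c)" "\<And>c. c \<in> K \<Longrightarrow> s c \<subseteq> V"
    and P: "\<And>c f g. c \<in> K \<Longrightarrow> (\<forall>v \<in> s c. f v = g v) \<Longrightarrow> P c f \<Longrightarrow> P c g"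
    and sat: "\<And>F. finite F \<Longrightarrow> F \<subseteq> K \<Longrightarrow> \<exists>f \<in> Pi\<^sub>E V D. \<forall>c \<in> F. P c f"
  shows "\<exists>f \<in> Pi\<^sub>E V D. \<forall>c \<in> K. P c f"
proof -
  let ?X = "product_topology (\<lambda>v. discrete_topology (D v)) V"
  let ?S = "\<lambda>c. {f \<in> Pi\<^sub>E V D. P c f}"
  have top: "topspace ?X = Pi\<^sub>E V D" by simp
  have closed: "closedin ?X (?S c)" if c: "c \<in> K" for c
  proof -
    have "openin ?X (Pi\<^sub>E V D - ?S c)"
    proof (subst openin_subopen, intro ballI)
      fix f assume f: "f \<in> Pi\<^sub>E V D - ?S c"
      \<comment> \<open>Fixing the finitely many coordinates in the support of \<open>c\<close> gives an open box.\<close>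
      let ?T = "\<lambda>v. if v \<in> s c then {f v} else D v"
      have "openin ?X (Pi\<^sub>E V ?T)"
      proof (rule product_topology_basis)
        show "openin (discrete_topology (D v)) (?T v)" for v
          using f s(2)[OF c] by (auto simp: PiE_iff)
        show "finite {v. ?T v \<noteq> topspace (discrete_topology (D v))}"
          by (rule finite_subset[OF _ s(1)[OF c]]) auto
      qed
      moreover have "f \<in> Pi\<^sub>E V ?T" using f by (auto simp: PiE_iff)
      moreover have "Pi\<^sub>E V ?T \<subseteq> Pi\<^sub>E V D - ?S c"
      proof
        fix g assume g: "g \<in> Pi\<^sub>E V ?T"
        have agree: "\<forall>v \<in> s c. g v = f v"
        proof
          fix v assume "v \<in> s c"
          thus "g v = f v" using PiE_mem[OF g, of v] s(2)[OF c] by auto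
        qed
        have "g v \<in> D v" if "v \<in> V" for v
          using PiE_mem[OF g that] PiE_mem[of f V D v] f that by (auto split: if_splits)
        hence "g \<in> Pi\<^sub>E V D" using PiE_arb[OF g] by (auto simp: PiE_iff extensional_def)
        moreover have "\<not> P c g" using P[OF c agree] f by blast
        ultimately show "g \<in> Pi\<^sub>E V D - ?S c" by blast
      qed
      ultimately show "\<exists>U. openin ?X U \<and> f \<in> U \<and> U \<subseteq> Pi\<^sub>E V D - ?S c" by blast
    qed
    thus ?thesis unfolding closedin_def top by blast
  qed
  have cpt: "compact_space ?X"
    using finD by (simp add: compact_space_product_topology compact_space_discrete_topology)
  have "\<Inter> (insert (Pi\<^sub>E V D) (?S ` K)) \<noteq> {}"
  proof (rule compact_space_fip[THEN iffD1, OF cpt, rule_format], intro conjI ballI allI impI)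
    fix A assume "A \<in> insert (Pi\<^sub>E V D) (?S ` K)"
    thus "closedin ?X A" using closed closedin_topspace[of ?X] by auto
  next
    fix \<F> assume F: "finite \<F> \<and> \<F> \<subseteq> insert (Pi\<^sub>E V D) (?S ` K)"
    hence "finite (\<F> - {Pi\<^sub>E V D})" "\<F> - {Pi\<^sub>E V D} \<subseteq> ?S ` K" by auto
    then obtain F' where F': "F' \<subseteq> K" "finite F'" "\<F> - {Pi\<^sub>E V D} = ?S ` F'"
      by (meson finite_subset_image)
    obtain f where f: "f \<in> Pi\<^sub>E V D" "\<forall>c \<in> F'. P c f" using bexE[OF sat[OF F'(2,1)]] .
    have "f \<in> A" if "A \<in> \<F>" for A
    proof (cases "A = Pi\<^sub>E V D")
      case False
      hence "A \<in> \<F> - {Pi\<^sub>E V D}" using that by simp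
      then obtain c where "c \<in> F'" "A = ?S c" unfolding F'(3) by (rule imageE)
      thus ?thesis using f by simp
    qed (use f in simp)
    thus "\<Inter> \<F> \<noteq> {}" by blast
  qed
  thus ?thesis by auto
qed

section \<open>Socle length in finite modular lattices\<close>

definition covers :: "('a, 'b) gorder_scheme \<Rightarrow> 'a \<Rightarrow> 'a \<Rightarrow> bool" where
  "covers L b x \<longleftrightarrow> b \<in> carrier L \<and> x \<in> carrier L \<and> b \<sqsubseteq>\<^bsub>L\<^esub> x \<and> b \<noteq> x \<and>
    (\<forall>z \<in> carrier L. b \<sqsubseteq>\<^bsub>L\<^esub> z \<longrightarrow> z \<sqsubseteq>\<^bsub>L\<^esub> x \<longrightarrow> z = b \<or> z = x)"

text \<open>
  In the lattice of submodules of a module this says that \<open>a / b\<close> is semisimple.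
\<close>

definition complemented_interval :: "('a, 'b) gorder_scheme \<Rightarrow> 'a \<Rightarrow> 'a \<Rightarrow> bool" where
  "complemented_interval L b a \<longleftrightarrow> b \<in> carrier L \<and> a \<in> carrier L \<and> b \<sqsubseteq>\<^bsub>L\<^esub> a \<and>
    (\<forall>x \<in> carrier L. b \<sqsubseteq>\<^bsub>L\<^esub> x \<longrightarrow> x \<sqsubseteq>\<^bsub>L\<^esub> a \<longrightarrow>
      (\<exists>y \<in> carrier L. b \<sqsubseteq>\<^bsub>L\<^esub> y \<and> y \<sqsubseteq>\<^bsub>L\<^esub> a \<and> x \<sqinter>\<^bsub>L\<^esub> y = b \<and> x \<squnion>\<^bsub>L\<^esub> y = a))"

text \<open>
  A chain from the bottom to \<open>a\<close> with \<open>k\<close> semisimple steps. For submodules this bounds the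
  Loewy length; the number \<open>k\<close>, unlike the length of a composition series, does not grow when
  joins are formed.
\<close>

fun socle_length_le :: "('a, 'b) gorder_scheme \<Rightarrow> nat \<Rightarrow> 'a \<Rightarrow> bool" where
  "socle_length_le L 0 a \<longleftrightarrow> a \<in> carrier L \<and> (\<forall>x \<in> carrier L. a \<sqsubseteq>\<^bsub>L\<^esub> x)"
| "socle_length_le L (Suc k) a \<longleftrightarrow>
    (\<exists>b. socle_length_le L k b \<and> complemented_interval L b a)"

locale finite_modular_lattice = modular_lattice +
  assumes finite_carrier: "finite (carrier L)"
begin

lemma join_eqI:
  assumes "x \<in> carrier L" "y \<in> carrier L" "a \<in> carrier L" "x \<sqsubseteq> a" "y \<sqsubseteq> a" "a \<sqsubseteq> x \<squnion> y"
  shows "x \<squnion> y = a"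
  using assms join_le le_antisym by auto

lemma meet_eqI:
  assumes "x \<in> carrier L" "y \<in> carrier L" "a \<in> carrier L" "a \<sqsubseteq> x" "a \<sqsubseteq> y" "x \<sqinter> y \<sqsubseteq> a"
  shows "x \<sqinter> y = a"
  using assms meet_le le_antisym by auto

text \<open>
  Upper semimodularity. An element \<open>z\<close> between \<open>c\<close> and \<open>x \<squnion> c\<close> is determined by
  \<open>x \<sqinter> z\<close>, because \<open>z = c \<squnion> (x \<sqinter> z)\<close> by the modular law, and there are only two
  possibilities for \<open>x \<sqinter> z\<close>.
\<close>

lemma covers_join:
  assumes x: "covers L b x" and c: "c \<in> carrier L" "b \<sqsubseteq> c"
  shows "x \<squnion> c = c \<or> covers L c (x \<squnion> c)"
proof -
  have b: "b \<in> carrier L" and xc: "x \<in> carrier L" and bx: "b \<sqsubseteq> x" using x by (auto simp: covers_def)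
  have j: "x \<squnion> c \<in> carrier L" using xc c by simp
  have "z = c \<or> z = x \<squnion> c" if z: "z \<in> carrier L" "c \<sqsubseteq> z" "z \<sqsubseteq> x \<squnion> c" for z
  proof -
    have m: "x \<sqinter> z \<in> carrier L" using xc z by simp
    have "b \<sqsubseteq> x \<sqinter> z" using meet_le[OF bx le_trans[OF c(2) z(2) b c(1) z(1)] xc z(1) b] .
    moreover have "x \<sqinter> z \<sqsubseteq> x" using meet_left[OF xc z(1)] .
    ultimately have "x \<sqinter> z = b \<or> x \<sqinter> z = x" using x m by (auto simp: covers_def)
    thus ?thesis
    proof
      assume h: "x \<sqinter> z = b"
      have "c \<squnion> (x \<sqinter> z) = (c \<squnion> x) \<sqinter> z" using modular[OF c(1) z(1) xc z(2)] .
      also have "\<dots> = z"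
        using meet_eqI[OF _ z(1) z(1), of "c \<squnion> x"] z(3) join_comm[of L c x] j
          le_refl[OF z(1)] meet_right[OF j z(1)] by simp
      also have "c \<squnion> (x \<sqinter> z) = c"
        using join_eqI[OF c(1) b c(1) le_refl[OF c(1)] c(2) join_left[OF c(1) b]] h by simp
      finally show ?thesis by simp
    next
      assume "x \<sqinter> z = x"
      hence "x \<sqsubseteq> z" using meet_right[OF xc z(1)] by simp
      hence "x \<squnion> c \<sqsubseteq> z" using join_le xc c z by blast
      thus ?thesis using le_antisym z j by blast
    qed
  qed
  moreover have "c \<sqsubseteq> x \<squnion> c" using join_right xc c by blast
  ultimately show ?thesis using j c unfolding covers_def by metis
qed

lemma ex_minimal_maximal:
  assumes "A \<subseteq> carrier L" "A \<noteq> {}"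
  shows "\<exists>x \<in> A. \<forall>z \<in> A. z \<sqsubseteq> x \<longrightarrow> z = x" and "\<exists>x \<in> A. \<forall>z \<in> A. x \<sqsubseteq> z \<longrightarrow> z = x"
proof -
  let ?R = "\<lambda>x y. x \<sqsubseteq> y \<and> x \<noteq> y"
  have fin: "finite A" using assms finite_carrier finite_subset by blast
  have 1: "asymp_on A ?R" using assms le_antisym by (intro asymp_onI) blast
  have 2: "transp_on A ?R"
    using assms le_antisym le_trans by (intro transp_onI) (metis (no_types, lifting) subsetD)
  show "\<exists>x \<in> A. \<forall>z \<in> A. z \<sqsubseteq> x \<longrightarrow> z = x" using Finite_Set.bex_min_element[OF fin 1 2 assms(2)] by blast
  show "\<exists>x \<in> A. \<forall>z \<in> A. x \<sqsubseteq> z \<longrightarrow> z = x" using Finite_Set.bex_max_element[OF fin 1 2 assms(2)] by blast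
qed

lemma ex_cover:
  assumes "b \<in> carrier L" "y \<in> carrier L" "b \<sqsubseteq> y" "b \<noteq> y"
  obtains x where "covers L b x" "x \<sqsubseteq> y"
proof -
  let ?A = "{x \<in> carrier L. b \<sqsubseteq> x \<and> b \<noteq> x \<and> x \<sqsubseteq> y}"
  have "?A \<subseteq> carrier L" "?A \<noteq> {}" using assms le_refl by blast+
  then obtain x where x: "x \<in> ?A" "\<And>z. z \<in> ?A \<Longrightarrow> z \<sqsubseteq> x \<Longrightarrow> z = x"
    using ex_minimal_maximal(1)[of ?A] by blast
  have "z = b \<or> z = x" if z: "z \<in> carrier L" "b \<sqsubseteq> z" "z \<sqsubseteq> x" for z
    using x z le_trans[OF z(3) _ z(1)] assms(2) by blast
  thus ?thesis using that[of x] x(1) assms(1) unfolding covers_def by blast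
qed

text \<open>
  Submodules of semisimple modules are semisimple: for \<open>x\<close> between \<open>b \<sqinter> c\<close> and \<open>c\<close>, a
  complement of \<open>x \<squnion> b\<close> in \<open>[b, a]\<close>, cut down to \<open>c\<close>, is a complement of \<open>x\<close>.
\<close>

lemma complemented_interval_lower:
  assumes ba: "complemented_interval L b a" and c: "c \<in> carrier L" "c \<sqsubseteq> a"
  shows "complemented_interval L (b \<sqinter> c) c"
proof -
  have b: "b \<in> carrier L" and a: "a \<in> carrier L" and le: "b \<sqsubseteq> a"
    using ba by (auto simp: complemented_interval_def)
  have bc: "b \<sqinter> c \<in> carrier L" using b c by simp
  have "\<exists>y \<in> carrier L. b \<sqinter> c \<sqsubseteq> y \<and> y \<sqsubseteq> c \<and> x \<sqinter> y = b \<sqinter> c \<and> x \<squnion> y = c"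
    if x: "x \<in> carrier L" "b \<sqinter> c \<sqsubseteq> x" "x \<sqsubseteq> c" for x
  proof -
    have xb: "x \<squnion> b \<in> carrier L" using x b by simp
    have "b \<sqsubseteq> x \<squnion> b" "x \<squnion> b \<sqsubseteq> a"
      using join_right join_le x b a le c le_trans[OF x(3) c(2)] by auto
    then obtain y where y: "y \<in> carrier L" "b \<sqsubseteq> y" "y \<sqsubseteq> a" "(x \<squnion> b) \<sqinter> y = b" "(x \<squnion> b) \<squnion> y = a"
      using ba xb unfolding complemented_interval_def by blast
    have yc: "y \<sqinter> c \<in> carrier L" using y c by simp
    have 1: "b \<sqinter> c \<sqsubseteq> y \<sqinter> c"
      by (rule meet_le[OF le_trans[OF meet_left[OF b c(1)] y(2) bc b y(1)] meet_right[OF b c(1)]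
            y(1) c(1) bc])
    have 2: "x \<sqinter> (y \<sqinter> c) = b \<sqinter> c"
    proof (rule meet_eqI[OF x(1) yc bc x(2) 1], rule meet_le)
      have m: "x \<sqinter> (y \<sqinter> c) \<in> carrier L" using x yc by simp
      have l1: "x \<sqinter> (y \<sqinter> c) \<sqsubseteq> x" "x \<sqinter> (y \<sqinter> c) \<sqsubseteq> y \<sqinter> c" using meet_left meet_right x yc by auto
      have l2: "x \<sqinter> (y \<sqinter> c) \<sqsubseteq> y" "x \<sqinter> (y \<sqinter> c) \<sqsubseteq> c"
        using le_trans[OF l1(2) meet_left[OF y(1) c(1)] m yc y(1)]
          le_trans[OF l1(2) meet_right[OF y(1) c(1)] m yc c(1)] by simp_all
      have "x \<sqinter> (y \<sqinter> c) \<sqsubseteq> x \<squnion> b" using le_trans[OF l1(1) join_left[OF x(1) b] m x(1) xb] .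
      hence "x \<sqinter> (y \<sqinter> c) \<sqsubseteq> (x \<squnion> b) \<sqinter> y" using meet_le[OF _ l2(1) xb y(1) m] by simp
      thus "x \<sqinter> (y \<sqinter> c) \<sqsubseteq> b" using y by simp
      show "x \<sqinter> (y \<sqinter> c) \<sqsubseteq> c" using l2 by blast
    qed (use x yc b c in auto)
    have "x \<squnion> (y \<sqinter> c) = (x \<squnion> y) \<sqinter> c" using modular[OF x(1) c(1) y(1) x(3)] .
    also have "x \<squnion> y = a"
    proof (rule join_eqI[OF x(1) y(1) a le_trans[OF x(3) c(2) x(1) c(1) a] y(3)])
      have xy: "x \<squnion> y \<in> carrier L" using x y by simp
      have l: "x \<sqsubseteq> x \<squnion> y" "y \<sqsubseteq> x \<squnion> y" using join_left join_right x y by auto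
      have "b \<sqsubseteq> x \<squnion> y" using le_trans[OF y(2) l(2) b y(1) xy] .
      hence "x \<squnion> b \<sqsubseteq> x \<squnion> y" using join_le[OF l(1) _ x(1) b xy] by simp
      hence "(x \<squnion> b) \<squnion> y \<sqsubseteq> x \<squnion> y" using join_le[OF _ l(2) xb y(1) xy] by simp
      thus "a \<sqsubseteq> x \<squnion> y" using y by simp
    qed
    also have "a \<sqinter> c = c" using c a meet_eqI[OF a c(1) c(1) c(2) le_refl[OF c(1)] meet_right[OF a c(1)]] by simp
    finally show ?thesis using 1 2 yc meet_right[OF y(1) c(1)] by blast
  qed
  thus ?thesis using bc c meet_right[OF b c(1)] unfolding complemented_interval_def by blast
qed

text \<open>
  A semisimple module is generated by its simple submodules: if \<open>u \<sqinter> a\<close> were not \<open>a\<close>, then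
  a complement of it in \<open>[b, a]\<close> would contain a cover of \<open>b\<close> that is not below \<open>u\<close>.
\<close>

lemma complemented_interval_le:
  assumes ba: "complemented_interval L b a" and u: "u \<in> carrier L" "b \<sqsubseteq> u"
    and cov: "\<And>x. covers L b x \<Longrightarrow> x \<sqsubseteq> a \<Longrightarrow> x \<sqsubseteq> u"
  shows "a \<sqsubseteq> u"
proof -
  have b: "b \<in> carrier L" and a: "a \<in> carrier L" and le: "b \<sqsubseteq> a"
    using ba by (auto simp: complemented_interval_def)
  have v: "u \<sqinter> a \<in> carrier L" using u a by simp
  have "b \<sqsubseteq> u \<sqinter> a" "u \<sqinter> a \<sqsubseteq> a" using meet_le meet_right u a b le by auto
  then obtain y where y: "y \<in> carrier L" "b \<sqsubseteq> y" "y \<sqsubseteq> a" "(u \<sqinter> a) \<sqinter> y = b" "(u \<sqinter> a) \<squnion> y = a"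
    using ba v unfolding complemented_interval_def by blast
  have "y = b"
  proof (rule ccontr)
    assume "y \<noteq> b"
    then obtain x where x: "covers L b x" "x \<sqsubseteq> y" using ex_cover[OF b y(1,2)] by blast
    have xc: "x \<in> carrier L" using x by (simp add: covers_def)
    have xa: "x \<sqsubseteq> a" using le_trans[OF x(2) y(3) xc y(1) a] .
    have "x \<sqsubseteq> u \<sqinter> a" using meet_le[OF cov[OF x(1) xa] xa u(1) a xc] .
    hence "x \<sqsubseteq> (u \<sqinter> a) \<sqinter> y" using meet_le[OF _ x(2) v y(1) xc] by simp
    hence "x \<sqsubseteq> b" using y by simp
    thus False using x(1) le_antisym unfolding covers_def by blast
  qed
  hence "u \<sqinter> a = a"
    using y(5) join_eqI[OF v b v le_refl[OF v] \<open>b \<sqsubseteq> u \<sqinter> a\<close> join_left[OF v b]] by simp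
  thus ?thesis using meet_left[OF u(1) a] by simp
qed

text \<open>
  Conversely, a module generated by its simple submodules is semisimple: an element \<open>y\<close> that is
  maximal with \<open>x \<sqinter> y = b\<close> is a complement of \<open>x\<close>.
\<close>

lemma complemented_intervalI:
  assumes b: "b \<in> carrier L" and a: "a \<in> carrier L" and le: "b \<sqsubseteq> a"
    and cov: "\<And>u. u \<in> carrier L \<Longrightarrow> b \<sqsubseteq> u \<Longrightarrow> u \<sqsubseteq> a \<Longrightarrow>
      (\<And>x. covers L b x \<Longrightarrow> x \<sqsubseteq> a \<Longrightarrow> x \<sqsubseteq> u) \<Longrightarrow> u = a"
  shows "complemented_interval L b a"
proof -
  have "\<exists>y \<in> carrier L. b \<sqsubseteq> y \<and> y \<sqsubseteq> a \<and> x \<sqinter> y = b \<and> x \<squnion> y = a"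
    if x: "x \<in> carrier L" "b \<sqsubseteq> x" "x \<sqsubseteq> a" for x
  proof -
    let ?A = "{y \<in> carrier L. b \<sqsubseteq> y \<and> y \<sqsubseteq> a \<and> x \<sqinter> y = b}"
    have "x \<sqinter> b = b" using x b meet_eqI meet_right by (simp add: le_refl)
    hence bA: "b \<in> ?A" using b le by simp
    have "?A \<subseteq> carrier L" "?A \<noteq> {}" using bA by blast+
    then obtain y where y: "y \<in> ?A" "\<And>z. z \<in> ?A \<Longrightarrow> y \<sqsubseteq> z \<Longrightarrow> z = y"
      using ex_minimal_maximal(2)[of ?A] by blast
    have yc: "y \<in> carrier L" and bY: "b \<sqsubseteq> y" and ya: "y \<sqsubseteq> a" and xy: "x \<sqinter> y = b" using y(1) by auto
    have j: "x \<squnion> y \<in> carrier L" using x yc by simp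
    have "x \<squnion> y = a"
    proof (rule cov[OF j])
      show "b \<sqsubseteq> x \<squnion> y" using le_trans[OF x(2) join_left[OF x(1) yc] b x(1) j] .
      show "x \<squnion> y \<sqsubseteq> a" using join_le x ya yc a by blast
      fix z assume z: "covers L b z" "z \<sqsubseteq> a"
      have zc: "z \<in> carrier L" and bz: "b \<sqsubseteq> z" using z by (auto simp: covers_def)
      show "z \<sqsubseteq> x \<squnion> y"
      proof (rule ccontr)
        assume n: "\<not> z \<sqsubseteq> x \<squnion> y"
        have m: "z \<sqinter> (x \<squnion> y) \<in> carrier L" using zc j by simp
        have "b \<sqsubseteq> z \<sqinter> (x \<squnion> y)" using meet_le b zc j bz \<open>b \<sqsubseteq> x \<squnion> y\<close> by blast
        hence "z \<sqinter> (x \<squnion> y) = b"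
          using z(1) m meet_left[OF zc j] meet_right[OF zc j] n unfolding covers_def by metis
        \<comment> \<open>Then \<open>y \<squnion> z\<close> is disjoint from \<open>x\<close> over \<open>b\<close>, against the maximality of \<open>y\<close>.\<close>
        hence "(y \<squnion> z) \<sqinter> (x \<squnion> y) = y \<squnion> b"
          using modular[OF yc j zc join_right[OF x(1) yc]] by simp
        also have "\<dots> = y" using bY yc b join_eqI[OF yc b yc] join_left by (simp add: le_refl)
        finally have e: "(y \<squnion> z) \<sqinter> (x \<squnion> y) = y" .
        have yz: "y \<squnion> z \<in> carrier L" using yc zc by simp
        have xm: "x \<sqinter> (y \<squnion> z) \<in> carrier L" using x yz by simp
        have "x \<sqinter> (y \<squnion> z) \<sqsubseteq> x \<squnion> y"
          using le_trans[OF meet_left[OF x(1) yz] join_left[OF x(1) yc] xm x(1) j] .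
        hence "x \<sqinter> (y \<squnion> z) \<sqsubseteq> y"
          using meet_le[OF meet_right[OF x(1) yz] _ yz j xm] e by simp
        hence "x \<sqinter> (y \<squnion> z) \<sqsubseteq> b" using meet_le[OF meet_left[OF x(1) yz] _ x(1) yc xm] xy by simp
        hence "x \<sqinter> (y \<squnion> z) = b"
          using meet_eqI[OF x(1) yz b x(2)] le_trans[OF bY join_left[OF yc zc] b yc yz] by blast
        hence "y \<squnion> z \<in> ?A"
          using yz le_trans[OF bY join_left[OF yc zc] b yc yz] join_le[OF ya z(2) yc zc a] by blast
        moreover have "\<not> y \<squnion> z \<sqsubseteq> y"
        proof
          assume "y \<squnion> z \<sqsubseteq> y"
          hence "z \<sqsubseteq> y" using le_trans[OF join_right[OF yc zc] _ zc yz yc] by blast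
          thus False using n le_trans[OF _ join_right[OF x(1) yc] zc yc j] by blast
        qed
        ultimately show False using y(2) join_left[OF yc zc] le_refl[OF yc] by metis
      qed
    qed
    thus ?thesis using yc bY ya xy by blast
  qed
  thus ?thesis using a b le unfolding complemented_interval_def by blast
qed

text \<open>
  Joining with \<open>b \<squnion> b'\<close> turns a cover of \<open>b\<close> or \<open>b'\<close> into a cover of \<open>b \<squnion> b'\<close> or
  absorbs it, so an element that contains all covers of \<open>b \<squnion> b'\<close> contains \<open>a\<close> and \<open>a'\<close>.
\<close>

lemma complemented_interval_join:
  assumes 1: "complemented_interval L b a" and 2: "complemented_interval L b' a'"
  shows "complemented_interval L (b \<squnion> b') (a \<squnion> a')"
proof -
  have c: "b \<in> carrier L" "a \<in> carrier L" "b \<sqsubseteq> a" "b' \<in> carrier L" "a' \<in> carrier L" "b' \<sqsubseteq> a'"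
    using 1 2 by (auto simp: complemented_interval_def)
  have j: "b \<squnion> b' \<in> carrier L" "a \<squnion> a' \<in> carrier L" using c by auto
  have l: "b \<sqsubseteq> b \<squnion> b'" "b' \<sqsubseteq> b \<squnion> b'" "a \<sqsubseteq> a \<squnion> a'" "a' \<sqsubseteq> a \<squnion> a'"
    using join_left join_right c by auto
  have l': "b \<squnion> b' \<sqsubseteq> a \<squnion> a'"
    using join_le[OF _ _ c(1,4) j(2)] le_trans[OF c(3) l(3) c(1,2) j(2)]
      le_trans[OF c(6) l(4) c(4,5) j(2)] by blast
  show ?thesis
  proof (rule complemented_intervalI[OF j l'])
    fix u assume u: "u \<in> carrier L" "b \<squnion> b' \<sqsubseteq> u" "u \<sqsubseteq> a \<squnion> a'"
      and cov: "\<And>x. covers L (b \<squnion> b') x \<Longrightarrow> x \<sqsubseteq> a \<squnion> a' \<Longrightarrow> x \<sqsubseteq> u"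
    have key: "d \<sqsubseteq> u" if d: "complemented_interval L e d" "e \<sqsubseteq> b \<squnion> b'" "d \<sqsubseteq> a \<squnion> a'" for e d
    proof -
      have dc: "e \<in> carrier L" "d \<in> carrier L" using d by (auto simp: complemented_interval_def)
      show ?thesis
      proof (rule complemented_interval_le[OF d(1) u(1) le_trans[OF d(2) u(2) dc(1) j(1) u(1)]])
        fix x assume x: "covers L e x" "x \<sqsubseteq> d"
        have xc: "x \<in> carrier L" using x by (simp add: covers_def)
        have xj: "x \<squnion> (b \<squnion> b') \<in> carrier L" using xc j by simp
        have "x \<squnion> (b \<squnion> b') \<sqsubseteq> a \<squnion> a'"
          using join_le[OF le_trans[OF x(2) d(3) xc dc(2) j(2)] l' xc j] .
        hence "x \<squnion> (b \<squnion> b') \<sqsubseteq> u" using covers_join[OF x(1) j(1) d(2)] cov u(2) by metis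
        thus "x \<sqsubseteq> u" using le_trans[OF join_left[OF xc j(1)] _ xc xj u(1)] by blast
      qed
    qed
    have "a \<squnion> a' \<sqsubseteq> u" using join_le[OF key[OF 1 l(1,3)] key[OF 2 l(2,4)] c(2,5) u(1)] .
    thus "u = a \<squnion> a'" using u j le_antisym by blast
  qed
qed

lemma complemented_interval_refl: "a \<in> carrier L \<Longrightarrow> complemented_interval L a a"
  by (rule complemented_intervalI) (auto intro: le_antisym)

lemma socle_length_le_carrier: "socle_length_le L k a \<Longrightarrow> a \<in> carrier L"
  by (cases k) (auto simp: complemented_interval_def)

lemma socle_length_le_mono: "socle_length_le L k a \<Longrightarrow> k \<le> n \<Longrightarrow> socle_length_le L n a"
proof (induction n)
  case (Suc n)
  thus ?case using complemented_interval_refl socle_length_le_carrier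
    by (metis le_Suc_eq socle_length_le.simps(2))
qed simp

text \<open>
  Together with the next lemma: the elements of socle length at most \<open>k\<close> form an ideal. This is
  what makes the condition stable under the closure operations that generate a level.
\<close>

lemma socle_length_le_lower:
  "socle_length_le L k a \<Longrightarrow> c \<in> carrier L \<Longrightarrow> c \<sqsubseteq> a \<Longrightarrow> socle_length_le L k c"
proof (induction k arbitrary: a c)
  case 0
  thus ?case using le_antisym by (metis socle_length_le.simps(1))
next
  case (Suc k)
  then obtain b where b: "socle_length_le L k b" "complemented_interval L b a" by auto
  have bc: "b \<in> carrier L" using socle_length_le_carrier[OF b(1)] .
  have "socle_length_le L k (b \<sqinter> c)" using Suc.IH[OF b(1)] meet_left[OF bc] Suc.prems bc by auto
  thus ?case using complemented_interval_lower[OF b(2)] Suc.prems by auto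
qed

lemma socle_length_le_join:
  "socle_length_le L k a \<Longrightarrow> socle_length_le L k a' \<Longrightarrow> socle_length_le L k (a \<squnion> a')"
proof (induction k arbitrary: a a')
  case 0
  hence "a = a'" using le_antisym by (metis socle_length_le.simps(1))
  thus ?case using 0 join_eqI[of a a a] join_left by (metis socle_length_le.simps(1))
next
  case (Suc k)
  thus ?case using complemented_interval_join by (metis socle_length_le.simps(2))
qed

lemma ex_socle_length_le: "a \<in> carrier L \<Longrightarrow> \<exists>k. socle_length_le L k a"
proof (induction "card {w \<in> carrier L. w \<sqsubseteq> a}" arbitrary: a rule: less_induct)
  case less
  let ?A = "{b \<in> carrier L. b \<sqsubseteq> a \<and> b \<noteq> a}"
  show ?case
  proof (cases "?A = {}")
    case True
    have "a \<sqsubseteq> x" if x: "x \<in> carrier L" for x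
    proof -
      have "a \<sqinter> x = a" using True meet_left[OF less.prems x] less.prems x by auto
      thus ?thesis using meet_right[OF less.prems x] by simp
    qed
    hence "socle_length_le L 0 a" using less.prems by simp
    thus ?thesis by blast
  next
    case False
    have "?A \<subseteq> carrier L" by blast
    then obtain b where b: "b \<in> ?A" "\<And>z. z \<in> ?A \<Longrightarrow> b \<sqsubseteq> z \<Longrightarrow> z = b"
      using ex_minimal_maximal(2)[of ?A] False by blast
    have fin: "finite {w \<in> carrier L. w \<sqsubseteq> z}" for z using finite_carrier by simp
    have "z = b \<or> z = a" if z: "z \<in> carrier L" "b \<sqsubseteq> z" "z \<sqsubseteq> a" for z
      using b z by blast
    hence cov: "covers L b a" using b(1) less.prems unfolding covers_def by auto
    have "{w \<in> carrier L. w \<sqsubseteq> b} \<subset> {w \<in> carrier L. w \<sqsubseteq> a}"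
      using b(1) less.prems le_trans le_antisym by blast
    then obtain k where k: "socle_length_le L k b"
      using less.hyps[of b] b(1) psubset_card_mono[OF fin[of a]] by blast
    have "complemented_interval L b a"
    proof (rule complemented_intervalI)
      fix u assume "u \<in> carrier L" "b \<sqsubseteq> u" "u \<sqsubseteq> a"
        "\<And>x. covers L b x \<Longrightarrow> x \<sqsubseteq> a \<Longrightarrow> x \<sqsubseteq> u"
      thus "u = a" using cov less.prems le_antisym le_refl by blast
    qed (use b(1) less.prems in auto)
    thus ?thesis using k by (meson socle_length_le.simps(2))
  qed
qed

end

text \<open>
  The quotients of a quotient \<open>F\<close> of \<open>G\<close> are the quotients of \<open>G\<close> below \<open>F\<close>. Such an
  isomorphism onto a lower set transports everything that is defined by looking downwards.
\<close>

locale lower_embedding = L: lattice L + L': lattice L'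
  for L :: "('a, 'b) gorder_scheme" and L' :: "('c, 'd) gorder_scheme" +
  fixes \<phi> :: "'a \<Rightarrow> 'c"
  assumes closed: "x \<in> carrier L \<Longrightarrow> \<phi> x \<in> carrier L'"
    and le_iff: "x \<in> carrier L \<Longrightarrow> y \<in> carrier L \<Longrightarrow> \<phi> x \<sqsubseteq>\<^bsub>L'\<^esub> \<phi> y \<longleftrightarrow> x \<sqsubseteq>\<^bsub>L\<^esub> y"
    and lower: "x \<in> carrier L \<Longrightarrow> z \<in> carrier L' \<Longrightarrow> z \<sqsubseteq>\<^bsub>L'\<^esub> \<phi> x \<Longrightarrow> z \<in> \<phi> ` carrier L"
begin

lemma eq_iff: "x \<in> carrier L \<Longrightarrow> y \<in> carrier L \<Longrightarrow> \<phi> x = \<phi> y \<longleftrightarrow> x = y"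
  using le_iff L.le_antisym L.le_refl by metis

lemma lowerE:
  assumes "x \<in> carrier L" "y \<in> carrier L'" "y \<sqsubseteq>\<^bsub>L'\<^esub> \<phi> x"
  obtains w where "w \<in> carrier L" "y = \<phi> w" "w \<sqsubseteq>\<^bsub>L\<^esub> x"
  using lower[OF assms] le_iff assms by blast

lemma meet:
  assumes x: "x \<in> carrier L" and y: "y \<in> carrier L"
  shows "\<phi> x \<sqinter>\<^bsub>L'\<^esub> \<phi> y = \<phi> (x \<sqinter>\<^bsub>L\<^esub> y)"
proof -
  note c = closed[OF x] closed[OF y]
  note m = L'.meet_closed[OF c] and m' = L.meet_closed[OF x y]
  obtain w where w: "w \<in> carrier L" "\<phi> x \<sqinter>\<^bsub>L'\<^esub> \<phi> y = \<phi> w" "w \<sqsubseteq>\<^bsub>L\<^esub> x"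
    using lowerE[OF x m L'.meet_left[OF c]] .
  have "w \<sqsubseteq>\<^bsub>L\<^esub> y" using L'.meet_right[OF c] w le_iff y by simp
  hence "w \<sqsubseteq>\<^bsub>L\<^esub> x \<sqinter>\<^bsub>L\<^esub> y" using L.meet_le w x y by blast
  moreover have "\<phi> (x \<sqinter>\<^bsub>L\<^esub> y) \<sqsubseteq>\<^bsub>L'\<^esub> \<phi> w"
    using L'.meet_le[OF _ _ c closed[OF m']] le_iff m' x y L.meet_left L.meet_right w(2) by simp
  ultimately show ?thesis using w m' le_iff[OF m' w(1)] L.le_antisym[of w, OF _ _ w(1) m'] by simp
qed

lemma join:
  assumes x: "x \<in> carrier L" and y: "y \<in> carrier L"
  shows "\<phi> x \<squnion>\<^bsub>L'\<^esub> \<phi> y = \<phi> (x \<squnion>\<^bsub>L\<^esub> y)"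
proof -
  note c = closed[OF x] closed[OF y]
  note j = L'.join_closed[OF c] and j' = L.join_closed[OF x y]
  have "\<phi> x \<squnion>\<^bsub>L'\<^esub> \<phi> y \<sqsubseteq>\<^bsub>L'\<^esub> \<phi> (x \<squnion>\<^bsub>L\<^esub> y)"
    using L'.join_le[OF _ _ c closed[OF j']] le_iff j' x y L.join_left L.join_right by simp
  then obtain w where w: "w \<in> carrier L" "\<phi> x \<squnion>\<^bsub>L'\<^esub> \<phi> y = \<phi> w" "w \<sqsubseteq>\<^bsub>L\<^esub> x \<squnion>\<^bsub>L\<^esub> y"
    using lowerE[OF j' j] by blast
  have "x \<sqsubseteq>\<^bsub>L\<^esub> w" "y \<sqsubseteq>\<^bsub>L\<^esub> w" using L'.join_left[OF c] L'.join_right[OF c] w le_iff x y by auto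
  hence "x \<squnion>\<^bsub>L\<^esub> y \<sqsubseteq>\<^bsub>L\<^esub> w" using L.join_le x y w by blast
  thus ?thesis using w L.le_antisym[of w, OF _ _ w(1) j'] by simp
qed

lemma complemented_interval_iff:
  assumes b: "b \<in> carrier L" and a: "a \<in> carrier L"
  shows "complemented_interval L' (\<phi> b) (\<phi> a) \<longleftrightarrow> complemented_interval L b a"
proof
  assume h: "complemented_interval L' (\<phi> b) (\<phi> a)"
  have "\<exists>y \<in> carrier L. b \<sqsubseteq>\<^bsub>L\<^esub> y \<and> y \<sqsubseteq>\<^bsub>L\<^esub> a \<and> x \<sqinter>\<^bsub>L\<^esub> y = b \<and> x \<squnion>\<^bsub>L\<^esub> y = a"
    if x: "x \<in> carrier L" "b \<sqsubseteq>\<^bsub>L\<^esub> x" "x \<sqsubseteq>\<^bsub>L\<^esub> a" for x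
  proof -
    have "\<phi> b \<sqsubseteq>\<^bsub>L'\<^esub> \<phi> x" "\<phi> x \<sqsubseteq>\<^bsub>L'\<^esub> \<phi> a" using x a b le_iff by auto
    then obtain y where y: "y \<in> carrier L'" "\<phi> b \<sqsubseteq>\<^bsub>L'\<^esub> y" "y \<sqsubseteq>\<^bsub>L'\<^esub> \<phi> a"
      "\<phi> x \<sqinter>\<^bsub>L'\<^esub> y = \<phi> b" "\<phi> x \<squnion>\<^bsub>L'\<^esub> y = \<phi> a"
      using h closed[OF x(1)] unfolding complemented_interval_def by blast
    obtain w where w: "w \<in> carrier L" "y = \<phi> w" "w \<sqsubseteq>\<^bsub>L\<^esub> a" using lowerE[OF a y(1,3)] .
    have "x \<sqinter>\<^bsub>L\<^esub> w = b" using y(4) w(2) meet[OF x(1) w(1)] eq_iff[OF L.meet_closed[OF x(1) w(1)] b] by simp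
    moreover have "x \<squnion>\<^bsub>L\<^esub> w = a"
      using y(5) w(2) join[OF x(1) w(1)] eq_iff[OF L.join_closed[OF x(1) w(1)] a] by simp
    moreover have "b \<sqsubseteq>\<^bsub>L\<^esub> w" using y(2) w le_iff[OF b w(1)] by simp
    ultimately show ?thesis using w by blast
  qed
  moreover have "b \<sqsubseteq>\<^bsub>L\<^esub> a" using h le_iff[OF b a] unfolding complemented_interval_def by blast
  ultimately show "complemented_interval L b a"
    using a b unfolding complemented_interval_def by blast
next
  assume h: "complemented_interval L b a"
  have "\<exists>y \<in> carrier L'. \<phi> b \<sqsubseteq>\<^bsub>L'\<^esub> y \<and> y \<sqsubseteq>\<^bsub>L'\<^esub> \<phi> a \<and> x \<sqinter>\<^bsub>L'\<^esub> y = \<phi> b \<and> x \<squnion>\<^bsub>L'\<^esub> y = \<phi> a"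
    if x: "x \<in> carrier L'" "\<phi> b \<sqsubseteq>\<^bsub>L'\<^esub> x" "x \<sqsubseteq>\<^bsub>L'\<^esub> \<phi> a" for x
  proof -
    obtain w where w: "w \<in> carrier L" "x = \<phi> w" "w \<sqsubseteq>\<^bsub>L\<^esub> a" using lowerE[OF a x(1,3)] .
    have "b \<sqsubseteq>\<^bsub>L\<^esub> w" using x w b le_iff by simp
    then obtain y where y: "y \<in> carrier L" "b \<sqsubseteq>\<^bsub>L\<^esub> y" "y \<sqsubseteq>\<^bsub>L\<^esub> a"
      "w \<sqinter>\<^bsub>L\<^esub> y = b" "w \<squnion>\<^bsub>L\<^esub> y = a"
      using h w unfolding complemented_interval_def by blast
    have "\<phi> b \<sqsubseteq>\<^bsub>L'\<^esub> \<phi> y" "\<phi> y \<sqsubseteq>\<^bsub>L'\<^esub> \<phi> a" using y a b le_iff by auto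
    moreover have "x \<sqinter>\<^bsub>L'\<^esub> \<phi> y = \<phi> b" "x \<squnion>\<^bsub>L'\<^esub> \<phi> y = \<phi> a"
      using w(2) meet[OF w(1) y(1)] join[OF w(1) y(1)] y by auto
    ultimately show ?thesis using closed[OF y(1)] by blast
  qed
  moreover have "\<phi> b \<sqsubseteq>\<^bsub>L'\<^esub> \<phi> a" using h le_iff[OF b a] unfolding complemented_interval_def by blast
  ultimately show "complemented_interval L' (\<phi> b) (\<phi> a)"
    using closed[OF a] closed[OF b] unfolding complemented_interval_def by blast
qed

lemma covers_iff:
  assumes b: "b \<in> carrier L" and a: "a \<in> carrier L"
  shows "covers L' (\<phi> b) (\<phi> a) \<longleftrightarrow> covers L b a"
proof -
  have "(\<forall>z \<in> carrier L'. \<phi> b \<sqsubseteq>\<^bsub>L'\<^esub> z \<longrightarrow> z \<sqsubseteq>\<^bsub>L'\<^esub> \<phi> a \<longrightarrow> z = \<phi> b \<or> z = \<phi> a) \<longleftrightarrow>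
      (\<forall>z \<in> carrier L. b \<sqsubseteq>\<^bsub>L\<^esub> z \<longrightarrow> z \<sqsubseteq>\<^bsub>L\<^esub> a \<longrightarrow> z = b \<or> z = a)"
  proof (intro iffI ballI impI)
    fix z assume h: "\<forall>z \<in> carrier L'. \<phi> b \<sqsubseteq>\<^bsub>L'\<^esub> z \<longrightarrow> z \<sqsubseteq>\<^bsub>L'\<^esub> \<phi> a \<longrightarrow> z = \<phi> b \<or> z = \<phi> a"
      and z: "z \<in> carrier L" "b \<sqsubseteq>\<^bsub>L\<^esub> z" "z \<sqsubseteq>\<^bsub>L\<^esub> a"
    have "\<phi> z = \<phi> b \<or> \<phi> z = \<phi> a"
      using h closed[OF z(1)] z(2,3) le_iff[OF b z(1)] le_iff[OF z(1) a] by blast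
    thus "z = b \<or> z = a" using eq_iff z(1) a b by blast
  next
    fix z assume h: "\<forall>z \<in> carrier L. b \<sqsubseteq>\<^bsub>L\<^esub> z \<longrightarrow> z \<sqsubseteq>\<^bsub>L\<^esub> a \<longrightarrow> z = b \<or> z = a"
      and z: "z \<in> carrier L'" "\<phi> b \<sqsubseteq>\<^bsub>L'\<^esub> z" "z \<sqsubseteq>\<^bsub>L'\<^esub> \<phi> a"
    obtain w where w: "w \<in> carrier L" "z = \<phi> w" "w \<sqsubseteq>\<^bsub>L\<^esub> a" using lowerE[OF a z(1,3)] .
    have "b \<sqsubseteq>\<^bsub>L\<^esub> w" using z w le_iff[OF b w(1)] by simp
    hence "w = b \<or> w = a" using h w by blast
    thus "z = \<phi> b \<or> z = \<phi> a" using w by blast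
  qed
  thus ?thesis using a b closed le_iff eq_iff unfolding covers_def by simp
qed

lemma socle_length_le_iff:
  "a \<in> carrier L \<Longrightarrow> socle_length_le L' k (\<phi> a) \<longleftrightarrow> socle_length_le L k a"
proof (induction k arbitrary: a)
  case (0 a)
  have "(\<forall>x \<in> carrier L'. \<phi> a \<sqsubseteq>\<^bsub>L'\<^esub> x) \<longleftrightarrow> (\<forall>x \<in> carrier L. a \<sqsubseteq>\<^bsub>L\<^esub> x)"
  proof
    assume h: "\<forall>x \<in> carrier L. a \<sqsubseteq>\<^bsub>L\<^esub> x"
    show "\<forall>x \<in> carrier L'. \<phi> a \<sqsubseteq>\<^bsub>L'\<^esub> x"
    proof
      fix x assume x: "x \<in> carrier L'"
      note m = L'.meet_closed[OF closed[OF 0] x]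
      obtain w where w: "w \<in> carrier L" "\<phi> a \<sqinter>\<^bsub>L'\<^esub> x = \<phi> w" "w \<sqsubseteq>\<^bsub>L\<^esub> a"
        using lowerE[OF 0 m L'.meet_left[OF closed[OF 0] x]] .
      hence "w = a" using h L.le_antisym[OF w(3) _ w(1) 0] by simp
      thus "\<phi> a \<sqsubseteq>\<^bsub>L'\<^esub> x" using w L'.meet_right[OF closed[OF 0] x] by simp
    qed
  next
    assume h: "\<forall>x \<in> carrier L'. \<phi> a \<sqsubseteq>\<^bsub>L'\<^esub> x"
    show "\<forall>x \<in> carrier L. a \<sqsubseteq>\<^bsub>L\<^esub> x" using h closed le_iff[OF 0] by simp
  qed
  thus ?case using 0 closed by simp
next
  case (Suc k a)
  have "(\<exists>b. socle_length_le L' k b \<and> complemented_interval L' b (\<phi> a)) \<longleftrightarrow>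
    (\<exists>b. socle_length_le L k b \<and> complemented_interval L b a)"
  proof
    assume "\<exists>b. socle_length_le L' k b \<and> complemented_interval L' b (\<phi> a)"
    then obtain b where b: "socle_length_le L' k b" "complemented_interval L' b (\<phi> a)" by blast
    obtain w where w: "w \<in> carrier L" "b = \<phi> w"
      using lowerE[OF Suc.prems, of b] b(2) unfolding complemented_interval_def by metis
    show "\<exists>b. socle_length_le L k b \<and> complemented_interval L b a"
      using b w Suc.IH[OF w(1)] complemented_interval_iff[OF w(1) Suc.prems] by auto
  next
    assume "\<exists>b. socle_length_le L k b \<and> complemented_interval L b a"
    then obtain b where b: "socle_length_le L k b" "complemented_interval L b a" by blast
    hence w: "b \<in> carrier L" by (simp add: complemented_interval_def)
    show "\<exists>b. socle_length_le L' k b \<and> complemented_interval L' b (\<phi> a)"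
      using b Suc.IH[OF w] complemented_interval_iff[OF w Suc.prems] by auto
  qed
  thus ?case by simp
qed

end

section \<open>Epimorphisms and quotients\<close>

context category
begin

lemma epi_cancel:
  "epi C p \<Longrightarrow> p \<in> hom C A B \<Longrightarrow> g \<in> hom C B D \<Longrightarrow> h \<in> hom C B D \<Longrightarrow>
    Comp C g p = Comp C h p \<Longrightarrow> g = h"
  unfolding epi_def hom_def by blast

lemma epiI:
  assumes "p \<in> hom C A B"
    and "\<And>D g h. g \<in> hom C B D \<Longrightarrow> h \<in> hom C B D \<Longrightarrow> Comp C g p = Comp C h p \<Longrightarrow> g = h"
  shows "epi C p"
  using assms unfolding epi_def hom_def by auto

lemma epi_Comp:
  assumes p: "p \<in> hom C A B" "epi C p" and q: "q \<in> hom C B D" "epi C q"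
  shows "epi C (Comp C q p)"
proof (rule epiI[OF Comp_hom[OF p(1) q(1)]])
  fix E g h assume g: "g \<in> hom C D E" and h: "h \<in> hom C D E"
    and e: "Comp C g (Comp C q p) = Comp C h (Comp C q p)"
  have "Comp C g q = Comp C h q"
    using e epi_cancel[OF p(2,1) Comp_hom[OF q(1) g] Comp_hom[OF q(1) h]]
      Comp_assoc[OF p(1) q(1) g] Comp_assoc[OF p(1) q(1) h] by simp
  thus "g = h" by (rule epi_cancel[OF q(2,1) g h])
qed

lemma epi_left_factor:
  assumes p: "p \<in> hom C A B" and q: "q \<in> hom C B D" and e: "epi C (Comp C q p)"
  shows "epi C q"
proof (rule epiI[OF q])
  fix E g h assume g: "g \<in> hom C D E" and h: "h \<in> hom C D E" and eq: "Comp C g q = Comp C h q"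
  show "g = h"
    by (rule epi_cancel[OF e Comp_hom[OF p q] g h])
      (simp add: Comp_assoc[OF p q g] Comp_assoc[OF p q h] eq)
qed

lemma epi_Ident:
  assumes "A \<in> Obj C"
  shows "epi C (Ident C A)"
proof (rule epiI[OF Ident_hom[OF assms]])
  fix D g h assume "g \<in> hom C A D" "h \<in> hom C A D" "Comp C g (Ident C A) = Comp C h (Ident C A)"
  thus "g = h" using Comp_Ident_right by metis
qed

lemma isoI:
  assumes "f \<in> hom C A B" "g \<in> hom C B A" "Comp C g f = Ident C A" "Comp C f g = Ident C B"
  shows "iso C f"
  using assms unfolding iso_def hom_def by auto

lemma isoE:
  assumes "iso C f" "f \<in> hom C A B"
  obtains g where "g \<in> hom C B A" "Comp C g f = Ident C A" "Comp C f g = Ident C B" "iso C g"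
proof -
  obtain g where g: "g \<in> hom C B A" "Comp C g f = Ident C A" "Comp C f g = Ident C B"
    using assms unfolding iso_def hom_def by auto
  thus ?thesis using that isoI[OF g(1) assms(2) g(3,2)] by blast
qed

lemma iso_epi:
  assumes f: "f \<in> hom C A B" "iso C f"
  shows "epi C f"
proof -
  obtain g where g: "g \<in> hom C B A" "Comp C f g = Ident C B" using isoE[OF f(2,1)] by metis
  show ?thesis
    using epi_left_factor[OF g(1) f(1)] g(2) epi_Ident hom_Obj(2)[OF f(1)] by simp
qed

lemma iso_Ident: "A \<in> Obj C \<Longrightarrow> iso C (Ident C A)"
  using isoI Ident_hom Comp_Ident_left by metis

lemma isomorphic_refl: "A \<in> Obj C \<Longrightarrow> isomorphic C A A"
  unfolding isomorphic_def using iso_Ident Ident_hom by blast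

lemma isomorphic_sym: "isomorphic C A B \<Longrightarrow> isomorphic C B A"
  unfolding isomorphic_def using isoE by metis

lemma iso_Comp:
  assumes f: "f \<in> hom C A B" "iso C f" and g: "g \<in> hom C B D" "iso C g"
  shows "iso C (Comp C g f)"
proof -
  obtain f' where f': "f' \<in> hom C B A" "Comp C f' f = Ident C A" "Comp C f f' = Ident C B"
    using isoE[OF f(2,1)] .
  obtain g' where g': "g' \<in> hom C D B" "Comp C g' g = Ident C B" "Comp C g g' = Ident C D"
    using isoE[OF g(2,1)] .
  note gf = Comp_hom[OF f(1) g(1)] and fg = Comp_hom[OF g'(1) f'(1)]
  have "Comp C (Comp C f' g') (Comp C g f) = Comp C f' (Comp C (Comp C g' g) f)"
    using Comp_assoc[OF gf g'(1) f'(1)] Comp_assoc[OF f(1) g(1) g'(1)] by simp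
  moreover have "Comp C (Comp C g f) (Comp C f' g') = Comp C g (Comp C (Comp C f f') g')"
    using Comp_assoc[OF fg f(1) g(1)] Comp_assoc[OF g'(1) f'(1) f(1)] by simp
  ultimately show ?thesis
    using isoI[OF gf fg] f' g' Comp_Ident_left[OF f(1)] Comp_Ident_left[OF g'(1)] by simp
qed

lemma isomorphic_trans: "isomorphic C A B \<Longrightarrow> isomorphic C B D \<Longrightarrow> isomorphic C A D"
  unfolding isomorphic_def using iso_Comp Comp_hom by blast

lemma isomorphic_Obj: "isomorphic C A B \<Longrightarrow> A \<in> Obj C" "isomorphic C A B \<Longrightarrow> B \<in> Obj C"
  unfolding isomorphic_def using hom_Obj by blast+

lemma iso_of_mutual_factors:
  assumes p: "p \<in> hom C A B" "epi C p" and q: "q \<in> hom C A D" "epi C q"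
    and h: "h \<in> hom C B D" "q = Comp C h p" and k: "k \<in> hom C D B" "p = Comp C k q"
  shows "iso C h"
proof (rule isoI[OF h(1) k(1)])
  have "Comp C (Comp C k h) p = p" using Comp_assoc[OF p(1) h(1) k(1)] h(2)[symmetric] k(2)[symmetric] by simp
  thus "Comp C k h = Ident C B"
    using epi_cancel[OF p(2,1) Comp_hom[OF h(1) k(1)] Ident_hom[OF hom_Obj(2)[OF p(1)]]]
      Comp_Ident_left[OF p(1)] by simp
  have "Comp C (Comp C h k) q = q" using Comp_assoc[OF q(1) k(1) h(1)] h(2)[symmetric] k(2)[symmetric] by simp
  thus "Comp C h k = Ident C D"
    using epi_cancel[OF q(2,1) Comp_hom[OF k(1) h(1)] Ident_hom[OF hom_Obj(2)[OF q(1)]]]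
      Comp_Ident_left[OF q(1)] by simp
qed

lemma quotients_iff: "p \<in> quotients C G \<longleftrightarrow> epi C p \<and> p \<in> hom C G (Cod C p)"
  unfolding quotients_def hom_def epi_def by auto

lemma quotientsI: "p \<in> hom C G H \<Longrightarrow> epi C p \<Longrightarrow> p \<in> quotients C G"
  by (auto simp: quotients_iff hom_def)

lemma quotientsE:
  assumes "p \<in> quotients C G"
  obtains "epi C p" "p \<in> hom C G (Cod C p)" "G \<in> Obj C" "Cod C p \<in> Obj C"
  using assms hom_Obj unfolding quotients_iff by blast

lemma Ident_quotients: "G \<in> Obj C \<Longrightarrow> Ident C G \<in> quotients C G"
  using quotientsI Ident_hom epi_Ident by blast

lemma Comp_quotients:
  "q \<in> quotients C G \<Longrightarrow> x \<in> quotients C (Cod C q) \<Longrightarrow> Comp C x q \<in> quotients C G"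
  using epi_Comp Comp_hom quotientsI by (metis quotientsE)

lemma quot_leI: "p \<in> hom C G A \<Longrightarrow> h \<in> hom C A B \<Longrightarrow> quot_le C (Comp C h p) p"
  unfolding quot_le_def using Comp_hom hom_Cod by metis

lemma quot_leE:
  assumes "quot_le C q p" "p \<in> hom C G A" "q \<in> hom C G B"
  obtains h where "h \<in> hom C A B" "q = Comp C h p"
  using assms unfolding quot_le_def hom_def by auto

lemma quot_le_refl: "p \<in> quotients C G \<Longrightarrow> quot_le C p p"
  using quot_leI Comp_Ident_left Ident_hom by (metis quotientsE)

lemma quot_le_trans:
  assumes "quot_le C q p" "quot_le C r q" and p: "p \<in> quotients C G"
  shows "quot_le C r p"
proof -
  obtain h k where h: "h \<in> hom C (Cod C p) (Cod C q)" "q = Comp C h p"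
    and k: "k \<in> hom C (Cod C q) (Cod C r)" "r = Comp C k q"
    using assms unfolding quot_le_def by blast
  have p: "p \<in> hom C G (Cod C p)" using p by (rule quotientsE)
  have "r = Comp C (Comp C k h) p" using h k Comp_assoc[OF p h(1) k(1)] by simp
  thus ?thesis using quot_leI[OF p Comp_hom[OF h(1) k(1)]] by simp
qed

lemma quot_iso_iff:
  assumes p: "p \<in> quotients C G" and q: "q \<in> quotients C G"
  shows "quot_iso C p q \<longleftrightarrow> quot_le C q p \<and> quot_le C p q"
proof
  assume "quot_iso C p q"
  then obtain r where r: "r \<in> hom C (Cod C p) (Cod C q)" "iso C r" "q = Comp C r p"
    unfolding quot_iso_def by blast
  obtain s where s: "s \<in> hom C (Cod C q) (Cod C p)" "Comp C s r = Ident C (Cod C p)"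
    using isoE[OF r(2,1)] .
  have h: "p \<in> hom C G (Cod C p)" using p by (rule quotientsE)
  have "p = Comp C s q" using r(3) s Comp_assoc[OF h r(1) s(1)] Comp_Ident_left[OF h] by simp
  thus "quot_le C q p \<and> quot_le C p q" using r(1,3) s(1) unfolding quot_le_def by blast
next
  assume "quot_le C q p \<and> quot_le C p q"
  then obtain h k where hk: "h \<in> hom C (Cod C p) (Cod C q)" "q = Comp C h p"
    "k \<in> hom C (Cod C q) (Cod C p)" "p = Comp C k q"
    unfolding quot_le_def by blast
  have p': "p \<in> hom C G (Cod C p)" "epi C p" and q': "q \<in> hom C G (Cod C q)" "epi C q"
    using p q by (auto elim: quotientsE)
  have "iso C h" by (rule iso_of_mutual_factors[OF p' q' hk])
  thus "quot_iso C p q" using hk unfolding quot_iso_def by blast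
qed

lemma quot_class_mem:
  "p \<in> quotients C G \<Longrightarrow>
    q \<in> quot_class C p \<longleftrightarrow> q \<in> quotients C G \<and> quot_le C q p \<and> quot_le C p q"
proof -
  assume p: "p \<in> quotients C G"
  hence "Dom C p = G" by (simp add: quotients_def)
  thus ?thesis using quot_iso_iff[OF p] unfolding quot_class_def by blast
qed

lemma quot_class_self: "p \<in> quotients C G \<Longrightarrow> p \<in> quot_class C p"
  using quot_class_mem quot_le_refl by blast

lemma quot_class_eq_iff:
  assumes p: "p \<in> quotients C G" and q: "q \<in> quotients C G"
  shows "quot_class C p = quot_class C q \<longleftrightarrow> quot_le C q p \<and> quot_le C p q"
proof
  assume "quot_class C p = quot_class C q"
  hence "p \<in> quot_class C q" using quot_class_self[OF p] by simp
  thus "quot_le C q p \<and> quot_le C p q" using quot_class_mem[OF q] by simp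
next
  assume h: "quot_le C q p \<and> quot_le C p q"
  have "r \<in> quot_class C p \<longleftrightarrow> r \<in> quot_class C q" for r
    unfolding quot_class_mem[OF p] quot_class_mem[OF q]
    using h quot_le_trans p q by meson
  thus "quot_class C p = quot_class C q" by blast
qed

lemma carrier_quot_poset: "carrier (quot_poset C G) = quot_class C ` quotients C G"
  by (simp add: quot_poset_def)

lemma quot_class_carrier: "p \<in> quotients C G \<Longrightarrow> quot_class C p \<in> carrier (quot_poset C G)"
  by (simp add: carrier_quot_poset)

lemma le_quot_poset_iff:
  assumes p: "p \<in> quotients C G" and q: "q \<in> quotients C G"
  shows "quot_class C q \<sqsubseteq>\<^bsub>quot_poset C G\<^esub> quot_class C p \<longleftrightarrow> quot_le C q p"
proof
  assume "quot_class C q \<sqsubseteq>\<^bsub>quot_poset C G\<^esub> quot_class C p"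
  then obtain q' p' where h: "q' \<in> quot_class C q" "p' \<in> quot_class C p" "quot_le C q' p'"
    by (auto simp: quot_poset_def)
  have q': "quot_le C q q'" "q' \<in> quotients C G" using h(1) quot_class_mem[OF q] by auto
  have p': "quot_le C p' p" "p' \<in> quotients C G" using h(2) quot_class_mem[OF p] by auto
  have "quot_le C q' p" by (rule quot_le_trans[OF p'(1) h(3) p])
  thus "quot_le C q p" by (rule quot_le_trans[OF _ q'(1) p])
next
  assume "quot_le C q p"
  thus "quot_class C q \<sqsubseteq>\<^bsub>quot_poset C G\<^esub> quot_class C p"
    using quot_class_self p q by (auto simp: quot_poset_def)
qed

text \<open>
  Precomposition with \<open>q\<close> on classes of quotients. It respects classes
  (\<open>pull_quot_class\<close>), hence the value does not depend on the representative chosen.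
\<close>

definition pull :: "'m \<Rightarrow> 'm set \<Rightarrow> 'm set" where
  "pull q a = quot_class C (Comp C (SOME x. x \<in> a) q)"

lemma Comp_quot_le_iff:
  assumes q: "q \<in> quotients C G" and x: "x \<in> quotients C (Cod C q)" and y: "y \<in> quotients C (Cod C q)"
  shows "quot_le C (Comp C x q) (Comp C y q) \<longleftrightarrow> quot_le C x y"
proof -
  have q': "q \<in> hom C G (Cod C q)" "epi C q" using q by (auto elim: quotientsE)
  have x': "x \<in> hom C (Cod C q) (Cod C x)" using x by (rule quotientsE)
  have y': "y \<in> hom C (Cod C q) (Cod C y)" using y by (rule quotientsE)
  show ?thesis
  proof
    assume "quot_le C (Comp C x q) (Comp C y q)"
    then obtain h where h: "h \<in> hom C (Cod C y) (Cod C x)" "Comp C x q = Comp C h (Comp C y q)"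
      using quot_leE Comp_hom[OF q'(1) x'] Comp_hom[OF q'(1) y'] by blast
    have "x = Comp C h y"
      using epi_cancel[OF q'(2,1) x' Comp_hom[OF y' h(1)]] h Comp_assoc[OF q'(1) y' h(1)] by simp
    thus "quot_le C x y" using h unfolding quot_le_def by blast
  next
    assume "quot_le C x y"
    then obtain h where h: "h \<in> hom C (Cod C y) (Cod C x)" "x = Comp C h y"
      unfolding quot_le_def by blast
    have "Comp C x q = Comp C h (Comp C y q)" using h Comp_assoc[OF q'(1) y' h(1)] by simp
    thus "quot_le C (Comp C x q) (Comp C y q)"
      using quot_leI[OF Comp_hom[OF q'(1) y'] h(1)] by simp
  qed
qed

lemma pull_quot_class:
  assumes q: "q \<in> quotients C G" and x: "x \<in> quotients C (Cod C q)"
  shows "pull q (quot_class C x) = quot_class C (Comp C x q)"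
proof -
  have "(SOME z. z \<in> quot_class C x) \<in> quot_class C x"
    using quot_class_self[OF x] by (rule someI)
  hence z: "(SOME z. z \<in> quot_class C x) \<in> quotients C (Cod C q)"
    "quot_le C (SOME z. z \<in> quot_class C x) x" "quot_le C x (SOME z. z \<in> quot_class C x)"
    using quot_class_mem[OF x] by auto
  show ?thesis
    unfolding pull_def
    using z quot_class_eq_iff[OF Comp_quotients[OF q z(1)] Comp_quotients[OF q x]]
      Comp_quot_le_iff[OF q] x by simp
qed

text \<open>
  A quotient \<open>y\<close> of \<open>G\<close> below \<open>x q\<close> has the form \<open>h x q\<close>, and \<open>h x\<close> is again an
  epimorphism; so it is pulled back from a quotient of the target of \<open>q\<close>.
\<close>

lemma lower_embedding_pull:
  assumes q: "q \<in> quotients C G"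
    and L: "lattice (quot_poset C (Cod C q))" and L': "lattice (quot_poset C G)"
  shows "lower_embedding (quot_poset C (Cod C q)) (quot_poset C G) (pull q)"
proof -
  interpret L: lattice "quot_poset C (Cod C q)" by fact
  interpret L': lattice "quot_poset C G" by fact
  have q': "q \<in> hom C G (Cod C q)" using q by (rule quotientsE)
  show ?thesis
  proof
    fix a assume "a \<in> carrier (quot_poset C (Cod C q))"
    then obtain x where x: "x \<in> quotients C (Cod C q)" "a = quot_class C x"
      by (auto simp: carrier_quot_poset)
    show "pull q a \<in> carrier (quot_poset C G)"
      using x pull_quot_class[OF q x(1)] quot_class_carrier[OF Comp_quotients[OF q x(1)]] by simp
    fix b assume "b \<in> carrier (quot_poset C G)" "b \<sqsubseteq>\<^bsub>quot_poset C G\<^esub> pull q a"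
    then obtain y where y: "y \<in> quotients C G" "b = quot_class C y" "quot_le C y (Comp C x q)"
      using x pull_quot_class[OF q x(1)] le_quot_poset_iff[OF Comp_quotients[OF q x(1)]]
      by (auto simp: carrier_quot_poset)
    have x': "x \<in> hom C (Cod C q) (Cod C x)" using x(1) by (rule quotientsE)
    have y': "y \<in> hom C G (Cod C y)" "epi C y" using y(1) by (auto elim: quotientsE)
    obtain h where h: "h \<in> hom C (Cod C x) (Cod C y)" "y = Comp C h (Comp C x q)"
      using quot_leE[OF y(3) Comp_hom[OF q' x'] y'(1)] .
    have e: "y = Comp C (Comp C h x) q" using h Comp_assoc[OF q' x' h(1)] by simp
    have "epi C (Comp C h x)" using epi_left_factor[OF q' Comp_hom[OF x' h(1)]] e y'(2) by simp
    hence m: "Comp C h x \<in> quotients C (Cod C q)" using quotientsI Comp_hom[OF x' h(1)] by blast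
    have "b = pull q (quot_class C (Comp C h x))" using pull_quot_class[OF q m] y(2) e by simp
    thus "b \<in> pull q ` carrier (quot_poset C (Cod C q))" using quot_class_carrier[OF m] by simp
  next
    fix a b assume "a \<in> carrier (quot_poset C (Cod C q))" "b \<in> carrier (quot_poset C (Cod C q))"
    then obtain x y where x: "x \<in> quotients C (Cod C q)" "a = quot_class C x"
      and y: "y \<in> quotients C (Cod C q)" "b = quot_class C y"
      by (auto simp: carrier_quot_poset)
    show "pull q a \<sqsubseteq>\<^bsub>quot_poset C G\<^esub> pull q b \<longleftrightarrow> a \<sqsubseteq>\<^bsub>quot_poset C (Cod C q)\<^esub> b"
      using x y pull_quot_class[OF q] Comp_quot_le_iff[OF q x(1) y(1)]
        le_quot_poset_iff[OF y(1) x(1)]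
        le_quot_poset_iff[OF Comp_quotients[OF q y(1)] Comp_quotients[OF q x(1)]] by simp
  qed
qed

section \<open>Levels\<close>

lemma iso_stable_level: "iso_stable C (level_generated C B)"
  and downward_closed_level: "downward_closed C (level_generated C B)"
  and join_closed_level: "join_closed C (level_generated C B)"
  and generators_subset_level: "B \<subseteq> level_generated C B"
  and minimal_subset_level: "{G. minimal_object C G} \<subseteq> level_generated C B"
  if B: "B \<subseteq> Obj C"
proof -
  let ?F = "{S. iso_stable C S \<and> downward_closed C S \<and> join_closed C S \<and>
         B \<subseteq> S \<and> {G. minimal_object C G} \<subseteq> S}"
  have F: "level_generated C B = \<Inter> ?F" by (simp add: level_generated_def)
  \<comment> \<open>The intersection that defines the level is not empty: \<open>Obj C\<close> is one of the sets.\<close>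
  have "Obj C \<in> ?F"
    using B unfolding iso_stable_def downward_closed_def join_closed_def
    by (auto simp: iso_class_def minimal_object_def elim: quotientsE)
  hence sub: "level_generated C B \<subseteq> Obj C" unfolding F by blast
  show "iso_stable C (level_generated C B)"
    using sub unfolding F iso_stable_def by blast
  show "downward_closed C (level_generated C B)" unfolding F downward_closed_def by blast
  show "join_closed C (level_generated C B)"
    unfolding join_closed_def
  proof (intro ballI impI)
    fix G p q j assume h: "G \<in> Obj C" "p \<in> quotients C G" "q \<in> quotients C G" "j \<in> quotients C G"
      "Cod C p \<in> level_generated C B" "Cod C q \<in> level_generated C B"
      "least (quot_poset C G) (quot_class C j)
        (Upper (quot_poset C G) {quot_class C p, quot_class C q})"
    have "Cod C j \<in> S" if S: "S \<in> ?F" for S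
    proof -
      have "join_closed C S" "Cod C p \<in> S" "Cod C q \<in> S" using S h(5,6) unfolding F by blast+
      thus ?thesis using h(1-4,7) unfolding join_closed_def by blast
    qed
    thus "Cod C j \<in> level_generated C B" unfolding F by blast
  qed
  show "B \<subseteq> level_generated C B" "{G. minimal_object C G} \<subseteq> level_generated C B"
    unfolding F by blast+
qed

lemma level_generated_subset:
  assumes "iso_stable C S" "downward_closed C S" "join_closed C S" "B \<subseteq> S"
    "{G. minimal_object C G} \<subseteq> S"
  shows "level_generated C B \<subseteq> S"
  unfolding level_generated_def using assms by blast

lemma levelE:
  assumes "L \<in> levels C"
  obtains B where "finite B" "B \<subseteq> Obj C" "L = level_generated C B"
  using assms unfolding levels_def by blast

lemma level_closed:
  assumes "L \<in> levels C"
  shows "iso_stable C L" "downward_closed C L" "join_closed C L" "{G. minimal_object C G} \<subseteq> L"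
proof -
  obtain B where "B \<subseteq> Obj C" "L = level_generated C B" using levelE[OF assms] .
  thus "iso_stable C L" "downward_closed C L" "join_closed C L" "{G. minimal_object C G} \<subseteq> L"
    using iso_stable_level downward_closed_level join_closed_level minimal_subset_level by auto
qed

lemma level_Obj: "L \<in> levels C \<Longrightarrow> G \<in> L \<Longrightarrow> G \<in> Obj C"
  using level_closed(1) unfolding iso_stable_def by blast

lemma level_isomorphic: "L \<in> levels C \<Longrightarrow> G \<in> L \<Longrightarrow> isomorphic C G H \<Longrightarrow> H \<in> L"
  using level_closed(1) isomorphic_Obj unfolding iso_stable_def iso_class_def by blast

lemma level_quotient_closed: "L \<in> levels C \<Longrightarrow> G \<in> L \<Longrightarrow> p \<in> hom C G H \<Longrightarrow> epi C p \<Longrightarrow> H \<in> L"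
  using level_closed(2) quotientsI hom_Cod unfolding downward_closed_def by metis

lemma finite_levels_upper_bound:
  assumes "finite F" "F \<subseteq> levels C"
  shows "\<exists>L \<in> levels C. \<forall>K \<in> F. K \<subseteq> L"
  using assms
proof (induction F rule: finite_induct)
  case empty
  have "level_generated C {} \<in> levels C" unfolding levels_def by blast
  thus ?case by blast
next
  case (insert K F)
  then obtain L where L: "L \<in> levels C" "\<forall>K \<in> F. K \<subseteq> L" by auto
  obtain B where B: "finite B" "B \<subseteq> Obj C" "L = level_generated C B" using levelE[OF L(1)] .
  obtain D where D: "finite D" "D \<subseteq> Obj C" "K = level_generated C D"
    using levelE insert.prems by blast
  have BD: "B \<union> D \<subseteq> Obj C" using B D by blast
  let ?L = "level_generated C (B \<union> D)"
  have "B \<subseteq> ?L" "D \<subseteq> ?L" using generators_subset_level[OF BD] by auto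
  hence "L \<subseteq> ?L" "K \<subseteq> ?L"
    using level_generated_subset[of ?L] iso_stable_level[OF BD] downward_closed_level[OF BD]
      join_closed_level[OF BD] minimal_subset_level[OF BD] B(3) D(3) by auto
  moreover have "?L \<in> levels C" using B D BD unfolding levels_def by blast
  ultimately show ?case using L(2) by (intro bexI[of _ ?L]) auto
qed

lemma ex_level_containing:
  assumes "G \<in> Obj C"
  obtains L where "L \<in> levels C" "G \<in> L"
proof -
  have "level_generated C {G} \<in> levels C" using assms unfolding levels_def by blast
  moreover have "G \<in> level_generated C {G}" using generators_subset_level[of "{G}"] assms by blast
  ultimately show ?thesis using that by blast
qed

end

context diamond_category
begin

lemma finite_modular_quotients: "G \<in> Obj C \<Longrightarrow> finite_modular_lattice (quot_poset C G)"
  using finite_quotients modular_quotients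
  unfolding finite_modular_lattice_def finite_modular_lattice_axioms_def by blast

lemma lattice_quotients: "G \<in> Obj C \<Longrightarrow> lattice (quot_poset C G)"
  using modular_quotients unfolding modular_lattice_def by blast

text \<open>
  An object is the top of its own lattice of quotients.
\<close>

definition obj_socle_length_le :: "nat \<Rightarrow> 'o \<Rightarrow> bool" where
  "obj_socle_length_le k G \<longleftrightarrow> socle_length_le (quot_poset C G) k (quot_class C (Ident C G))"

lemma obj_socle_length_le_quotient:
  assumes p: "p \<in> quotients C G"
  shows "obj_socle_length_le k (Cod C p) \<longleftrightarrow> socle_length_le (quot_poset C G) k (quot_class C p)"
proof -
  have o: "G \<in> Obj C" "Cod C p \<in> Obj C" and h: "p \<in> hom C G (Cod C p)"
    using p by (auto elim: quotientsE)
  interpret lower_embedding "quot_poset C (Cod C p)" "quot_poset C G" "pull p"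
    using lower_embedding_pull[OF p lattice_quotients[OF o(2)] lattice_quotients[OF o(1)]] .
  note i = Ident_quotients[OF o(2)]
  show ?thesis
    using socle_length_le_iff[OF quot_class_carrier[OF i]] pull_quot_class[OF p i]
      Comp_Ident_left[OF h] unfolding obj_socle_length_le_def by simp
qed

lemma top_quot_poset:
  assumes "G \<in> Obj C" "a \<in> carrier (quot_poset C G)"
  shows "a \<sqsubseteq>\<^bsub>quot_poset C G\<^esub> quot_class C (Ident C G)"
proof -
  obtain p where p: "p \<in> quotients C G" "a = quot_class C p"
    using assms(2) by (auto simp: carrier_quot_poset)
  have h: "p \<in> hom C G (Cod C p)" using p(1) by (rule quotientsE)
  have "quot_le C p (Ident C G)"
    using quot_leI[OF Ident_hom[OF assms(1)] h] Comp_Ident_right[OF h] by simp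
  thus ?thesis using le_quot_poset_iff[OF Ident_quotients[OF assms(1)] p(1)] p(2) by simp
qed

text \<open>
  The objects of socle length at most \<open>k\<close> are closed under quotients and joins and contain the
  minimal objects. For \<open>k\<close> large enough they contain the finitely many generators of a level,
  hence the level, although the composition lengths in a level are in general unbounded.
\<close>

lemma level_bounded_socle_length:
  assumes L: "L \<in> levels C"
  shows "\<exists>k. \<forall>G \<in> L. obj_socle_length_le k G"
proof -
  obtain B where B: "finite B" "B \<subseteq> Obj C" "L = level_generated C B" using levelE[OF L] .
  have "\<exists>k. \<forall>G \<in> B. obj_socle_length_le k G" using B(1,2)
  proof (induction B rule: finite_induct)
    case (insert G B)
    then obtain k where k: "\<forall>G \<in> B. obj_socle_length_le k G" by blast
    have G: "G \<in> Obj C" using insert.prems by blast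
    interpret G: finite_modular_lattice "quot_poset C G" using finite_modular_quotients[OF G] .
    obtain n where n: "obj_socle_length_le n G"
      using G.ex_socle_length_le quot_class_carrier[OF Ident_quotients[OF G]]
      unfolding obj_socle_length_le_def by blast
    have "obj_socle_length_le (max k n) H" if "H \<in> insert G B" for H
    proof -
      have H: "H \<in> Obj C" using that insert.prems by blast
      interpret H: finite_modular_lattice "quot_poset C H" using finite_modular_quotients[OF H] .
      show ?thesis using that k n H.socle_length_le_mono
        unfolding obj_socle_length_le_def by (metis insertE max.cobounded1 max.cobounded2)
    qed
    thus ?case by blast
  qed simp
  then obtain k where k: "\<forall>G \<in> B. obj_socle_length_le k G" by blast
  let ?S = "{G \<in> Obj C. obj_socle_length_le k G}"
  have down: "downward_closed C ?S"
    unfolding downward_closed_def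
  proof (intro ballI)
    fix G p assume G: "G \<in> ?S" and p: "p \<in> quotients C G"
    interpret G: finite_modular_lattice "quot_poset C G" using finite_modular_quotients G by blast
    have "socle_length_le (quot_poset C G) k (quot_class C p)"
      using G.socle_length_le_lower[OF _ quot_class_carrier[OF p] top_quot_poset] G
        quot_class_carrier[OF p] unfolding obj_socle_length_le_def by blast
    thus "Cod C p \<in> ?S" using obj_socle_length_le_quotient[OF p] p by (auto elim: quotientsE)
  qed
  moreover have "iso_stable C ?S"
    unfolding iso_stable_def
  proof (intro conjI ballI subsetI)
    fix G H assume G: "G \<in> ?S" and "H \<in> iso_class C G"
    then obtain f where f: "f \<in> hom C G H" "iso C f" unfolding iso_class_def isomorphic_def by blast
    thus "H \<in> ?S"
      using down G quotientsI[OF f(1) iso_epi[OF f]] hom_Cod[OF f(1)]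
      unfolding downward_closed_def by blast
  qed auto
  moreover have "join_closed C ?S"
    unfolding join_closed_def
  proof (intro ballI impI)
    fix G p q j assume G: "G \<in> Obj C"
      and p: "p \<in> quotients C G" and q: "q \<in> quotients C G" and j: "j \<in> quotients C G"
      and S: "Cod C p \<in> ?S" "Cod C q \<in> ?S"
      and least: "least (quot_poset C G) (quot_class C j)
        (Upper (quot_poset C G) {quot_class C p, quot_class C q})"
    interpret G: finite_modular_lattice "quot_poset C G" using finite_modular_quotients[OF G] .
    have "quot_class C j = quot_class C p \<squnion>\<^bsub>quot_poset C G\<^esub> quot_class C q"
      using G.least_unique[OF least]
        G.sup_of_two_least[OF quot_class_carrier[OF p] quot_class_carrier[OF q]]
      unfolding join_def by blast
    hence "socle_length_le (quot_poset C G) k (quot_class C j)"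
      using G.socle_length_le_join S obj_socle_length_le_quotient p q by simp
    thus "Cod C j \<in> ?S" using obj_socle_length_le_quotient[OF j] j by (auto elim: quotientsE)
  qed
  moreover have "B \<subseteq> ?S" using k B(2) by blast
  moreover have "{G. minimal_object C G} \<subseteq> ?S"
  proof
    fix G assume "G \<in> {G. minimal_object C G}"
    hence G: "G \<in> Obj C" "carrier (quot_poset C G) = {quot_class C (Ident C G)}"
      unfolding minimal_object_def by auto
    interpret G: finite_modular_lattice "quot_poset C G" using finite_modular_quotients[OF G(1)] .
    have "socle_length_le (quot_poset C G) 0 (quot_class C (Ident C G))"
      using G(2) G.le_refl by auto
    thus "G \<in> ?S" using G(1) G.socle_length_le_mono unfolding obj_socle_length_le_def by blast
  qed
  ultimately have "L \<subseteq> ?S" using level_generated_subset B(3) by simp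
  thus ?thesis by blast
qed

end

section \<open>Quotients of pro-objects\<close>

context category
begin

text \<open>
  For the pro-category this makes \<open>pro_level_quotient\<close> an isomorphism invariant.
\<close>

lemma max_quotient_iso:
  assumes p: "max_quotient C S Z p" and f: "f \<in> hom C Y Z" "iso C f"
  shows "max_quotient C S Y (Comp C p f)" "Cod C (Comp C p f) = Cod C p"
proof -
  obtain g where g: "g \<in> hom C Z Y" "Comp C g f = Ident C Y" "iso C g" using isoE[OF f(2,1)] by metis
  have p': "p \<in> hom C Z (Cod C p)" "epi C p" and pS: "Cod C p \<in> S"
    using p unfolding max_quotient_def by (auto elim: quotientsE)
  note pf = Comp_hom[OF f(1) p'(1)]
  show c: "Cod C (Comp C p f) = Cod C p" using hom_Cod[OF pf] .
  have "quot_le C q (Comp C p f)" if q: "q \<in> quotients C Y" "Cod C q \<in> S" for q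
  proof -
    have q': "q \<in> hom C Y (Cod C q)" "epi C q" using q by (auto elim: quotientsE)
    note qg = Comp_hom[OF g(1) q'(1)]
    have "Comp C q g \<in> quotients C Z"
      using quotientsI[OF qg epi_Comp[OF g(1) iso_epi[OF g(1,3)] q']] .
    moreover have "Cod C (Comp C q g) \<in> S" using hom_Cod[OF qg] q(2) by simp
    ultimately have "quot_le C (Comp C q g) p" using p unfolding max_quotient_def by blast
    then obtain h where h: "h \<in> hom C (Cod C p) (Cod C q)" "Comp C q g = Comp C h p"
      using quot_leE[OF _ p'(1) qg] by metis
    have "q = Comp C (Comp C q g) f"
      using Comp_assoc[OF f(1) g(1) q'(1)] g(2) Comp_Ident_right[OF q'(1)] by simp
    also have "\<dots> = Comp C h (Comp C p f)" using h(2) Comp_assoc[OF f(1) p'(1) h(1)] by simp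
    finally show ?thesis using quot_leI[OF pf h(1)] by simp
  qed
  thus "max_quotient C S Y (Comp C p f)"
    unfolding max_quotient_def
    using quotientsI[OF pf epi_Comp[OF f(1) iso_epi[OF f] p']] c pS by auto
qed

end

lemma pro_level_quotient_iso:
  fixes C :: "('o, 'm) cat" and Y Z :: "('i, 'j, 'o, 'm) pro_obj"
  assumes "isomorphic (pro_cat C) Y Z"
  shows "pro_level_quotient C L Y = pro_level_quotient C L Z"
proof -
  interpret P: category "pro_cat C" by (rule category_pro_cat)
  have "pro_level_quotient C L Z' \<subseteq> pro_level_quotient C L Y'"
    if iso: "isomorphic (pro_cat C) Y' Z'" for Y' Z' :: "('i, 'j, 'o, 'm) pro_obj"
  proof -
    obtain f where f: "f \<in> hom (pro_cat C) Y' Z'" "iso (pro_cat C) f"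
      using iso unfolding isomorphic_def by blast
    show ?thesis
    proof
      fix G assume "G \<in> pro_level_quotient C L Z'"
      then obtain p where p: "G \<in> L" "max_quotient (pro_cat C) (const_pro C ` L) Z' p"
        "Cod (pro_cat C) p = const_pro C G"
        unfolding pro_level_quotient_def by blast
      have "Cod (pro_cat C) (Comp (pro_cat C) p f) = const_pro C G"
        using P.max_quotient_iso(2)[OF p(2) f] p(3) by simp
      thus "G \<in> pro_level_quotient C L Y'"
        using P.max_quotient_iso(1)[OF p(2) f] p(1) unfolding pro_level_quotient_def by blast
    qed
  qed
  thus ?thesis using assms P.isomorphic_sym by blast
qed

lemma const_pro_simps [simp]:
  "Obj (idx (const_pro C G)) = {undefined}" "Arr (idx (const_pro C G)) = {undefined}"
  "on_obj (const_pro C G) i = G" "on_arr (const_pro C G) u = Ident C G"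
  "Dom (idx (const_pro C G)) u = undefined" "Cod (idx (const_pro C G)) u = undefined"
  by (simp_all add: const_pro_def)

lemma const_pro_eq_iff [simp]: "const_pro C G = const_pro C H \<longleftrightarrow> G = H"
  using const_pro_simps(3) by metis

lemma germ_const_pro:
  fixes C :: "('o, 'm) cat"
  assumes "category C" and f: "f \<in> hom C G A"
  shows "germ C (const_pro C G :: ('i, 'j, 'o, 'm) pro_obj) undefined f = {(undefined, f)}"
proof -
  interpret category C by fact
  let ?K = "const_pro C G :: ('i, 'j, 'o, 'm) pro_obj"
  have hom: "hom (idx ?K) undefined undefined = {undefined}"
    by (auto simp: hom_def)
  have "(i, g) \<in> germ C ?K undefined f \<longleftrightarrow> i = undefined \<and> g = f" for i g
  proof (cases "i = undefined \<and> g \<in> hom C G A")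
    case True
    thus ?thesis
      using hom hom_Cod[OF f] Comp_Ident_right[OF f] Comp_Ident_right[of g G A]
      by (auto simp: germ_def)
  next
    case False
    thus ?thesis using f hom_Cod[OF f] by (auto simp: germ_def)
  qed
  thus ?thesis by auto
qed

lemma germs_const_pro:
  assumes "category C"
  shows "germs C (const_pro C G) A = (\<lambda>f. {(undefined, f)}) ` hom C G A"
  unfolding germs_def using germ_const_pro[OF assms] by fastforce

text \<open>
  The pro-object of an object of \<open>C\<close> has the single index \<open>undefined\<close>, so a morphism to it is
  one germ.
\<close>

definition to_const ::
  "('o, 'm) cat \<Rightarrow> ('i, 'j, 'o, 'm) pro_obj \<Rightarrow> 'o \<Rightarrow> ('i \<times> 'm) set \<Rightarrow>
    ('i, 'j, 'o, 'm) pro_obj \<times> ('i, 'j, 'o, 'm) pro_obj \<times> ('i \<Rightarrow> ('i \<times> 'm) set)" where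
  "to_const C Z G a = (Z, const_pro C G, \<lambda>j \<in> {undefined}. a)"

text \<open>
  Cancellation is tested against objects of \<open>C\<close> only. By \<open>epi_to_const_iff\<close> this is the same
  as being an epimorphism of pro-objects.
\<close>

definition epi_germ ::
  "('o, 'm) cat \<Rightarrow> ('i, 'j, 'o, 'm) pro_obj \<Rightarrow> 'o \<Rightarrow> ('i \<times> 'm) set \<Rightarrow> bool" where
  "epi_germ C Z G a \<longleftrightarrow> a \<in> germs C Z G \<and>
    (\<forall>B. \<forall>g \<in> hom C G B. \<forall>h \<in> hom C G B. germ_post C Z g a = germ_post C Z h a \<longrightarrow> g = h)"

text \<open>
  The map to the maximal quotient in \<open>L\<close>, formulated without the pro-category.
\<close>

definition max_germ ::
  "('o, 'm) cat \<Rightarrow> 'o set \<Rightarrow> ('i, 'j, 'o, 'm) pro_obj \<Rightarrow> 'o \<Rightarrow> ('i \<times> 'm) set \<Rightarrow> bool" where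
  "max_germ C L Z G a \<longleftrightarrow> G \<in> L \<and> epi_germ C Z G a \<and>
    (\<forall>H \<in> L. \<forall>b. epi_germ C Z H b \<longrightarrow> (\<exists>h \<in> hom C G H. b = germ_post C Z h a))"

context pro_object
begin

lemma germ_post_Ident: "a \<in> germs C Y G \<Longrightarrow> germ_post C Y (Ident C G) a = a"
  using germsE germ_post_germ C.Comp_Ident_left C.Ident_hom C.hom_Obj(2) by metis

lemma germs_Obj: "a \<in> germs C Y G \<Longrightarrow> G \<in> Obj C"
  using germsE C.hom_Obj(2) by metis

lemma hom_const_pro_iff:
  assumes G: "G \<in> Obj C"
  shows "p \<in> hom (pro_cat C) Y (const_pro C G) \<longleftrightarrow> (\<exists>a \<in> germs C Y G. p = to_const C Y G a)"
proof
  assume "p \<in> hom (pro_cat C) Y (const_pro C G)"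
  then obtain \<phi> where \<phi>: "\<phi> \<in> pro_hom C Y (const_pro C G)" "p = (Y, const_pro C G, \<phi>)"
    unfolding pro_cat_hom by blast
  have "\<phi> = (\<lambda>j \<in> {undefined}. \<phi> undefined)"
    using pro_homD(3)[OF \<phi>(1)] by (intro extensionalityI[of _ "{undefined}"]) auto
  moreover have "\<phi> undefined \<in> germs C Y G" using pro_homD(1)[OF \<phi>(1)] by simp
  ultimately show "\<exists>a \<in> germs C Y G. p = to_const C Y G a" using \<phi>(2) unfolding to_const_def by metis
next
  assume "\<exists>a \<in> germs C Y G. p = to_const C Y G a"
  then obtain a where a: "a \<in> germs C Y G" "p = to_const C Y G a" by blast
  have "(\<lambda>j \<in> {undefined}. a) \<in> pro_hom C Y (const_pro C G)"
    unfolding pro_hom_def using a(1) germ_post_Ident[OF a(1)] by auto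
  moreover have "pro_object C (const_pro C G)" using pro_object_const_pro[OF C.category_axioms G] .
  ultimately show "p \<in> hom (pro_cat C) Y (const_pro C G)"
    unfolding pro_cat_hom using a(2) pro_object_axioms unfolding to_const_def by blast
qed

lemma pro_comp_const:
  assumes a: "a \<in> germs C Y G" and k: "k \<in> Obj (idx W)" and g: "g \<in> hom C G B"
    and \<psi>: "\<psi> k = {(undefined, g)}"
  shows "pro_comp C Y W \<psi> (\<lambda>j \<in> {undefined}. a) k = germ_post C Y g a"
proof -
  have G: "G \<in> Obj C" using germs_Obj[OF a] .
  have "to_const C Y G a \<in> hom (pro_cat C) Y (const_pro C G)" using hom_const_pro_iff[OF G] a by blast
  hence "(\<lambda>j \<in> {undefined}. a) \<in> pro_hom C Y (const_pro C G)"
    unfolding pro_cat_hom to_const_def by auto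
  moreover have "germ C (const_pro C G :: ('i, 'j, 'o, 'm) pro_obj) undefined g = {(undefined, g)}"
    by (rule germ_const_pro[OF C.category_axioms g])
  ultimately show ?thesis
    using pro_comp_germ[OF pro_object_axioms pro_object_const_pro[OF C.category_axioms G], of _ k W
        undefined g B \<psi>] k g \<psi> by simp
qed

lemma Comp_to_const:
  assumes a: "a \<in> germs C Y G" and h: "h \<in> hom C G H"
  shows "Comp (pro_cat C) (to_const C (const_pro C G) H {(undefined, h)})
      (to_const C Y G a) = to_const C Y H (germ_post C Y h a)"
proof -
  have "pro_comp C Y (const_pro C H) (\<lambda>j \<in> {undefined}. {(undefined, h)})
      (\<lambda>j \<in> {undefined}. a) = (\<lambda>j \<in> {undefined}. germ_post C Y h a)" (is "?l = ?r")
  proof (rule extensionalityI[of _ "{undefined}"])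
    show "?l \<in> extensional {undefined}" by (simp add: pro_comp_def)
    fix k :: 'i assume "k \<in> {undefined}"
    thus "?l k = ?r k" using pro_comp_const[OF a _ h, of k "const_pro C H"] by simp
  qed simp
  thus ?thesis unfolding to_const_def by (simp add: pro_cat_def)
qed

lemma epi_germD:
  "epi_germ C Y G a \<Longrightarrow> g \<in> hom C G B \<Longrightarrow> h \<in> hom C G B \<Longrightarrow>
    germ_post C Y g a = germ_post C Y h a \<Longrightarrow> g = h"
  "epi_germ C Y G a \<Longrightarrow> a \<in> germs C Y G"
  unfolding epi_germ_def by blast+

text \<open>
  A morphism from an object \<open>G\<close> of \<open>C\<close> to a pro-object \<open>W\<close> is a family of arrows from \<open>G\<close>
  to the objects of \<open>W\<close>, and each of them can be cancelled separately.
\<close>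

lemma epi_to_const_iff:
  assumes a: "a \<in> germs C Y G"
  shows "epi (pro_cat C) (to_const C Y G a) \<longleftrightarrow> epi_germ C Y G a"
proof
  note G = germs_Obj[OF a]
  note c = pro_object_const_pro[OF C.category_axioms G]
  have hom: "to_const C Y G a \<in> hom (pro_cat C) Y (const_pro C G)"
    using hom_const_pro_iff[OF G] a by blast
  interpret P: category "pro_cat C" by (rule category_pro_cat)
  interpret K: pro_object C "const_pro C G :: ('i, 'j, 'o, 'm) pro_obj" by (rule c)
  {
    assume e: "epi (pro_cat C) (to_const C Y G a)"
    have "g = h" if gh: "g \<in> hom C G B" "h \<in> hom C G B"
      and eq: "germ_post C Y g a = germ_post C Y h a" for B g h
    proof -
      note B = C.hom_Obj(2)[OF gh(1)]
      let ?t = "\<lambda>g. to_const C (const_pro C G :: ('i, 'j, 'o, 'm) pro_obj) B {(undefined, g)}"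
      have t: "?t f \<in> hom (pro_cat C) (const_pro C G) (const_pro C B)" if "f \<in> hom C G B" for f
        using K.hom_const_pro_iff[OF B] germs_const_pro[OF C.category_axioms] that by blast
      have "?t g = ?t h"
        using P.epi_cancel[OF e hom t[OF gh(1)] t[OF gh(2)]] Comp_to_const[OF a] gh eq by simp
      hence "{(undefined, g)} = {(undefined, h)}"
        unfolding to_const_def by (auto dest: fun_cong[of _ _ undefined])
      thus ?thesis by simp
    qed
    thus "epi_germ C Y G a" using a unfolding epi_germ_def by blast
  }
  assume e: "epi_germ C Y G a"
  show "epi (pro_cat C) (to_const C Y G a)"
  proof (rule P.epiI[OF hom])
    fix W g h assume "g \<in> hom (pro_cat C) (const_pro C G) W" "h \<in> hom (pro_cat C) (const_pro C G) W"
      and eq: "Comp (pro_cat C) g (to_const C Y G a) = Comp (pro_cat C) h (to_const C Y G a)"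
    then obtain \<phi> \<psi> where \<phi>: "\<phi> \<in> pro_hom C (const_pro C G) W" "g = (const_pro C G, W, \<phi>)"
      and \<psi>: "\<psi> \<in> pro_hom C (const_pro C G) W" "h = (const_pro C G, W, \<psi>)"
      unfolding pro_cat_hom by blast
    have pc: "pro_comp C Y W \<phi> (\<lambda>j \<in> {undefined}. a) = pro_comp C Y W \<psi> (\<lambda>j \<in> {undefined}. a)"
      using eq \<phi>(2) \<psi>(2) by (simp add: pro_cat_def to_const_def)
    have "\<phi> k = \<psi> k" if k: "k \<in> Obj (idx W)" for k
    proof -
      obtain f f' where f: "f \<in> hom C G (on_obj W k)" "\<phi> k = {(undefined, f)}"
        and f': "f' \<in> hom C G (on_obj W k)" "\<psi> k = {(undefined, f')}"
        using pro_homD(1)[OF \<phi>(1) k] pro_homD(1)[OF \<psi>(1) k]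
        unfolding germs_const_pro[OF C.category_axioms] by blast
      have "germ_post C Y f a = germ_post C Y f' a"
        using pro_comp_const[where \<psi> = \<phi>, OF a k f] pro_comp_const[where \<psi> = \<psi>, OF a k f'] pc by simp
      thus ?thesis using epi_germD(1)[OF e f(1) f'(1)] f f' by simp
    qed
    hence "\<phi> = \<psi>" by (rule extensionalityI[OF pro_homD(3)[OF \<phi>(1)] pro_homD(3)[OF \<psi>(1)]])
    thus "g = h" using \<phi> \<psi> by simp
  qed
qed

lemma quot_le_to_const_iff:
  assumes a: "a \<in> germs C Y G" and b: "b \<in> germs C Y H"
  shows "quot_le (pro_cat C) (to_const C Y H b) (to_const C Y G a) \<longleftrightarrow>
    (\<exists>h \<in> hom C G H. b = germ_post C Y h a)"
proof -
  note G = germs_Obj[OF a] and H = germs_Obj[OF b]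
  interpret K: pro_object C "const_pro C G :: ('i, 'j, 'o, 'm) pro_obj" by (rule pro_object_const_pro[OF C.category_axioms G])
  have cod: "Cod (pro_cat C) (to_const C Y F c) = const_pro C F" for F c
    by (simp add: to_const_def pro_cat_def)
  have inj: "to_const C Y H c = to_const C Y H d \<longleftrightarrow> c = d" for c d
    unfolding to_const_def by (auto dest: fun_cong[of _ _ undefined])
  show ?thesis
  proof
    assume "quot_le (pro_cat C) (to_const C Y H b) (to_const C Y G a)"
    then obtain t where t: "t \<in> hom (pro_cat C) (const_pro C G) (const_pro C H)"
      "to_const C Y H b = Comp (pro_cat C) t (to_const C Y G a)"
      unfolding quot_le_def cod by blast
    then obtain c where c: "c \<in> germs C (const_pro C G :: ('i, 'j, 'o, 'm) pro_obj) H"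
      "t = to_const C (const_pro C G) H c"
      unfolding K.hom_const_pro_iff[OF H] by blast
    then obtain h where h: "h \<in> hom C G H" "c = {(undefined, h)}"
      unfolding germs_const_pro[OF C.category_axioms] by blast
    thus "\<exists>h \<in> hom C G H. b = germ_post C Y h a"
      using t(2) c(2) Comp_to_const[OF a h(1)] inj by auto
  next
    assume "\<exists>h \<in> hom C G H. b = germ_post C Y h a"
    then obtain h where h: "h \<in> hom C G H" "b = germ_post C Y h a" by blast
    have "to_const C (const_pro C G :: ('i, 'j, 'o, 'm) pro_obj) H {(undefined, h)}
        \<in> hom (pro_cat C) (const_pro C G) (const_pro C H)"
      using h(1) unfolding K.hom_const_pro_iff[OF H] germs_const_pro[OF C.category_axioms] by blast
    thus "quot_le (pro_cat C) (to_const C Y H b) (to_const C Y G a)"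
      unfolding quot_le_def cod using Comp_to_const[OF a h(1)] h(2) by metis
  qed
qed

lemma pro_level_quotient_iff:
  assumes L: "L \<subseteq> Obj C"
  shows "pro_level_quotient C L Y = {G \<in> L. \<exists>a. max_germ C L Y G a}"
proof -
  interpret P: category "pro_cat C" by (rule category_pro_cat)
  have quot: "q \<in> quotients (pro_cat C) Y \<and> Cod (pro_cat C) q = const_pro C H \<longleftrightarrow>
      (\<exists>b. epi_germ C Y H b \<and> q = to_const C Y H b)" if H: "H \<in> Obj C" for q H
  proof
    assume "q \<in> quotients (pro_cat C) Y \<and> Cod (pro_cat C) q = const_pro C H"
    hence e: "epi (pro_cat C) q" and h: "q \<in> hom (pro_cat C) Y (const_pro C H)"
      unfolding P.quotients_iff by (simp, metis)
    obtain b where b: "b \<in> germs C Y H" "q = to_const C Y H b"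
      using h unfolding hom_const_pro_iff[OF H] by (rule bexE)
    thus "\<exists>b. epi_germ C Y H b \<and> q = to_const C Y H b"
      using e epi_to_const_iff[OF b(1)] by blast
  next
    assume "\<exists>b. epi_germ C Y H b \<and> q = to_const C Y H b"
    then obtain b where b: "epi_germ C Y H b" "q = to_const C Y H b" by blast
    note b' = epi_germD(2)[OF b(1)]
    have "q \<in> hom (pro_cat C) Y (const_pro C H)" "epi (pro_cat C) q"
      using hom_const_pro_iff[OF H] epi_to_const_iff[OF b'] b b' by auto
    thus "q \<in> quotients (pro_cat C) Y \<and> Cod (pro_cat C) q = const_pro C H"
      using P.quotientsI hom_Cod by metis
  qed
  have "(\<exists>p. max_quotient (pro_cat C) (const_pro C ` L) Y p \<and> Cod (pro_cat C) p = const_pro C G)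
      \<longleftrightarrow> (\<exists>a. max_germ C L Y G a)" if G: "G \<in> L" for G
  proof
    assume "\<exists>p. max_quotient (pro_cat C) (const_pro C ` L) Y p \<and> Cod (pro_cat C) p = const_pro C G"
    then obtain p where p: "max_quotient (pro_cat C) (const_pro C ` L) Y p"
      "Cod (pro_cat C) p = const_pro C G" by blast
    then obtain a where a: "epi_germ C Y G a" "p = to_const C Y G a"
      using quot G L unfolding max_quotient_def by blast
    have "\<exists>h \<in> hom C G H. b = germ_post C Y h a" if H: "H \<in> L" and b: "epi_germ C Y H b" for H b
    proof -
      have "to_const C Y H b \<in> quotients (pro_cat C) Y"
        "Cod (pro_cat C) (to_const C Y H b) = const_pro C H"
        using quot[of H "to_const C Y H b"] H L b by blast+
      hence "quot_le (pro_cat C) (to_const C Y H b) p"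
        using p(1) H unfolding max_quotient_def by auto
      thus ?thesis using quot_le_to_const_iff[OF epi_germD(2)[OF a(1)] epi_germD(2)[OF b]] a by simp
    qed
    thus "\<exists>a. max_germ C L Y G a" using a G unfolding max_germ_def by blast
  next
    assume "\<exists>a. max_germ C L Y G a"
    then obtain a where a: "max_germ C L Y G a" by blast
    hence e: "epi_germ C Y G a" unfolding max_germ_def by blast
    let ?p = "to_const C Y G a"
    have p: "?p \<in> quotients (pro_cat C) Y" "Cod (pro_cat C) ?p = const_pro C G"
      using quot[of G ?p] G L e by blast+
    have "quot_le (pro_cat C) q ?p"
      if q: "q \<in> quotients (pro_cat C) Y" "Cod (pro_cat C) q \<in> const_pro C ` L" for q
    proof -
      obtain H where H: "H \<in> L" "Cod (pro_cat C) q = const_pro C H" using q(2) by blast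
      then obtain b where b: "epi_germ C Y H b" "q = to_const C Y H b"
        using quot[of H q] q(1) L by blast
      thus ?thesis
        using a H(1) quot_le_to_const_iff[OF epi_germD(2)[OF e] epi_germD(2)[OF b(1)]]
        unfolding max_germ_def by blast
    qed
    moreover have "Cod (pro_cat C) ?p \<in> const_pro C ` L" using p(2) G by simp
    ultimately have "max_quotient (pro_cat C) (const_pro C ` L) Y ?p"
      using p(1) unfolding max_quotient_def by blast
    thus "\<exists>p. max_quotient (pro_cat C) (const_pro C ` L) Y p \<and> Cod (pro_cat C) p = const_pro C G"
      using p(2) by blast
  qed
  thus ?thesis unfolding pro_level_quotient_def by blast
qed

lemma epi_germ_post:
  assumes a: "epi_germ C Y G a" and h: "h \<in> hom C G H" "epi C h"
  shows "epi_germ C Y H (germ_post C Y h a)"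
  unfolding epi_germ_def
proof (intro conjI allI ballI impI)
  note a' = epi_germD(2)[OF a]
  show "germ_post C Y h a \<in> germs C Y H" using germ_post_germs[OF a' h(1)] .
  fix B f g assume f: "f \<in> hom C H B" and g: "g \<in> hom C H B"
    and "germ_post C Y f (germ_post C Y h a) = germ_post C Y g (germ_post C Y h a)"
  hence "germ_post C Y (Comp C f h) a = germ_post C Y (Comp C g h) a"
    using germ_post_comp[OF a' h(1)] by simp
  hence "Comp C f h = Comp C g h"
    using epi_germD(1)[OF a C.Comp_hom[OF h(1) f] C.Comp_hom[OF h(1) g]] by blast
  thus "f = g" by (rule C.epi_cancel[OF h(2,1) f g])
qed

lemma epi_of_epi_germ_post:
  assumes a: "a \<in> germs C Y G" and h: "h \<in> hom C G H" and e: "epi_germ C Y H (germ_post C Y h a)"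
  shows "epi C h"
proof (rule C.epiI[OF h])
  fix B f g assume f: "f \<in> hom C H B" and g: "g \<in> hom C H B" and eq: "Comp C f h = Comp C g h"
  show "f = g"
    by (rule epi_germD(1)[OF e f g])
      (simp add: germ_post_comp[OF a h f] germ_post_comp[OF a h g] eq)
qed

lemma germ_eq_post:
  assumes "i \<in> Obj I" "f \<in> hom C (on_obj Y i) G"
  shows "germ C Y i f = germ_post C Y f (germ C Y i (Ident C (on_obj Y i)))"
  using germ_post_germ[OF C.Ident_hom[OF on_obj[OF assms(1)]] assms]
    C.Comp_Ident_right[OF assms(2)] by simp

lemma epi_of_epi_germ:
  assumes "i \<in> Obj I" "f \<in> hom C (on_obj Y i) G" "epi_germ C Y G (germ C Y i f)"
  shows "epi C f"
  using epi_of_epi_germ_post[OF germsI[OF assms(1) C.Ident_hom[OF on_obj[OF assms(1)]]] assms(2)]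
    germ_eq_post[OF assms(1,2)] assms(3) by simp

end

locale epic_pro_object = pro_object C Y
  for C :: "('o, 'm) cat" and Y :: "('i, 'j, 'o, 'm) pro_obj" +
  assumes epi_arr: "u \<in> Arr (idx Y) \<Longrightarrow> epi C (on_arr Y u)"
begin

text \<open>
  If \<open>g\<close> and \<open>h\<close> become equal after two transition maps \<open>Y u\<close> and \<open>Y v\<close> with the same
  target, then a further transition map equalizes \<open>u\<close> and \<open>v\<close>, so that \<open>g\<close> and \<open>h\<close> agree
  after one transition map. It is an epimorphism and can be cancelled.
\<close>

lemma epi_germ_Ident:
  assumes i: "i \<in> Obj I"
  shows "epi_germ C Y (on_obj Y i) (germ C Y i (Ident C (on_obj Y i)))"
  unfolding epi_germ_def
proof (intro conjI allI ballI impI)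
  note id = C.Ident_hom[OF on_obj[OF i]]
  show "germ C Y i (Ident C (on_obj Y i)) \<in> germs C Y (on_obj Y i)" using germsI[OF i id] .
  fix B g h assume g: "g \<in> hom C (on_obj Y i) B" and h: "h \<in> hom C (on_obj Y i) B"
    and "germ_post C Y g (germ C Y i (Ident C (on_obj Y i))) =
      germ_post C Y h (germ C Y i (Ident C (on_obj Y i)))"
  hence "germ C Y i g = germ C Y i h" using germ_eq_post[OF i g] germ_eq_post[OF i h] by simp
  hence "(i, g) \<in> germ C Y i h" using germ_self[OF i g] by simp
  then obtain k u v where k: "k \<in> Obj I" "u \<in> hom I k i" "v \<in> hom I k i"
    "Comp C h (on_arr Y u) = Comp C g (on_arr Y v)"
    unfolding germ_def by auto
  obtain l w where w: "w \<in> hom I l k" "Comp I u w = Comp I v w"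
    using I.equalized[OF k(2,3)] by blast
  let ?w = "Comp I v w"
  have w': "?w \<in> hom I l i" using I.Comp_hom[OF w(1) k(3)] .
  have "Comp C h (on_arr Y ?w) = Comp C (Comp C h (on_arr Y u)) (on_arr Y w)"
    using on_Comp[OF w(1) k(2)] C.Comp_assoc[OF on_arr[OF w(1)] on_arr[OF k(2)] h] w(2) by simp
  also have "\<dots> = Comp C g (on_arr Y ?w)"
    using k(4) on_Comp[OF w(1) k(3)] C.Comp_assoc[OF on_arr[OF w(1)] on_arr[OF k(3)] g] by simp
  finally have "h = g"
    using C.epi_cancel[OF epi_arr on_arr[OF w'] h g] w' by (simp add: hom_def)
  thus "g = h" by simp
qed

lemma epi_germ_iff:
  assumes "i \<in> Obj I" "f \<in> hom C (on_obj Y i) G"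
  shows "epi_germ C Y G (germ C Y i f) \<longleftrightarrow> epi C f"
  using epi_of_epi_germ[OF assms] epi_germ_post[OF epi_germ_Ident[OF assms(1)] assms(2)]
    germ_eq_post[OF assms] by auto

end

locale small_epic_pro_object = epic_pro_object +
  assumes finite_epi_germs: "G \<in> Obj C \<Longrightarrow> finite {a. epi_germ C Y G a}"

lemma finite_epi_germs_iff:
  assumes "pro_object C Z" "G \<in> Obj C"
  shows "finite {p \<in> hom (pro_cat C) Z (const_pro C G). epi (pro_cat C) p} \<longleftrightarrow>
    finite {a. epi_germ C Z G a}"
proof -
  interpret pro_object C Z by fact
  have "{p \<in> hom (pro_cat C) Z (const_pro C G). epi (pro_cat C) p} =
      to_const C Z G ` {a. epi_germ C Z G a}"
    using hom_const_pro_iff[OF assms(2)] epi_to_const_iff epi_germD(2) by auto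
  moreover have "inj (to_const C Z G)"
    unfolding to_const_def by (auto intro!: injI dest: fun_cong[of _ _ undefined])
  ultimately show ?thesis by (simp add: finite_image_iff inj_on_subset)
qed

text \<open>
  From here on a small pro-object is replaced by an isomorphic one with epic transition maps,
  since both the level quotients and the claims are invariant under isomorphism.
\<close>

lemma small_pro_object_iff:
  fixes C :: "('o, 'm) cat" and Y :: "('i, 'j, 'o, 'm) pro_obj"
  assumes "category C"
  shows "small_pro_object C Y \<longleftrightarrow> (\<exists>Z. isomorphic (pro_cat C) Y Z \<and> small_epic_pro_object C Z)"
proof -
  interpret P: category "pro_cat C" by (rule category_pro_cat)
  have "(\<forall>u \<in> Arr (idx Z). epi C (on_arr Z u)) \<and>
      (\<forall>G \<in> Obj C. finite {p \<in> hom (pro_cat C) Z (const_pro C G). epi (pro_cat C) p}) \<longleftrightarrow>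
      small_epic_pro_object C Z" if iso: "isomorphic (pro_cat C) Y Z" for Z :: "('i, 'j, 'o, 'm) pro_obj"
  proof -
    have Z: "pro_object C Z" using P.isomorphic_Obj(2)[OF iso] by (simp add: pro_cat_def)
    show ?thesis
      unfolding small_epic_pro_object_def small_epic_pro_object_axioms_def
        epic_pro_object_def epic_pro_object_axioms_def
      using finite_epi_germs_iff[OF Z] Z by (simp add: Ball_def)
  qed
  thus ?thesis unfolding small_pro_object_def by (intro iff_exI conj_cong refl)
qed

section \<open>The maximal quotient in a level\<close>

context diamond_category
begin

text \<open>
  The interval between \<open>g t\<close> and \<open>t\<close> in the lattice of \<open>J\<close> is the interval above \<open>g\<close> in the
  lattice of the target of \<open>t\<close>.
\<close>

lemma simple_epi_of_covers:
  assumes t: "t \<in> quotients C J" and g: "g \<in> hom C (Cod C t) S"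
    and cov: "covers (quot_poset C J) (quot_class C (Comp C g t)) (quot_class C t)"
    and e: "epi C g"
  shows "simple_epi C g"
proof -
  let ?T = "Cod C t"
  have t': "t \<in> hom C J ?T" and o: "J \<in> Obj C" "?T \<in> Obj C" using t by (auto elim: quotientsE)
  have gq: "g \<in> quotients C ?T" using quotientsI[OF g e] .
  note id = Ident_quotients[OF o(2)]
  have dom: "Dom C g = ?T" using g by (simp add: hom_def)
  interpret lower_embedding "quot_poset C ?T" "quot_poset C J" "pull t"
    by (rule lower_embedding_pull[OF t lattice_quotients[OF o(2)] lattice_quotients[OF o(1)]])
  have "covers (quot_poset C J) (pull t (quot_class C g)) (pull t (quot_class C (Ident C ?T)))"
    using cov pull_quot_class[OF t gq] pull_quot_class[OF t id] Comp_Ident_left[OF t'] by simp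
  hence c: "covers (quot_poset C ?T) (quot_class C g) (quot_class C (Ident C ?T))"
    using covers_iff[OF quot_class_carrier[OF gq] quot_class_carrier[OF id]] by simp
  have "\<not> iso C g"
  proof
    assume i: "iso C g"
    have "quot_iso C (Ident C ?T) g"
      unfolding quot_iso_def hom_Cod[OF Ident_hom[OF o(2)]] hom_Cod[OF g]
      using g i Comp_Ident_right[OF g] by metis
    hence "quot_class C g = quot_class C (Ident C ?T)"
      using quot_iso_iff[OF id gq] quot_class_eq_iff[OF gq id] by blast
    thus False using c unfolding covers_def by simp
  qed
  moreover have "quot_interval C g = {quot_class C g, quot_class C (Ident C ?T)}"
  proof
    show "quot_interval C g \<subseteq> {quot_class C g, quot_class C (Ident C ?T)}"
    proof
      fix z assume "z \<in> quot_interval C g"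
      hence z: "z \<in> carrier (quot_poset C ?T)" "quot_class C g \<sqsubseteq>\<^bsub>quot_poset C ?T\<^esub> z"
        unfolding quot_interval_def dom by auto
      thus "z \<in> {quot_class C g, quot_class C (Ident C ?T)}"
        using c top_quot_poset[OF o(2) z(1)] unfolding covers_def by blast
    qed
    show "{quot_class C g, quot_class C (Ident C ?T)} \<subseteq> quot_interval C g"
      using c L.le_refl unfolding quot_interval_def dom covers_def by blast
  qed
  ultimately show ?thesis using e dom unfolding simple_epi_def by simp
qed

text \<open>
  The third axiom of a diamond category, with representatives in place of classes.
\<close>

lemma finite_simple_epi_sources:
  assumes L: "L \<in> levels C" and S: "S \<in> L"
  shows "\<exists>R. finite R \<and> R \<subseteq> L \<and>
    (\<forall>T \<in> L. \<forall>g \<in> hom C T S. simple_epi C g \<longrightarrow> (\<exists>H \<in> R. isomorphic C T H))"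
proof -
  define K where "K = {iso_class C H |H. H \<in> L \<and> (\<exists>p \<in> hom C H S. simple_epi C p)}"
  define R where "R = (\<lambda>A. SOME H. H \<in> A) ` K"
  have rep: "(SOME H'. H' \<in> iso_class C H) \<in> iso_class C H" if H: "H \<in> L" for H
  proof -
    have "H \<in> iso_class C H" using level_Obj[OF L H] isomorphic_refl unfolding iso_class_def by blast
    thus ?thesis by (rule someI)
  qed
  have "finite K" using finite_simple_epis[OF L S] unfolding K_def .
  hence "finite R" unfolding R_def by (rule finite_imageI)
  moreover have "R \<subseteq> L"
    using rep level_isomorphic[OF L] unfolding R_def K_def iso_class_def by auto
  moreover have "\<exists>H \<in> R. isomorphic C T H"
    if T: "T \<in> L" "g \<in> hom C T S" "simple_epi C g" for T g
  proof -
    have "iso_class C T \<in> K" using T unfolding K_def by blast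
    hence "(SOME H. H \<in> iso_class C T) \<in> R" unfolding R_def by (rule imageI)
    thus ?thesis using rep[OF T(1)] unfolding iso_class_def by blast
  qed
  ultimately show ?thesis by blast
qed

text \<open>
  The target of the bottom quotient is a minimal object.
\<close>

lemma ex_minimal_quotient:
  assumes G: "G \<in> Obj C"
  obtains m where "m \<in> quotients C G" "minimal_object C (Cod C m)"
proof -
  interpret G: finite_modular_lattice "quot_poset C G" using finite_modular_quotients[OF G] .
  obtain a where a: "a \<in> carrier (quot_poset C G)"
    "\<And>z. z \<in> carrier (quot_poset C G) \<Longrightarrow> z \<sqsubseteq>\<^bsub>quot_poset C G\<^esub> a \<Longrightarrow> z = a"
    using G.ex_minimal_maximal(1)[of "carrier (quot_poset C G)"]
      quot_class_carrier[OF Ident_quotients[OF G]] by blast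
  obtain m where m: "m \<in> quotients C G" "a = quot_class C m"
    using a(1) by (auto simp: carrier_quot_poset)
  let ?M = "Cod C m"
  have M: "?M \<in> Obj C" and m': "m \<in> hom C G ?M" using m(1) by (auto elim: quotientsE)
  note id = Ident_quotients[OF M]
  have "quot_class C x = quot_class C (Ident C ?M)" if x: "x \<in> quotients C ?M" for x
  proof -
    have xm: "Comp C x m \<in> quotients C G" using Comp_quotients[OF m(1) x] .
    have x': "x \<in> hom C ?M (Cod C x)" using x by (rule quotientsE)
    have "quot_class C (Comp C x m) = a"
      using a(2)[OF quot_class_carrier[OF xm]] le_quot_poset_iff[OF m(1) xm] quot_leI[OF m' x'] m(2)
      by simp
    hence "quot_le C m (Comp C x m)" using m(2) quot_class_eq_iff[OF xm m(1)] by simp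
    hence "quot_le C (Ident C ?M) x"
      using Comp_quot_le_iff[OF m(1) id x] Comp_Ident_left[OF m'] by simp
    moreover have "quot_le C x (Ident C ?M)"
      using quot_leI[OF Ident_hom[OF M] x'] Comp_Ident_right[OF x'] by simp
    ultimately show ?thesis using quot_class_eq_iff[OF x id] by simp
  qed
  hence "carrier (quot_poset C ?M) = {quot_class C (Ident C ?M)}"
    using quot_class_carrier[OF id] unfolding carrier_quot_poset by blast
  thus ?thesis using that m(1) M unfolding minimal_object_def by blast
qed

lemma ex_join_quotient:
  assumes L: "L \<in> levels C" and G: "G \<in> Obj C"
    and p: "p \<in> quotients C G" "Cod C p \<in> L" and q: "q \<in> quotients C G" "Cod C q \<in> L"
  obtains j where "j \<in> quotients C G" "Cod C j \<in> L" "quot_le C p j" "quot_le C q j"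
proof -
  interpret G: finite_modular_lattice "quot_poset C G" using finite_modular_quotients[OF G] .
  note c = quot_class_carrier[OF p(1)] quot_class_carrier[OF q(1)]
  let ?a = "quot_class C p \<squnion>\<^bsub>quot_poset C G\<^esub> quot_class C q"
  obtain j where j: "j \<in> quotients C G" "?a = quot_class C j"
    using G.join_closed[OF c] unfolding carrier_quot_poset by blast
  have "least (quot_poset C G) (quot_class C j)
      (Upper (quot_poset C G) {quot_class C p, quot_class C q})"
    using G.sup_of_two_least[OF c] j(2) unfolding join_def by simp
  hence "Cod C j \<in> L" using level_closed(3)[OF L] G p q j(1) unfolding join_closed_def by blast
  moreover have "quot_le C p j" "quot_le C q j"
    using G.join_left[OF c] G.join_right[OF c] j(2) le_quot_poset_iff[OF j(1)] p(1) q(1) by auto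
  ultimately show ?thesis using that j(1) by blast
qed

end

locale diamond_small_pro_object = diamond_category C + small_epic_pro_object C Y
  for C :: "('o, 'm) cat" and Y :: "('i, 'j, 'o, 'm) pro_obj"
begin

abbreviation post :: "'m \<Rightarrow> ('i \<times> 'm) set \<Rightarrow> ('i \<times> 'm) set" where
  "post \<equiv> germ_post C Y"

abbreviation proj :: "'o \<Rightarrow> ('i \<times> 'm) set \<Rightarrow> bool" where
  "proj \<equiv> epi_germ C Y"

lemma proj_Obj: "proj G a \<Longrightarrow> G \<in> Obj C"
  using germs_Obj epi_germD(2) by blast

lemma post_post: "proj G a \<Longrightarrow> f \<in> hom C G H \<Longrightarrow> g \<in> hom C H K \<Longrightarrow>
    post g (post f a) = post (Comp C g f) a"
  using germ_post_comp epi_germD(2) by blast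

text \<open>
  Two quotients of \<open>Y\<close> factor through one \<open>on_obj Y k\<close>, because the index category is
  cofiltered. Their join as quotients of this object is again in the level.
\<close>

lemma proj_directed:
  assumes L: "L \<in> levels C" and a: "proj G a" "G \<in> L" and b: "proj H b" "H \<in> L"
  obtains J c f g where "proj J c" "J \<in> L" "f \<in> quotients C J" "f \<in> hom C J G" "a = post f c"
    "g \<in> quotients C J" "g \<in> hom C J H" "b = post g c"
proof -
  obtain i1 f1 where f1: "i1 \<in> Obj I" "f1 \<in> hom C (on_obj Y i1) G" "a = germ C Y i1 f1"
    using germsE[OF epi_germD(2)[OF a(1)]] .
  obtain i2 f2 where f2: "i2 \<in> Obj I" "f2 \<in> hom C (on_obj Y i2) H" "b = germ C Y i2 f2"
    using germsE[OF epi_germD(2)[OF b(1)]] .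
  obtain k u v where k: "k \<in> Obj I" "u \<in> hom I k i1" "v \<in> hom I k i2"
    using I.common_source[OF f1(1) f2(1)] by blast
  let ?p = "Comp C f1 (on_arr Y u)" and ?q = "Comp C f2 (on_arr Y v)"
  have p: "?p \<in> hom C (on_obj Y k) G" "a = germ C Y k ?p"
    using Comp_hom[OF on_arr[OF k(2)] f1(2)] germ_precomp[OF f1(2,1) k(2)] f1(3) by auto
  have q: "?q \<in> hom C (on_obj Y k) H" "b = germ C Y k ?q"
    using Comp_hom[OF on_arr[OF k(3)] f2(2)] germ_precomp[OF f2(2,1) k(3)] f2(3) by auto
  have pq: "?p \<in> quotients C (on_obj Y k)" "?q \<in> quotients C (on_obj Y k)"
    using quotientsI epi_germ_iff[OF k(1)] p q a b by auto
  obtain j where j: "j \<in> quotients C (on_obj Y k)" "Cod C j \<in> L" "quot_le C ?p j" "quot_le C ?q j"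
    using ex_join_quotient[OF L on_obj[OF k(1)] pq(1) _ pq(2)] hom_Cod[OF p(1)] hom_Cod[OF q(1)] a b
    by metis
  have j': "j \<in> hom C (on_obj Y k) (Cod C j)" "epi C j" using j(1) by (auto elim: quotientsE)
  obtain f where f: "f \<in> hom C (Cod C j) G" "?p = Comp C f j" using quot_leE[OF j(3) j'(1) p(1)] .
  obtain g where g: "g \<in> hom C (Cod C j) H" "?q = Comp C g j" using quot_leE[OF j(4) j'(1) q(1)] .
  let ?c = "germ C Y k j"
  have c: "proj (Cod C j) ?c" using epi_germ_iff[OF k(1) j'(1)] j'(2) by simp
  have af: "a = post f ?c" using germ_post_germ[OF j'(1) k(1) f(1)] f(2) p(2) by simp
  have bg: "b = post g ?c" using germ_post_germ[OF j'(1) k(1) g(1)] g(2) q(2) by simp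
  have "epi C f" "epi C g"
    using epi_of_epi_germ_post[OF epi_germD(2)[OF c]] f(1) g(1) a(1) b(1) af bg by auto
  thus ?thesis using that[OF c j(2) _ f(1) af _ g(1) bg] quotientsI f(1) g(1) by blast
qed

lemma proj_finite_upper_bound:
  assumes L: "L \<in> levels C" and a: "proj G a" "G \<in> L"
    and T: "finite T" "\<And>H b. (H, b) \<in> T \<Longrightarrow> H \<in> L \<and> proj H b"
  obtains J c f where "proj J c" "J \<in> L" "f \<in> hom C J G" "a = post f c"
    "\<And>H b. (H, b) \<in> T \<Longrightarrow> \<exists>g \<in> hom C J H. b = post g c"
proof -
  have "\<exists>J c. proj J c \<and> J \<in> L \<and> (\<exists>f \<in> hom C J G. a = post f c) \<and>
    (\<forall>(H, b) \<in> T. \<exists>g \<in> hom C J H. b = post g c)" using T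
  proof (induction T rule: finite_induct)
    case empty
    have "a = post (Ident C G) a" using germ_post_Ident[OF epi_germD(2)[OF a(1)]] by simp
    thus ?case using a Ident_hom[OF proj_Obj[OF a(1)]] by blast
  next
    case (insert x T)
    obtain J c where J: "proj J c" "J \<in> L" "\<exists>f \<in> hom C J G. a = post f c"
      "\<forall>(H, b) \<in> T. \<exists>g \<in> hom C J H. b = post g c"
      using insert.IH[OF insert.prems[OF insertI2]] by blast
    obtain H0 b0 where x: "x = (H0, b0)" by (cases x)
    have x': "H0 \<in> L" "proj H0 b0" using insert.prems x by auto
    obtain K d p q where d: "proj K d" "K \<in> L" "p \<in> hom C K J" "c = post p d"
      "q \<in> hom C K H0" "b0 = post q d"
      using proj_directed[OF L J(1,2) x'(2,1)] by metis
    have step: "\<exists>g \<in> hom C K H. b = post g d" if ex: "\<exists>g \<in> hom C J H. b = post g c" for H b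
    proof -
      obtain g where g: "g \<in> hom C J H" "b = post g c" using ex by blast
      have "b = post (Comp C g p) d" using post_post[OF d(1,3) g(1)] d(4) g(2) by simp
      thus ?thesis using Comp_hom[OF d(3) g(1)] by blast
    qed
    have "\<forall>(H, b) \<in> insert x T. \<exists>g \<in> hom C K H. b = post g d"
      using J(4) step x d(5,6) by blast
    thus ?case using d(1,2) step[OF J(3)] by blast
  qed
  thus ?thesis using that by fastforce
qed

text \<open>
  Induction on \<open>k\<close> will produce a quotient of \<open>Y\<close> in \<open>L\<close> that lies above all quotients in
  \<open>L\<close> of socle length at most \<open>k\<close>. As socle length is bounded on \<open>L\<close>, it is the maximal
  quotient once \<open>k\<close> is large.
\<close>

definition dominates :: "'o set \<Rightarrow> nat \<Rightarrow> 'o \<Rightarrow> ('i \<times> 'm) set \<Rightarrow> bool" where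
  "dominates L k S s \<longleftrightarrow> S \<in> L \<and> proj S s \<and>
    (\<forall>F \<in> L. \<forall>f. proj F f \<longrightarrow> obj_socle_length_le k F \<longrightarrow> (\<exists>h \<in> hom C S F. f = post h s))"

text \<open>
  A quotient of socle length \<open>0\<close> is the bottom of the lattice it lies in; so any quotient of \<open>Y\<close> in
  \<open>L\<close> will do, and the minimal quotient of some \<open>on_obj Y i\<close> provides one.
\<close>

lemma ex_dominates_0:
  assumes L: "L \<in> levels C"
  shows "\<exists>S s. dominates L 0 S s"
proof -
  obtain i where i: "i \<in> Obj I" using I.nonempty by blast
  obtain m where m: "m \<in> quotients C (on_obj Y i)" "minimal_object C (Cod C m)"
    using ex_minimal_quotient[OF on_obj[OF i]] .
  have m': "m \<in> hom C (on_obj Y i) (Cod C m)" "epi C m" using m(1) by (auto elim: quotientsE)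
  let ?s = "germ C Y i m"
  have s: "proj (Cod C m) ?s" using epi_germ_iff[OF i m'(1)] m'(2) by simp
  have M: "Cod C m \<in> L" using m(2) level_closed(4)[OF L] by blast
  have "\<exists>h \<in> hom C (Cod C m) F. f = post h ?s"
    if F: "F \<in> L" "proj F f" "obj_socle_length_le 0 F" for F f
  proof -
    obtain J c p q where J: "proj J c" and p: "p \<in> quotients C J" "p \<in> hom C J F" "f = post p c"
      and q: "q \<in> quotients C J" "q \<in> hom C J (Cod C m)" "?s = post q c"
      using proj_directed[OF L F(2,1) s M] by metis
    have "socle_length_le (quot_poset C J) 0 (quot_class C p)"
      using obj_socle_length_le_quotient[OF p(1)] F(3) hom_Cod[OF p(2)] by simp
    hence "quot_le C p q" using quot_class_carrier[OF q(1)] le_quot_poset_iff[OF q(1) p(1)] by simp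
    then obtain h where h: "h \<in> hom C (Cod C m) F" "p = Comp C h q"
      using quot_leE[OF _ q(2) p(2)] by blast
    have "f = post h ?s" using p(3) h(2) q(3) post_post[OF J q(2) h(1)] by simp
    thus ?thesis using h(1) by blast
  qed
  thus ?thesis using M s unfolding dominates_def by blast
qed

text \<open>
  Let \<open>S'\<close> be an upper bound in \<open>L\<close> of \<open>S\<close> and of all quotients \<open>T\<close> of \<open>Y\<close> in \<open>L\<close> that
  have a simple epimorphism to \<open>S\<close>: up to isomorphism there are finitely many \<open>T\<close>, and each has
  finitely many epimorphisms from \<open>Y\<close>. A quotient \<open>F\<close> of length at most \<open>k + 1\<close> is the join
  of covers \<open>x\<close> of some \<open>b\<close> of length at most \<open>k\<close>. As \<open>b\<close> is below \<open>S\<close>, each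
  \<open>x \<squnion> S\<close> is \<open>S\<close> or one of the \<open>T\<close>, hence below \<open>S'\<close>; so \<open>F\<close> is below \<open>S'\<close>.
  The comparison takes place in the lattice of a common upper bound \<open>J\<close> of \<open>F\<close> and \<open>S'\<close>.
\<close>

lemma ex_dominates_Suc:
  assumes L: "L \<in> levels C" and S: "dominates L k S s"
  shows "\<exists>S' s'. dominates L (Suc k) S' s'"
proof -
  have s: "S \<in> L" "proj S s" using S unfolding dominates_def by auto
  obtain R where R: "finite R" "R \<subseteq> L"
    "\<forall>T \<in> L. \<forall>g \<in> hom C T S. simple_epi C g \<longrightarrow> (\<exists>H \<in> R. isomorphic C T H)"
    using finite_simple_epi_sources[OF L s(1)] by blast
  let ?T = "Sigma R (\<lambda>H. {t. proj H t})"
  have "finite ?T"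
    using R(1,2) finite_epi_germs level_Obj[OF L] by (intro finite_SigmaI) blast+
  then obtain S' s' e where s': "proj S' s'" "S' \<in> L" and e: "e \<in> hom C S' S" "s = post e s'"
    and ub: "\<And>H b. (H, b) \<in> ?T \<Longrightarrow> \<exists>g \<in> hom C S' H. b = post g s'"
    using proj_finite_upper_bound[OF L s(2,1), of ?T] R(2) by blast
  have "\<exists>h \<in> hom C S' F. f = post h s'"
    if F: "F \<in> L" "proj F f" "obj_socle_length_le (Suc k) F" for F f
  proof -
    obtain J c p q' where J: "proj J c" "J \<in> L"
      and p: "p \<in> quotients C J" "p \<in> hom C J F" "f = post p c"
      and q': "q' \<in> quotients C J" "q' \<in> hom C J S'" "s' = post q' c"
      using proj_directed[OF L F(2,1) s'] by metis
    interpret J: finite_modular_lattice "quot_poset C J"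
      using finite_modular_quotients[OF proj_Obj[OF J(1)]] .
    let ?le = "\<lambda>a b. a \<sqsubseteq>\<^bsub>quot_poset C J\<^esub> b"
    let ?q = "Comp C e q'"
    have q: "?q \<in> hom C J S" "s = post ?q c"
      using Comp_hom[OF q'(2) e(1)] post_post[OF J(1) q'(2) e(1)] q'(3) e(2) by auto
    have qe: "?q \<in> quotients C J"
      using quotientsI[OF q(1) epi_of_epi_germ_post[OF epi_germD(2)[OF J(1)] q(1)]] q(2) s(2) by simp
    \<comment> \<open>Quotients of \<open>J\<close> that factor through \<open>s\<close> or \<open>s'\<close> as quotients of \<open>Y\<close> do so over \<open>J\<close>.\<close>
    have factor: "x = Comp C h y"
      if "x \<in> hom C J A" "y \<in> hom C J B" "h \<in> hom C B A" "post x c = post h (post y c)" for x y h A B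
      using epi_germD(1)[OF J(1) that(1) Comp_hom[OF that(2,3)]] post_post[OF J(1) that(2,3)] that(4)
      by simp
    note carr = quot_class_carrier[OF p(1)] quot_class_carrier[OF qe] quot_class_carrier[OF q'(1)]
    have qq': "?le (quot_class C ?q) (quot_class C q')"
      using le_quot_poset_iff[OF q'(1) qe] quot_leI[OF q'(2) e(1)] by simp
    have "socle_length_le (quot_poset C J) (Suc k) (quot_class C p)"
      using obj_socle_length_le_quotient[OF p(1)] F(3) hom_Cod[OF p(2)] by simp
    then obtain b where b: "socle_length_le (quot_poset C J) k b"
      "complemented_interval (quot_poset C J) b (quot_class C p)" by auto
    have bc: "b \<in> carrier (quot_poset C J)" using J.socle_length_le_carrier[OF b(1)] .
    then obtain r where r: "r \<in> quotients C J" "b = quot_class C r"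
      by (auto simp: carrier_quot_poset)
    have r': "r \<in> hom C J (Cod C r)" "epi C r" using r(1) by (auto elim: quotientsE)
    have "Cod C r \<in> L" using level_quotient_closed[OF L J(2) r'] .
    moreover have "obj_socle_length_le k (Cod C r)"
      using b(1) obj_socle_length_le_quotient[OF r(1)] r(2) by simp
    moreover have "proj (Cod C r) (post r c)" using epi_germ_post[OF J(1) r'] .
    ultimately obtain h where h: "h \<in> hom C S (Cod C r)" "post r c = post h s"
      using S unfolding dominates_def by blast
    have "r = Comp C h ?q" using factor[OF r'(1) q(1) h(1)] h(2) q(2) by simp
    hence bq: "?le b (quot_class C ?q)"
      using le_quot_poset_iff[OF qe r(1)] quot_leI[OF q(1) h(1)] r(2) by simp
    have "?le (quot_class C p) (quot_class C q')"
    proof (rule J.complemented_interval_le[OF b(2) carr(3) J.le_trans[OF bq qq' bc carr(2,3)]])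
      fix x assume x: "covers (quot_poset C J) b x"
      have xc: "x \<in> carrier (quot_poset C J)" using x unfolding covers_def by blast
      let ?y = "x \<squnion>\<^bsub>quot_poset C J\<^esub> quot_class C ?q"
      have yc: "?y \<in> carrier (quot_poset C J)" using J.join_closed[OF xc carr(2)] .
      have "?le ?y (quot_class C q')"
      proof (cases "?y = quot_class C ?q")
        case True
        thus ?thesis using qq' by simp
      next
        case False
        hence cov: "covers (quot_poset C J) (quot_class C ?q) ?y"
          using J.covers_join[OF x carr(2) bq] by blast
        obtain t where t: "t \<in> quotients C J" "?y = quot_class C t"
          using yc unfolding carrier_quot_poset by blast
        have t': "t \<in> hom C J (Cod C t)" "epi C t" using t(1) by (auto elim: quotientsE)
        have "quot_le C ?q t"
          using J.join_right[OF xc carr(2)] t(2) le_quot_poset_iff[OF t(1) qe] by simp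
        then obtain g where g: "g \<in> hom C (Cod C t) S" "?q = Comp C g t"
          using quot_leE[OF _ t'(1) q(1)] by blast
        have "epi C (Comp C g t)" using qe g(2) by (simp add: quotients_iff)
        hence "simple_epi C g"
          using simple_epi_of_covers[OF t(1) g(1)] cov t(2) g(2) epi_left_factor[OF t'(1) g(1)]
          by simp
        hence "\<exists>H \<in> R. isomorphic C (Cod C t) H"
          by (rule R(3)[rule_format, OF level_quotient_closed[OF L J(2) t'] g(1)])
        then obtain H where H: "H \<in> R" and "isomorphic C (Cod C t) H" by (rule bexE)
        then obtain \<rho> where \<rho>: "\<rho> \<in> hom C (Cod C t) H" "iso C \<rho>"
          unfolding isomorphic_def by blast
        obtain \<rho>' where \<rho>': "\<rho>' \<in> hom C H (Cod C t)" "Comp C \<rho>' \<rho> = Ident C (Cod C t)"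
          using isoE[OF \<rho>(2,1)] .
        note \<rho>t = Comp_hom[OF t'(1) \<rho>(1)]
        have "proj H (post (Comp C \<rho> t) c)"
          using epi_germ_post[OF J(1) \<rho>t epi_Comp[OF t' \<rho>(1) iso_epi[OF \<rho>]]] .
        then obtain n where n: "n \<in> hom C S' H" "post (Comp C \<rho> t) c = post n s'"
          using ub[OF SigmaI[OF H]] by blast
        have "Comp C \<rho> t = Comp C n q'" using factor[OF \<rho>t q'(2) n(1)] n(2) q'(3) by simp
        hence "t = Comp C (Comp C \<rho>' n) q'"
          using Comp_assoc[OF t'(1) \<rho>(1) \<rho>'(1)] \<rho>'(2) Comp_Ident_left[OF t'(1)]
            Comp_assoc[OF q'(2) n(1) \<rho>'(1)] by simp
        thus ?thesis
          using le_quot_poset_iff[OF q'(1) t(1)] quot_leI[OF q'(2) Comp_hom[OF n(1) \<rho>'(1)]] t(2)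
          by simp
      qed
      thus "?le x (quot_class C q')"
        using J.le_trans[OF J.join_left[OF xc carr(2)] _ xc yc carr(3)] by blast
    qed
    hence "quot_le C p q'" using le_quot_poset_iff[OF q'(1) p(1)] by simp
    then obtain h where h: "h \<in> hom C S' F" "p = Comp C h q'"
      using quot_leE[OF _ q'(2) p(2)] by blast
    have "f = post h s'" using p(3) h(2) q'(3) post_post[OF J(1) q'(2) h(1)] by simp
    thus ?thesis using h(1) by blast
  qed
  thus ?thesis using s' unfolding dominates_def by blast
qed

lemma ex_max_germ:
  assumes L: "L \<in> levels C"
  obtains G a where "max_germ C L Y G a"
proof -
  have ex: "\<exists>S s. dominates L k S s" for k
    by (induction k) (use ex_dominates_0[OF L] ex_dominates_Suc[OF L] in blast)+
  obtain k where k: "\<forall>G \<in> L. obj_socle_length_le k G" using level_bounded_socle_length[OF L] by blast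
  obtain S s where "dominates L k S s" using ex by blast
  hence "max_germ C L Y S s" using k unfolding dominates_def max_germ_def by blast
  thus ?thesis by (rule that)
qed

end

context diamond_small_pro_object
begin

text \<open>
  Two maximal quotients factor through each other, and the factors are mutually inverse.
\<close>

lemma max_germ_codomains:
  assumes L: "L \<in> levels C" and a: "max_germ C L Y G a"
  shows "{H \<in> L. \<exists>b. max_germ C L Y H b} = iso_class C G"
proof (intro equalityI subsetI)
  have G: "G \<in> L" "proj G a" using a unfolding max_germ_def by auto
  {
    fix H assume "H \<in> {H \<in> L. \<exists>b. max_germ C L Y H b}"
    then obtain b where b: "max_germ C L Y H b" by blast
    hence H: "H \<in> L" "proj H b" unfolding max_germ_def by auto
    obtain h where h: "h \<in> hom C G H" "b = post h a" using a H unfolding max_germ_def by blast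
    obtain k where k: "k \<in> hom C H G" "a = post k b" using b G unfolding max_germ_def by blast
    have "post (Comp C k h) a = a" "post (Comp C h k) b = b"
      using post_post[OF G(2) h(1) k(1)] post_post[OF H(2) k(1) h(1)] h(2)[symmetric] k(2)[symmetric] by simp_all
    hence "Comp C k h = Ident C G" "Comp C h k = Ident C H"
      using epi_germD(1)[OF G(2) Comp_hom[OF h(1) k(1)] Ident_hom[OF proj_Obj[OF G(2)]]]
        epi_germD(1)[OF H(2) Comp_hom[OF k(1) h(1)] Ident_hom[OF proj_Obj[OF H(2)]]]
        germ_post_Ident[OF epi_germD(2)[OF G(2)]] germ_post_Ident[OF epi_germD(2)[OF H(2)]] by simp_all
    hence "iso C h" using isoI[OF h(1) k(1)] by blast
    thus "H \<in> iso_class C G"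
      using h(1) hom_Obj(2)[OF h(1)] unfolding iso_class_def isomorphic_def by blast
  }
  fix H assume "H \<in> iso_class C G"
  then obtain r where r: "r \<in> hom C G H" "iso C r" unfolding iso_class_def isomorphic_def by blast
  obtain r' where r': "r' \<in> hom C H G" "Comp C r' r = Ident C G" using isoE[OF r(2,1)] .
  have H: "H \<in> L" using level_quotient_closed[OF L G(1) r(1) iso_epi[OF r]] .
  have "\<exists>h \<in> hom C H K. b = post h (post r a)" if K: "K \<in> L" "proj K b" for K b
  proof -
    obtain h where h: "h \<in> hom C G K" "b = post h a" using a K unfolding max_germ_def by blast
    have "Comp C (Comp C h r') r = h"
      using Comp_assoc[OF r(1) r'(1) h(1)] r'(2) Comp_Ident_right[OF h(1)] by simp
    hence "b = post (Comp C h r') (post r a)"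
      using post_post[OF G(2) r(1) Comp_hom[OF r'(1) h(1)]] h(2) by simp
    thus ?thesis using Comp_hom[OF r'(1) h(1)] by blast
  qed
  hence "max_germ C L Y H (post r a)"
    using H epi_germ_post[OF G(2) r(1) iso_epi[OF r]] unfolding max_germ_def by blast
  thus "H \<in> {H \<in> L. \<exists>b. max_germ C L Y H b}" using H by blast
qed

lemma pro_level_quotient_eq:
  "L \<in> levels C \<Longrightarrow> pro_level_quotient C L Y = {G \<in> L. \<exists>a. max_germ C L Y G a}"
  using pro_level_quotient_iff level_Obj by blast

text \<open>
  A quotient of \<open>Y\<close> in \<open>L\<close> is in \<open>L'\<close>, so it factors through \<open>a\<close> and is a quotient of
  \<open>G\<close>. Thus \<open>G\<close> and \<open>Y\<close> have the same quotients in \<open>L\<close>.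
\<close>

lemma level_quotient_of_max_germ:
  assumes L: "L \<in> levels C" and L': "L' \<in> levels C" and sub: "L \<subseteq> L'"
    and a: "max_germ C L' Y G a"
  shows "level_quotient C L G = {H \<in> L. \<exists>b. max_germ C L Y H b}"
proof (intro equalityI subsetI)
  have G: "proj G a" using a unfolding max_germ_def by auto
  {
    fix H assume "H \<in> level_quotient C L G"
    then obtain p where p: "max_quotient C L G p" "H = Cod C p" unfolding level_quotient_def by blast
    hence p': "p \<in> hom C G H" "epi C p" and H: "H \<in> L"
      unfolding max_quotient_def by (auto elim: quotientsE)
    note pa = epi_germ_post[OF G p']
    have "\<exists>h \<in> hom C H K. b = post h (post p a)" if K: "K \<in> L" "proj K b" for K b
    proof -
      obtain q where q: "q \<in> hom C G K" "b = post q a"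
        using a K sub unfolding max_germ_def by blast
      have "epi C q" using epi_of_epi_germ_post[OF epi_germD(2)[OF G] q(1)] q(2) K(2) by simp
      hence "quot_le C q p"
        using p(1) K(1) quotientsI[OF q(1)] hom_Cod[OF q(1)] unfolding max_quotient_def by blast
      then obtain h where h: "h \<in> hom C H K" "q = Comp C h p" using quot_leE[OF _ p'(1) q(1)] by blast
      thus ?thesis using post_post[OF G p'(1) h(1)] q(2) by auto
    qed
    hence "max_germ C L Y H (post p a)" using H pa unfolding max_germ_def by blast
    thus "H \<in> {H \<in> L. \<exists>b. max_germ C L Y H b}" using H by blast
  }
  fix H assume "H \<in> {H \<in> L. \<exists>b. max_germ C L Y H b}"
  then obtain b where b: "max_germ C L Y H b" by blast
  hence H: "H \<in> L" "proj H b" unfolding max_germ_def by auto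
  obtain p where p: "p \<in> hom C G H" "b = post p a" using a H sub unfolding max_germ_def by blast
  have e: "epi C p" using epi_of_epi_germ_post[OF epi_germD(2)[OF G] p(1)] p(2) H(2) by simp
  have "quot_le C q p" if q: "q \<in> quotients C G" "Cod C q \<in> L" for q
  proof -
    have q': "q \<in> hom C G (Cod C q)" "epi C q" using q by (auto elim: quotientsE)
    obtain h where h: "h \<in> hom C H (Cod C q)" "post q a = post h b"
      using b q(2) epi_germ_post[OF G q'] unfolding max_germ_def by blast
    have "q = Comp C h p"
      using epi_germD(1)[OF G q'(1) Comp_hom[OF p(1) h(1)]] post_post[OF G p(1) h(1)] h(2) p(2) by simp
    thus ?thesis using quot_leI[OF p(1) h(1)] by simp
  qed
  hence "max_quotient C L G p"
    using quotientsI[OF p(1) e] hom_Cod[OF p(1)] H(1) unfolding max_quotient_def by blast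
  thus "H \<in> level_quotient C L G" using hom_Cod[OF p(1)] unfolding level_quotient_def by blast
qed

lemma pro_level_quotients_in_pro_iso_classes: "pro_level_quotients C Y \<in> pro_iso_classes C"
proof -
  have "pro_level_quotients C Y \<in> (\<Pi>\<^sub>E L \<in> levels C. iso_class C ` L)"
  proof
    fix L assume L: "L \<in> levels C"
    obtain G a where a: "max_germ C L Y G a" using ex_max_germ[OF L] .
    have "G \<in> L" using a unfolding max_germ_def by blast
    thus "pro_level_quotients C Y L \<in> iso_class C ` L"
      using max_germ_codomains[OF L a] pro_level_quotient_eq[OF L] L
      unfolding pro_level_quotients_def by simp
  next
    fix L assume "L \<notin> levels C"
    thus "pro_level_quotients C Y L = undefined" unfolding pro_level_quotients_def by simp
  qed
  moreover have "level_quotient C L G = pro_level_quotients C Y L"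
    if L: "L \<in> levels C" "L' \<in> levels C" "L \<subseteq> L'" "G \<in> pro_level_quotients C Y L'" for L L' G
  proof -
    obtain a where "max_germ C L' Y G a"
      using L(2,4) pro_level_quotient_eq[OF L(2)] unfolding pro_level_quotients_def by auto
    thus ?thesis
      using level_quotient_of_max_germ[OF L(1-3)] pro_level_quotient_eq[OF L(1)] L(1)
      unfolding pro_level_quotients_def by simp
  qed
  ultimately show ?thesis unfolding pro_iso_classes_def by blast
qed

end

section \<open>Compatible systems of maximal quotients\<close>

context diamond_category
begin

text \<open>
  There are finitely many classes of quotients of \<open>A\<close>, and two epimorphisms to \<open>B\<close> in one
  class differ by an automorphism of \<open>B\<close>.
\<close>

lemma finite_epis:
  assumes A: "A \<in> Obj C" and B: "B \<in> Obj C"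
  shows "finite {p \<in> hom C A B. epi C p}"
proof -
  let ?E = "{p \<in> hom C A B. epi C p}"
  have "finite {p \<in> ?E. quot_class C p = K}" for K
  proof (cases "\<exists>p \<in> ?E. quot_class C p = K")
    case True
    then obtain p where p: "p \<in> hom C A B" "epi C p" "quot_class C p = K" by blast
    have "{q \<in> ?E. quot_class C q = K} \<subseteq> (\<lambda>h. Comp C h p) ` {f \<in> hom C B B. iso C f}"
    proof
      fix q assume "q \<in> {q \<in> ?E. quot_class C q = K}"
      hence q: "q \<in> hom C A B" "epi C q" "quot_class C q = quot_class C p" using p by auto
      note pq = quotientsI[OF p(1,2)] quotientsI[OF q(1,2)]
      have "quot_iso C p q"
        using quot_class_eq_iff[OF pq(2,1)] q(3) quot_iso_iff[OF pq] by blast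
      thus "q \<in> (\<lambda>h. Comp C h p) ` {f \<in> hom C B B. iso C f}"
        unfolding quot_iso_def hom_Cod[OF p(1)] hom_Cod[OF q(1)] by blast
    qed
    thus ?thesis using finite_automorphisms[OF B] finite_surj by blast
  next
    case False
    hence "{p \<in> ?E. quot_class C p = K} = {}" by blast
    thus ?thesis by (metis finite.emptyI)
  qed
  hence "finite (\<Union>K \<in> carrier (quot_poset C A). {p \<in> ?E. quot_class C p = K})"
    by (intro finite_UN_I[OF finite_quotients[OF A]])
  moreover have "?E \<subseteq> (\<Union>K \<in> carrier (quot_poset C A). {p \<in> ?E. quot_class C p = K})"
  proof
    fix p assume p: "p \<in> ?E"
    hence "quot_class C p \<in> carrier (quot_poset C A)" using quot_class_carrier quotientsI by blast
    thus "p \<in> (\<Union>K \<in> carrier (quot_poset C A). {p \<in> ?E. quot_class C p = K})" using p by simp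
  qed
  ultimately show ?thesis by (rule finite_subset[rotated])
qed

text \<open>
  Maps between maximal quotients of a common object \<open>A\<close> are canonical. This gives compatible
  choices below any given level.
\<close>

lemma max_quotient_factor:
  assumes r: "r \<in> hom C A B" "max_quotient C L' A r" and q: "q \<in> hom C A D" "max_quotient C L A q"
    and sub: "L \<subseteq> L'"
  obtains p where "p \<in> hom C B D" "max_quotient C L B p" "Comp C p r = q"
proof -
  have r': "epi C r" and q': "q \<in> quotients C A" "D \<in> L" "epi C q"
    using r q hom_Cod[OF q(1)] unfolding max_quotient_def by (auto elim: quotientsE)
  have "quot_le C q r" using r(2) q' sub hom_Cod[OF q(1)] unfolding max_quotient_def by blast
  then obtain p where p: "p \<in> hom C B D" "q = Comp C p r" using quot_leE[OF _ r(1) q(1)] by blast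
  have "quot_le C t p" if t: "t \<in> quotients C B" "Cod C t \<in> L" for t
  proof -
    have t': "t \<in> hom C B (Cod C t)" "epi C t" using t by (auto elim: quotientsE)
    note tr = Comp_hom[OF r(1) t'(1)]
    have "quot_le C (Comp C t r) q"
      using q(2) quotientsI[OF tr epi_Comp[OF r(1) r' t']] t(2) hom_Cod[OF tr]
      unfolding max_quotient_def by simp
    then obtain h where h: "h \<in> hom C D (Cod C t)" "Comp C t r = Comp C h q"
      using quot_leE[OF _ q(1) tr] by blast
    have "t = Comp C h p"
      using epi_cancel[OF r' r(1) t'(1) Comp_hom[OF p(1) h(1)]] h(2) p(2)
        Comp_assoc[OF r(1) p(1) h(1)] by simp
    thus ?thesis using quot_leI[OF p(1) h(1)] by simp
  qed
  moreover have "epi C p" using epi_left_factor[OF r(1) p(1)] p(2) q'(3) by simp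
  ultimately have "max_quotient C L B p"
    using quotientsI[OF p(1)] hom_Cod[OF p(1)] q'(2) unfolding max_quotient_def by simp
  thus ?thesis using that[OF p(1)] p(2) by simp
qed

end

text \<open>
  Representatives of a pro-isomorphism class with functorial maps between them. The functoriality
  is what the definition of a pro-isomorphism class leaves open.
\<close>

locale level_system = diamond_category C for C :: "('o, 'm) cat" +
  fixes obj :: "'o set \<Rightarrow> 'o" and tr :: "'o set \<Rightarrow> 'o set \<Rightarrow> 'm"
  assumes obj_level: "L \<in> levels C \<Longrightarrow> obj L \<in> L"
    and tr_hom: "L \<in> levels C \<Longrightarrow> L' \<in> levels C \<Longrightarrow> L \<subseteq> L' \<Longrightarrow> tr L' L \<in> hom C (obj L') (obj L)"
    and tr_max: "L \<in> levels C \<Longrightarrow> L' \<in> levels C \<Longrightarrow> L \<subseteq> L' \<Longrightarrow>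
      max_quotient C L (obj L') (tr L' L)"
    and tr_comp: "L \<in> levels C \<Longrightarrow> L' \<in> levels C \<Longrightarrow> L'' \<in> levels C \<Longrightarrow> L \<subseteq> L' \<Longrightarrow> L' \<subseteq> L'' \<Longrightarrow>
      Comp C (tr L' L) (tr L'' L') = tr L'' L"

text \<open>
  For each pair \<open>L \<subseteq> L'\<close> there are finitely many, and at least one, maximal quotient maps between
  the representatives. Functoriality is a family of constraints on three of them each. Finitely
  many constraints involve only levels inside one level \<open>M\<close>, where maximal quotient maps out of
  \<open>obj M\<close> induce a functorial choice; compactness does the rest.
\<close>

lemma (in diamond_category) ex_level_system:
  assumes X: "X \<in> pro_iso_classes C"
  obtains obj tr where "level_system C obj tr" "\<And>L. L \<in> levels C \<Longrightarrow> X L = iso_class C (obj L)"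
proof -
  have "X \<in> (\<Pi>\<^sub>E L \<in> levels C. iso_class C ` L)" using X unfolding pro_iso_classes_def by simp
  hence "X L \<in> iso_class C ` L" if "L \<in> levels C" for L using that by (rule PiE_mem)
  hence "\<exists>G. G \<in> L \<and> X L = iso_class C G" if "L \<in> levels C" for L using that by blast
  then obtain obj where obj: "\<And>L. L \<in> levels C \<Longrightarrow> obj L \<in> L \<and> X L = iso_class C (obj L)"
    by metis
  have obj_X: "obj L \<in> X L" if "L \<in> levels C" for L
    using obj[OF that] level_Obj[OF that] isomorphic_refl unfolding iso_class_def by blast
  let ?M = "\<lambda>L' L. {p \<in> hom C (obj L') (obj L). max_quotient C L (obj L') p}"
  have ne: "\<exists>p. p \<in> ?M L' L" if L: "L \<in> levels C" "L' \<in> levels C" "L \<subseteq> L'" for L L'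
  proof -
    have "level_quotient C L (obj L') = X L"
      using X L obj_X[OF L(2)] unfolding pro_iso_classes_def by blast
    hence "obj L \<in> level_quotient C L (obj L')" using obj_X[OF L(1)] by simp
    then obtain p where p: "max_quotient C L (obj L') p" "obj L = Cod C p"
      unfolding level_quotient_def by blast
    hence "p \<in> hom C (obj L') (obj L)" unfolding max_quotient_def by (auto elim: quotientsE)
    thus ?thesis using p by blast
  qed
  let ?V = "{(L', L). L \<in> levels C \<and> L' \<in> levels C \<and> L \<subseteq> L'}"
  let ?K = "{(L'', L', L). L \<in> levels C \<and> L' \<in> levels C \<and> L'' \<in> levels C \<and> L \<subseteq> L' \<and> L' \<subseteq> L''}"
  let ?D = "\<lambda>(L', L). ?M L' L"
  let ?P = "\<lambda>(L'', L', L) f. Comp C (f (L', L)) (f (L'', L')) = f (L'', L)"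
  have "\<exists>f \<in> Pi\<^sub>E ?V ?D. \<forall>c \<in> ?K. ?P c f"
  proof (rule finite_constraint_compactness[where
        s = "\<lambda>(L'', L', L). {(L', L), (L'', L'), (L'', L)}"])
    fix v assume "v \<in> ?V"
    then obtain L' L where v: "v = (L', L)" "L \<in> levels C" "L' \<in> levels C" by blast
    have "obj L' \<in> Obj C" "obj L \<in> Obj C" using obj level_Obj v by blast+
    hence "finite {p \<in> hom C (obj L') (obj L). epi C p}" by (rule finite_epis)
    moreover have "?M L' L \<subseteq> {p \<in> hom C (obj L') (obj L). epi C p}"
      unfolding max_quotient_def by (auto elim: quotientsE)
    ultimately have "finite (?M L' L)" using finite_subset by blast
    thus "finite (?D v)" unfolding v by simp
  next
    fix F assume F: "finite F" "F \<subseteq> ?K"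
    have fin: "finite ((\<lambda>(L'', L', L). L'') ` F)" "(\<lambda>(L'', L', L). L'') ` F \<subseteq> levels C"
      using F by auto
    obtain M where M: "M \<in> levels C" "\<forall>K \<in> (\<lambda>(L'', L', L). L'') ` F. K \<subseteq> M"
      using bexE[OF finite_levels_upper_bound[OF fin]] .
    \<comment> \<open>Below \<open>M\<close> the choice of maps out of \<open>obj M\<close> determines all the others.\<close>
    obtain q where q: "\<And>L. L \<in> levels C \<Longrightarrow> L \<subseteq> M \<Longrightarrow> q L \<in> ?M M L"
      using ne[OF _ M(1)] by metis
    have p_ex: "\<exists>p. p \<in> ?M L' L \<and> (L' \<subseteq> M \<longrightarrow> Comp C p (q L') = q L)"
      if L: "L \<in> levels C" "L' \<in> levels C" "L \<subseteq> L'" for L L'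
    proof (cases "L' \<subseteq> M")
      case True
      hence qs: "q L' \<in> ?M M L'" "q L \<in> ?M M L" using q L by auto
      then obtain p where "p \<in> hom C (obj L') (obj L)" "max_quotient C L (obj L') p"
        "Comp C p (q L') = q L"
        using max_quotient_factor[of "q L'" "obj M" "obj L'" L' "q L" "obj L" L] L(3) by blast
      thus ?thesis by blast
    next
      case False
      thus ?thesis using ne[OF L] by blast
    qed
    define p where "p L' L = (SOME p. p \<in> ?M L' L \<and> (L' \<subseteq> M \<longrightarrow> Comp C p (q L') = q L))" for L' L
    have p: "p L' L \<in> ?M L' L \<and> (L' \<subseteq> M \<longrightarrow> Comp C (p L' L) (q L') = q L)"
      if "L \<in> levels C" "L' \<in> levels C" "L \<subseteq> L'" for L L'
      unfolding p_def using p_ex[OF that] by (rule someI_ex)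
    let ?f = "\<lambda>v \<in> ?V. p (fst v) (snd v)"
    have "?f \<in> Pi\<^sub>E ?V ?D" using p by auto
    moreover have "?P c ?f" if c: "c \<in> F" for c
    proof -
      obtain L'' L' L where c': "c = (L'', L', L)" by (cases c)
      have l: "L \<in> levels C" "L' \<in> levels C" "L'' \<in> levels C" "L \<subseteq> L'" "L' \<subseteq> L''"
        using c c' F(2) by auto
      have m: "L'' \<subseteq> M" "L' \<subseteq> M" "L \<subseteq> M" using M(2) c c' l by force+
      have h: "q L'' \<in> hom C (obj M) (obj L'')" "p L'' L' \<in> hom C (obj L'') (obj L')"
        "p L' L \<in> hom C (obj L') (obj L)" "p L'' L \<in> hom C (obj L'') (obj L)"
        using q[OF l(3) m(1)] p[OF l(2,3,5)] p[OF l(1,2,4)] p[OF l(1,3)] l by auto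
      have "epi C (q L'')" using q[OF l(3) m(1)] unfolding max_quotient_def by (auto elim: quotientsE)
      moreover have "Comp C (Comp C (p L' L) (p L'' L')) (q L'') = Comp C (p L'' L) (q L'')"
        using Comp_assoc[OF h(1-3)] p[OF l(2,3,5)] p[OF l(1,2,4)] p[OF l(1,3)] l m by auto
      ultimately have "Comp C (p L' L) (p L'' L') = p L'' L"
        using epi_cancel[OF _ h(1) Comp_hom[OF h(2,3)] h(4)] by blast
      thus ?thesis using c' l by auto
    qed
    ultimately show "\<exists>f \<in> Pi\<^sub>E ?V ?D. \<forall>c \<in> F. ?P c f" by blast
  qed auto
  then obtain f where f: "f \<in> Pi\<^sub>E ?V ?D" "\<forall>c \<in> ?K. ?P c f" by (rule bexE)
  have f_mem: "f (L', L) \<in> ?M L' L" if "L \<in> levels C" "L' \<in> levels C" "L \<subseteq> L'" for L L'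
    using PiE_mem[OF f(1), of "(L', L)"] that by simp
  have "level_system C obj (\<lambda>L' L. f (L', L))"
  proof
    fix L assume L: "L \<in> levels C"
    thus "obj L \<in> L" using obj by blast
    fix L' assume L': "L' \<in> levels C" "L \<subseteq> L'"
    show "f (L', L) \<in> hom C (obj L') (obj L)" "max_quotient C L (obj L') (f (L', L))"
      using f_mem[OF L L'] by auto
    fix L'' assume "L'' \<in> levels C" "L' \<subseteq> L''"
    thus "Comp C (f (L', L)) (f (L'', L')) = f (L'', L)"
      using f(2)[rule_format, of "(L'', L', L)"] L L' by simp
  qed
  thus ?thesis using that obj by blast
qed

section \<open>The limit of a compatible system\<close>

text \<open>
  The set of levels ordered by reverse inclusion: the pair \<open>(L', L)\<close> with \<open>L \<subseteq> L'\<close> is the arrow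
  from \<open>L'\<close> to \<open>L\<close>. All indices lie in the left summands.
\<close>

definition level_cat :: "('o, 'm) cat \<Rightarrow> ('o set + 'i, ('o set \<times> 'o set) + 'j) cat" where
  "level_cat C =
    \<lparr>Obj = Inl ` levels C,
     Arr = {Inl (L', L) |L L'. L \<in> levels C \<and> L' \<in> levels C \<and> L \<subseteq> L'},
     Dom = (\<lambda>u. Inl (fst (projl u))), Cod = (\<lambda>u. Inl (snd (projl u))),
     Ident = (\<lambda>i. Inl (projl i, projl i)),
     Comp = (\<lambda>v u. Inl (fst (projl u), snd (projl v)))\<rparr>"

lemma Obj_level_cat [simp]: "Obj (level_cat C) = Inl ` levels C"
  by (simp add: level_cat_def)

lemma hom_level_cat:
  "u \<in> hom (level_cat C) i' i \<longleftrightarrow> (\<exists>L \<in> levels C. \<exists>L' \<in> levels C. L \<subseteq> L' \<and>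
    i' = Inl L' \<and> i = Inl L \<and> u = Inl (L', L))"
  by (auto simp: hom_def level_cat_def)

lemma (in category) cofiltered_level_cat:
  "cofiltered_category (level_cat C :: ('o set + 'i, ('o set \<times> 'o set) + 'j) cat)"
  (is "cofiltered_category ?I")
proof
  fix f assume "f \<in> Arr ?I"
  thus "Dom ?I f \<in> Obj ?I" "Cod ?I f \<in> Obj ?I"
    by (auto simp: level_cat_def)
next
  fix a assume "a \<in> Obj ?I"
  thus "Ident ?I a \<in> hom ?I a a"
    by (auto simp: hom_level_cat) (auto simp: level_cat_def)
next
  fix f a b g d assume "f \<in> hom ?I a b" "g \<in> hom ?I b d"
  thus "Comp ?I g f \<in> hom ?I a d"
    by (auto simp: hom_level_cat) (auto simp: level_cat_def)
next
  fix f a b assume "f \<in> hom ?I a b"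
  thus "Comp ?I f (Ident ?I a) = f"
    "Comp ?I (Ident ?I b) f = f"
    by (auto simp: hom_level_cat) (auto simp: level_cat_def)
next
  fix f a b g d h e assume "f \<in> hom ?I a b" "g \<in> hom ?I b d"
    "h \<in> hom ?I d e"
  thus "Comp ?I h (Comp ?I g f) = Comp ?I (Comp ?I h g) f"
    by (simp add: level_cat_def)
next
  show "Obj ?I \<noteq> {}"
    using finite_levels_upper_bound[of "{}"] by auto
next
  fix a b assume "a \<in> Obj ?I" "b \<in> Obj ?I"
  then obtain K L where KL: "K \<in> levels C" "L \<in> levels C" "a = Inl K" "b = Inl L" by auto
  obtain M where M: "M \<in> levels C" "K \<subseteq> M" "L \<subseteq> M"
    using finite_levels_upper_bound[of "{K, L}"] KL by auto
  have "Inl (M, K) \<in> hom ?I (Inl M) a" "Inl (M, L) \<in> hom ?I (Inl M) b"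
    using KL M by (auto simp: hom_level_cat)
  thus "\<exists>c \<in> Obj ?I. hom ?I c a \<noteq> {} \<and> hom ?I c b \<noteq> {}"
    using M(1) by auto
next
  fix f a b g assume fg: "f \<in> hom ?I a b" "g \<in> hom ?I a b"
  hence "f = g" by (auto simp: hom_level_cat)
  moreover obtain L where L: "L \<in> levels C" "a = Inl L" using fg(1) by (auto simp: hom_level_cat)
  have "Inl (L, L) \<in> hom ?I a a" using L by (auto simp: hom_level_cat)
  ultimately show "\<exists>c \<in> Obj ?I. \<exists>h \<in> hom ?I c a.
      Comp ?I f h = Comp ?I g h"
    using L by auto
qed

context level_system
begin

definition limit :: "('o set + 'i, ('o set \<times> 'o set) + 'j, 'o, 'm) pro_obj" where
  "limit = \<lparr>idx = level_cat C, on_obj = (\<lambda>i. obj (projl i)),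
    on_arr = (\<lambda>u. tr (fst (projl u)) (snd (projl u)))\<rparr>"

lemma limit_simps [simp]:
  "idx limit = level_cat C" "on_obj limit (Inl L) = obj L" "on_arr limit (Inl (L', L)) = tr L' L"
  by (simp_all add: limit_def)

lemma obj_Obj: "L \<in> levels C \<Longrightarrow> obj L \<in> Obj C"
  using obj_level level_Obj by blast

lemma tr_epi: "L \<in> levels C \<Longrightarrow> L' \<in> levels C \<Longrightarrow> L \<subseteq> L' \<Longrightarrow> epi C (tr L' L)"
  using tr_max unfolding max_quotient_def quotients_def by blast

lemma tr_self:
  assumes L: "L \<in> levels C"
  shows "tr L L = Ident C (obj L)"
proof -
  note h = tr_hom[OF L L order_refl]
  have "Comp C (tr L L) (tr L L) = Comp C (Ident C (obj L)) (tr L L)"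
    using tr_comp[OF L L L] Comp_Ident_left[OF h] by simp
  thus ?thesis
    by (rule epi_cancel[OF tr_epi[OF L L order_refl] h h Ident_hom[OF obj_Obj[OF L]]])
qed

lemma level_pair_upper_bound:
  assumes "K \<in> levels C" "L \<in> levels C"
  obtains M where "M \<in> levels C" "K \<subseteq> M" "L \<subseteq> M"
  using finite_levels_upper_bound[of "{K, L}"] assms by auto

lemma epic_pro_object_limit:
  "epic_pro_object C (limit :: ('o set + 'i, ('o set \<times> 'o set) + 'j, 'o, 'm) pro_obj)"
  (is "epic_pro_object C ?Y")
proof -
  have "pro_object_axioms C ?Y"
    unfolding pro_object_axioms_def
  proof (intro conjI allI impI)
    fix i :: "'o set + 'i" assume "i \<in> Obj (idx ?Y)"
    thus "on_obj ?Y i \<in> Obj C" "on_arr ?Y (Ident (idx ?Y) i) = Ident C (on_obj ?Y i)"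
      using obj_Obj tr_self by (auto simp: level_cat_def)
  next
    fix u :: "('o set \<times> 'o set) + 'j" and i i' :: "'o set + 'i"
    assume "u \<in> hom (idx ?Y) i i'"
    thus "on_arr ?Y u \<in> hom C (on_obj ?Y i) (on_obj ?Y i')"
      using tr_hom by (auto simp: hom_level_cat)
  next
    fix u v :: "('o set \<times> 'o set) + 'j" and i i' i'' :: "'o set + 'i"
    assume "u \<in> hom (idx ?Y) i i'" "v \<in> hom (idx ?Y) i' i''"
    thus "on_arr ?Y (Comp (idx ?Y) v u) = Comp C (on_arr ?Y v) (on_arr ?Y u)"
      using tr_comp by (auto simp: hom_level_cat) (auto simp: level_cat_def)
  qed
  moreover have "cofiltered_category (idx ?Y)" using cofiltered_level_cat by simp
  moreover have "epi C (on_arr ?Y u)" if "u \<in> Arr (idx ?Y)" for u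
    using that tr_epi by (auto simp: level_cat_def)
  ultimately show ?thesis
    unfolding epic_pro_object_def epic_pro_object_axioms_def pro_object_def
    using category_axioms by blast
qed

end

text \<open>
  The constant \<open>limit\<close> is polymorphic in the right summands of its index types. The parameter
  \<open>Y\<close> stands for one instance of it.
\<close>

locale level_system_limit = level_system C obj tr + Y: epic_pro_object C Y
  for C :: "('o, 'm) cat" and obj tr
    and Y :: "('o set + 'i, ('o set \<times> 'o set) + 'j, 'o, 'm) pro_obj" +
  assumes Y_def: "Y = limit"
begin

lemma Y_simps [simp]:
  "idx Y = level_cat C" "on_obj Y (Inl L) = obj L" "on_arr Y (Inl (L', L)) = tr L' L"
  by (simp_all add: Y_def)

text \<open>
  The projection from the limit to \<open>obj L\<close>.
\<close>

definition point :: "'o set \<Rightarrow> (('o set + 'i) \<times> 'm) set" where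
  "point L = germ C Y (Inl L) (Ident C (obj L))"

lemma germ_tr:
  assumes L: "L \<in> levels C" "M \<in> levels C" "L \<subseteq> M" and f: "f \<in> hom C (obj L) A"
  shows "germ C Y (Inl M) (Comp C f (tr M L)) = germ C Y (Inl L) f"
proof -
  have "Inl (M, L) \<in> hom (idx Y) (Inl M) (Inl L)" using L by (simp add: hom_level_cat)
  thus ?thesis using Y.germ_precomp[of f "Inl L" A "Inl (M, L)" "Inl M"] f L(1) by simp
qed

lemma germ_eq_post_point:
  "L \<in> levels C \<Longrightarrow> f \<in> hom C (obj L) A \<Longrightarrow> germ C Y (Inl L) f = germ_post C Y f (point L)"
  using Y.germ_eq_post[of "Inl L" f A] unfolding point_def by simp

lemma epi_germ_point: "L \<in> levels C \<Longrightarrow> epi_germ C Y (obj L) (point L)"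
  using Y.epi_germ_Ident[of "Inl L"] unfolding point_def by simp

text \<open>
  A quotient of \<open>Y\<close> in \<open>L\<close> is a quotient of some \<open>obj M\<close> with \<open>L \<subseteq> M\<close>, hence factors through
  the maximal quotient \<open>obj L\<close> of \<open>obj M\<close> in \<open>L\<close>.
\<close>

lemma epi_germ_factor:
  assumes L: "L \<in> levels C" and H: "H \<in> L" and b: "epi_germ C Y H b"
  obtains h where "h \<in> hom C (obj L) H" "epi C h" "b = germ C Y (Inl L) h"
proof -
  obtain i f where "i \<in> Obj (idx Y)" "f \<in> hom C (on_obj Y i) H" "b = germ C Y i f"
    using Y.germsE[OF Y.epi_germD(2)[OF b]] .
  then obtain K where K: "K \<in> levels C" and f: "f \<in> hom C (obj K) H" "b = germ C Y (Inl K) f" by auto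
  obtain M where M: "M \<in> levels C" "K \<subseteq> M" "L \<subseteq> M" using level_pair_upper_bound[OF K L] .
  let ?f = "Comp C f (tr M K)"
  have f': "?f \<in> hom C (obj M) H" "b = germ C Y (Inl M) ?f"
    using Comp_hom[OF tr_hom[OF K M(1,2)] f(1)] germ_tr[OF K M(1,2) f(1)] f(2) by auto
  have "epi C ?f" using Y.epi_of_epi_germ[of "Inl M" ?f H] M(1) f' b by simp
  hence "quot_le C ?f (tr M L)"
    using tr_max[OF L M(1,3)] quotientsI[OF f'(1)] H hom_Cod[OF f'(1)] unfolding max_quotient_def by simp
  then obtain h where h: "h \<in> hom C (obj L) H" "?f = Comp C h (tr M L)"
    using quot_leE[OF _ tr_hom[OF L M(1,3)] f'(1)] by blast
  have "b = germ C Y (Inl L) h" using germ_tr[OF L M(1,3) h(1)] f'(2) h(2) by simp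
  moreover from this have "epi C h" using Y.epi_of_epi_germ[of "Inl L" h H] L h(1) b by simp
  ultimately show ?thesis using that h(1) by blast
qed

lemma max_germ_point:
  assumes L: "L \<in> levels C"
  shows "max_germ C L Y (obj L) (point L)"
  unfolding max_germ_def
proof (intro conjI ballI allI impI)
  fix H b assume "H \<in> L" "epi_germ C Y H b"
  then obtain h where "h \<in> hom C (obj L) H" "b = germ C Y (Inl L) h" using epi_germ_factor[OF L] by metis
  thus "\<exists>h \<in> hom C (obj L) H. b = germ_post C Y h (point L)" using germ_eq_post_point[OF L] by blast
qed (use obj_level[OF L] epi_germ_point[OF L] in auto)

text \<open>
  If \<open>H\<close> is in the level \<open>L\<close>, then the epimorphisms from \<open>Y\<close> to \<open>H\<close> correspond to those from
  \<open>obj L\<close>, and these are finite in number.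
\<close>

lemma diamond_small_pro_object_limit: "diamond_small_pro_object C Y"
proof -
  have "finite {b. epi_germ C Y H b}" if H: "H \<in> Obj C" for H
  proof -
    obtain L where L: "L \<in> levels C" "H \<in> L" using ex_level_containing[OF H] .
    have "{b. epi_germ C Y H b} \<subseteq> germ C Y (Inl L) ` {h \<in> hom C (obj L) H. epi C h}"
      using epi_germ_factor[OF L] by blast
    thus ?thesis using finite_surj[OF finite_epis[OF obj_Obj[OF L(1)] H]] by blast
  qed
  hence "small_epic_pro_object C Y"
    unfolding small_epic_pro_object_def small_epic_pro_object_axioms_def
    using Y.epic_pro_object_axioms by blast
  thus ?thesis unfolding diamond_small_pro_object_def using diamond_category_axioms by blast
qed

lemma pro_level_quotient_limit:
  assumes L: "L \<in> levels C"
  shows "pro_level_quotient C L Y = iso_class C (obj L)"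
proof -
  interpret D: diamond_small_pro_object C Y by (rule diamond_small_pro_object_limit)
  show ?thesis
    using D.max_germ_codomains[OF L max_germ_point[OF L]] D.pro_level_quotient_eq[OF L] by simp
qed

end

section \<open>Uniqueness\<close>

locale two_realizations = level_system_limit C obj tr Y + Z: diamond_small_pro_object C Z
  for C :: "('o, 'm) cat" and obj tr
    and Y Z :: "('o set + 'i, ('o set \<times> 'o set) + 'j, 'o, 'm) pro_obj" +
  assumes same_quotients: "L \<in> levels C \<Longrightarrow> pro_level_quotient C L Z = iso_class C (obj L)"
begin

lemma max_germ_tr:
  assumes L: "L \<in> levels C" "L' \<in> levels C" "L \<subseteq> L'" and a: "max_germ C L' Z (obj L') a"
  shows "max_germ C L Z (obj L) (germ_post C Z (tr L' L) a)"
proof -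
  have e: "epi_germ C Z (obj L') a" using a unfolding max_germ_def by blast
  note t = tr_hom[OF L] tr_epi[OF L]
  have "\<exists>h \<in> hom C (obj L) H. b = germ_post C Z h (germ_post C Z (tr L' L) a)"
    if H: "H \<in> L" "epi_germ C Z H b" for H b
  proof -
    obtain q where q: "q \<in> hom C (obj L') H" "b = germ_post C Z q a"
      using a H L(3) unfolding max_germ_def by blast
    have "epi C q" using Z.epi_of_epi_germ_post[OF Z.epi_germD(2)[OF e] q(1)] q(2) H(2) by simp
    hence "quot_le C q (tr L' L)"
      using tr_max[OF L] quotientsI[OF q(1)] H(1) hom_Cod[OF q(1)] unfolding max_quotient_def by simp
    then obtain h where h: "h \<in> hom C (obj L) H" "q = Comp C h (tr L' L)"
      using quot_leE[OF _ t(1) q(1)] by blast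
    thus ?thesis using Z.post_post[OF e t(1) h(1)] q(2) by auto
  qed
  thus ?thesis using obj_level[OF L(1)] Z.epi_germ_post[OF e t] unfolding max_germ_def by blast
qed

text \<open>
  A maximal quotient map from \<open>Z\<close> to \<open>obj M\<close> induces compatible maps to all \<open>obj L\<close> with
  \<open>L \<subseteq> M\<close>. By smallness there are finitely many maximal quotient maps to each \<open>obj L\<close>, so
  compactness yields a family that is compatible over all levels.
\<close>

lemma ex_compatible_max_germs:
  "\<exists>m. (\<forall>L \<in> levels C. max_germ C L Z (obj L) (m L)) \<and>
    (\<forall>L \<in> levels C. \<forall>L' \<in> levels C. L \<subseteq> L' \<longrightarrow> germ_post C Z (tr L' L) (m L') = m L)"
proof -
  let ?D = "\<lambda>L. {a. max_germ C L Z (obj L) a}"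
  let ?K = "{(L', L). L \<in> levels C \<and> L' \<in> levels C \<and> L \<subseteq> L'}"
  let ?P = "\<lambda>(L', L) m. germ_post C Z (tr L' L) (m L') = m L"
  have ne: "\<exists>a. max_germ C L Z (obj L) a" if L: "L \<in> levels C" for L
  proof -
    have "obj L \<in> pro_level_quotient C L Z"
      using same_quotients[OF L] isomorphic_refl obj_Obj[OF L] unfolding iso_class_def by simp
    thus ?thesis using Z.pro_level_quotient_eq[OF L] by simp
  qed
  have "\<exists>m \<in> Pi\<^sub>E (levels C) ?D. \<forall>c \<in> ?K. ?P c m"
  proof (rule finite_constraint_compactness[where s = "\<lambda>(L', L). {L', L}"])
    fix L assume L: "L \<in> levels C"
    have "?D L \<subseteq> {a. epi_germ C Z (obj L) a}" unfolding max_germ_def by blast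
    thus "finite (?D L)" using Z.finite_epi_germs[OF obj_Obj[OF L]] finite_subset by blast
  next
    fix F assume F: "finite F" "F \<subseteq> ?K"
    have fin: "finite (fst ` F)" "fst ` F \<subseteq> levels C" using F by auto
    obtain M where M: "M \<in> levels C" "\<forall>K \<in> fst ` F. K \<subseteq> M"
      using bexE[OF finite_levels_upper_bound[OF fin]] .
    obtain a where a: "max_germ C M Z (obj M) a" using ne[OF M(1)] by blast
    let ?m = "\<lambda>L \<in> levels C. if L \<subseteq> M then germ_post C Z (tr M L) a
      else (SOME b. max_germ C L Z (obj L) b)"
    have "?m \<in> Pi\<^sub>E (levels C) ?D"
      using max_germ_tr[OF _ M(1) _ a] someI_ex[OF ne] by auto
    moreover have "?P c ?m" if c: "c \<in> F" for c
    proof -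
      obtain L' L where c': "c = (L', L)" by (cases c)
      have l: "L \<in> levels C" "L' \<in> levels C" "L \<subseteq> L'" "L' \<subseteq> M"
        using c c' F(2) M(2) by force+
      have "epi_germ C Z (obj M) a" using a unfolding max_germ_def by blast
      hence "germ_post C Z (tr L' L) (germ_post C Z (tr M L') a) = germ_post C Z (tr M L) a"
        using Z.post_post[OF _ tr_hom[OF l(2) M(1) l(4)] tr_hom[OF l(1-3)]]
          tr_comp[OF l(1,2) M(1) l(3,4)] by simp
      thus ?thesis using c' l by auto
    qed
    ultimately show "\<exists>m \<in> Pi\<^sub>E (levels C) ?D. \<forall>c \<in> F. ?P c m" by blast
  qed auto
  then obtain m where m: "m \<in> Pi\<^sub>E (levels C) ?D" "\<forall>c \<in> ?K. ?P c m" by (rule bexE)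
  have "\<forall>L \<in> levels C. max_germ C L Z (obj L) (m L)" using PiE_mem[OF m(1)] by simp
  moreover have "\<forall>L \<in> levels C. \<forall>L' \<in> levels C. L \<subseteq> L' \<longrightarrow> germ_post C Z (tr L' L) (m L') = m L"
    using m(2) by auto
  ultimately show ?thesis by blast
qed

text \<open>
  The compatible family \<open>m\<close> is a morphism from \<open>Z\<close> to the limit. For the inverse, let \<open>L\<close> be a
  level that contains \<open>on_obj Z i\<close>. The projection from \<open>Z\<close> to this object is an epimorphism, so
  it factors through the maximal quotient \<open>m L\<close>, and the factor is the component at \<open>i\<close>. That
  components fit together and that both composites are identities follows from the
  cancellation property of the \<open>m L\<close>.
\<close>

lemma isomorphic_limit: "isomorphic (pro_cat C) Z Y"
proof -
  obtain m where "(\<forall>L \<in> levels C. max_germ C L Z (obj L) (m L)) \<and>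
    (\<forall>L \<in> levels C. \<forall>L' \<in> levels C. L \<subseteq> L' \<longrightarrow> germ_post C Z (tr L' L) (m L') = m L)"
    using exE[OF ex_compatible_max_germs] .
  hence m: "max_germ C L Z (obj L) (m L)"
    and m_tr: "L' \<in> levels C \<Longrightarrow> L \<subseteq> L' \<Longrightarrow> germ_post C Z (tr L' L) (m L') = m L"
    if "L \<in> levels C" for L L'
    using that by simp_all
  have e: "epi_germ C Z (obj L) (m L)" if "L \<in> levels C" for L
    using m[OF that] unfolding max_germ_def by blast
  \<comment> \<open>The projection from \<open>Z\<close> to its object with index \<open>i\<close>.\<close>
  let ?id = "\<lambda>i. germ C Z i (Ident C (on_obj Z i))"
  \<comment> \<open>A map out of \<open>Y\<close> is determined by its composite with the family \<open>m\<close>.\<close>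
  have unique: "germ C Y (Inl L) h = germ C Y (Inl K) k"
    if L: "L \<in> levels C" "h \<in> hom C (obj L) A" and K: "K \<in> levels C" "k \<in> hom C (obj K) A"
      and eq: "germ_post C Z h (m L) = germ_post C Z k (m K)" for L K h k A
  proof -
    obtain M where M: "M \<in> levels C" "L \<subseteq> M" "K \<subseteq> M" using level_pair_upper_bound[OF L(1) K(1)] .
    note tL = tr_hom[OF L(1) M(1,2)] and tK = tr_hom[OF K(1) M(1,3)]
    have "germ_post C Z (Comp C h (tr M L)) (m M) = germ_post C Z (Comp C k (tr M K)) (m M)"
      using Z.post_post[OF e[OF M(1)] tL L(2)] Z.post_post[OF e[OF M(1)] tK K(2)]
        m_tr[OF L(1) M(1,2)] m_tr[OF K(1) M(1,3)] eq by simp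
    hence "Comp C h (tr M L) = Comp C k (tr M K)"
      using Z.epi_germD(1)[OF e[OF M(1)] Comp_hom[OF tL L(2)] Comp_hom[OF tK K(2)]] by blast
    thus ?thesis using germ_tr[OF L(1) M(1,2) L(2)] germ_tr[OF K(1) M(1,3) K(2)] by simp
  qed
  have "\<exists>L h. L \<in> levels C \<and> h \<in> hom C (obj L) (on_obj Z i) \<and> ?id i = germ_post C Z h (m L)"
    if i: "i \<in> Obj (idx Z)" for i
  proof -
    obtain L where L: "L \<in> levels C" "on_obj Z i \<in> L"
      using ex_level_containing[OF Z.on_obj[OF i]] .
    thus ?thesis using m[OF L(1)] Z.epi_germ_Ident[OF i] unfolding max_germ_def by blast
  qed
  then obtain lv h where lv: "\<And>i. i \<in> Obj (idx Z) \<Longrightarrow> lv i \<in> levels C"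
    and h: "\<And>i. i \<in> Obj (idx Z) \<Longrightarrow> h i \<in> hom C (obj (lv i)) (on_obj Z i)"
    and h_m: "\<And>i. i \<in> Obj (idx Z) \<Longrightarrow> ?id i = germ_post C Z (h i) (m (lv i))"
    by metis
  define \<phi> where "\<phi> = (\<lambda>i \<in> Obj (idx Y). m (projl i))"
  define \<psi> where "\<psi> = (\<lambda>i \<in> Obj (idx Z). germ C Y (Inl (lv i)) (h i))"
  have \<phi>: "\<phi> \<in> pro_hom C Z Y"
    unfolding pro_hom_def
  proof (intro CollectI conjI ballI)
    show "\<phi> \<in> (\<Pi>\<^sub>E j \<in> Obj (idx Y). germs C Z (on_obj Y j))"
      using Z.epi_germD(2)[OF e] unfolding \<phi>_def by auto
    fix w assume "w \<in> Arr (idx Y)"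
    then obtain L L' where w: "w = Inl (L', L)" "L \<in> levels C" "L' \<in> levels C" "L \<subseteq> L'"
      by (auto simp: level_cat_def)
    show "\<phi> (Cod (idx Y) w) = germ_post C Z (on_arr Y w) (\<phi> (Dom (idx Y) w))"
      using m_tr[OF w(2-4)] w unfolding \<phi>_def by (simp add: level_cat_def)
  qed
  have \<psi>: "\<psi> \<in> pro_hom C Y Z"
    unfolding pro_hom_def
  proof (intro CollectI conjI ballI)
    show "\<psi> \<in> (\<Pi>\<^sub>E i \<in> Obj (idx Z). germs C Y (on_obj Z i))"
      using Y.germsI[of "Inl (lv _)"] lv h unfolding \<psi>_def by auto
    fix w assume w: "w \<in> Arr (idx Z)"
    let ?i = "Dom (idx Z) w" and ?j = "Cod (idx Z) w"
    have wh: "w \<in> hom (idx Z) ?i ?j" using w by (simp add: hom_def)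
    note o = Z.I.hom_Obj[OF wh] and zw = Z.on_arr[OF wh]
    note hw = Comp_hom[OF h[OF o(1)] zw]
    have "germ_post C Z (Comp C (on_arr Z w) (h ?i)) (m (lv ?i)) = germ_post C Z (on_arr Z w) (?id ?i)"
      using Z.post_post[OF e[OF lv[OF o(1)]] h[OF o(1)] zw] h_m[OF o(1)] by simp
    also have "\<dots> = germ C Z ?i (on_arr Z w)" using Z.germ_eq_post[OF o(1) zw] by simp
    also have "\<dots> = ?id ?j"
      using Z.germ_precomp[OF Ident_hom[OF Z.on_obj[OF o(2)]] o(2) wh] Comp_Ident_left[OF zw] by simp
    finally have "germ C Y (Inl (lv ?i)) (Comp C (on_arr Z w) (h ?i)) = germ C Y (Inl (lv ?j)) (h ?j)"
      using unique[OF lv[OF o(1)] hw lv[OF o(2)] h[OF o(2)]] h_m[OF o(2)] by simp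
    thus "\<psi> ?j = germ_post C Y (on_arr Z w) (\<psi> ?i)"
      using Y.germ_post_germ[of "h ?i" "Inl (lv ?i)" "on_obj Z ?i" "on_arr Z w"] o lv[OF o(1)] h[OF o(1)] zw
      unfolding \<psi>_def by simp
  qed
  note oY = Y.pro_object_axioms and oZ = Z.pro_object_axioms
  have "pro_comp C Z Z \<psi> \<phi> = pro_ident C Z"
  proof (rule extensionalityI[of _ "Obj (idx Z)"])
    fix i assume i: "i \<in> Obj (idx Z)"
    have "pro_comp C Z Z \<psi> \<phi> i = germ_post C Z (h i) (\<phi> (Inl (lv i)))"
      by (rule pro_comp_germ[OF oZ oY \<phi> i]) (use lv[OF i] h[OF i] i in \<open>simp_all add: \<psi>_def\<close>)
    thus "pro_comp C Z Z \<psi> \<phi> i = pro_ident C Z i"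
      using h_m[OF i] lv[OF i] i unfolding \<phi>_def by (simp add: pro_ident_def)
  qed (simp_all add: pro_comp_def pro_ident_def)
  moreover have "pro_comp C Y Y \<phi> \<psi> = pro_ident C Y"
  proof (rule extensionalityI[of _ "Obj (idx Y)"])
    fix j assume "j \<in> Obj (idx Y)"
    then obtain L where L: "L \<in> levels C" "j = Inl L" by auto
    obtain i f where f: "i \<in> Obj (idx Z)" "f \<in> hom C (on_obj Z i) (obj L)" "m L = germ C Z i f"
      using Z.germsE[OF Z.epi_germD(2)[OF e[OF L(1)]]] .
    note i = f(1) and id = Ident_hom[OF obj_Obj[OF L(1)]]
    have "pro_comp C Y Y \<phi> \<psi> j = germ_post C Y f (\<psi> i)"
      by (rule pro_comp_germ[OF oY oZ \<psi> _ i]) (use L f in \<open>simp_all add: \<phi>_def\<close>)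
    also have "\<dots> = germ C Y (Inl (lv i)) (Comp C f (h i))"
      using Y.germ_post_germ[of "h i" "Inl (lv i)" "on_obj Z i" f] lv[OF i] h[OF i] f i
      unfolding \<psi>_def by simp
    also have "\<dots> = germ C Y (Inl L) (Ident C (obj L))"
    proof (rule unique[OF lv[OF i] Comp_hom[OF h[OF i] f(2)] L(1) id])
      have "germ_post C Z (Comp C f (h i)) (m (lv i)) = germ_post C Z f (?id i)"
        using Z.post_post[OF e[OF lv[OF i]] h[OF i] f(2)] h_m[OF i] by simp
      also have "\<dots> = m L" using Z.germ_eq_post[OF i f(2)] f(3) by simp
      also have "\<dots> = germ_post C Z (Ident C (obj L)) (m L)"
        using Z.germ_post_Ident[OF Z.epi_germD(2)[OF e[OF L(1)]]] by simp
      finally show "germ_post C Z (Comp C f (h i)) (m (lv i)) = germ_post C Z (Ident C (obj L)) (m L)" .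
    qed
    finally show "pro_comp C Y Y \<phi> \<psi> j = pro_ident C Y j" using L by (simp add: pro_ident_def)
  qed (simp_all add: pro_comp_def pro_ident_def)
  moreover interpret P: category "pro_cat C" by (rule category_pro_cat)
  have "(Z, Y, \<phi>) \<in> hom (pro_cat C) Z Y" "(Y, Z, \<psi>) \<in> hom (pro_cat C) Y Z"
    unfolding pro_cat_hom using \<phi> \<psi> oY oZ by blast+
  ultimately show ?thesis
    unfolding isomorphic_def
    by (intro bexI[of _ "(Z, Y, \<phi>)"] P.isoI[of _ Z Y "(Y, Z, \<psi>)"]) (simp_all add: pro_cat_def)
qed

end

section \<open>Small pro-objects and pro-isomorphism classes\<close>

context diamond_category
begin

lemma small_pro_object_representative:
  assumes "small_pro_object C Y"
  obtains Z where "isomorphic (pro_cat C) Y Z" "diamond_small_pro_object C Z"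
  using assms small_pro_object_iff[OF category_axioms] diamond_category_axioms
  unfolding diamond_small_pro_object_def by blast

lemma ex_unique_realization:
  assumes X: "X \<in> pro_iso_classes C"
  shows "\<exists>Y :: ('o set + 'i, ('o set \<times> 'o set) + 'j, 'o, 'm) pro_obj.
    small_pro_object C Y \<and> (\<forall>L \<in> levels C. pro_level_quotient C L Y = X L) \<and>
    (\<forall>Y' :: ('o set + 'i, ('o set \<times> 'o set) + 'j, 'o, 'm) pro_obj.
      small_pro_object C Y' \<longrightarrow> (\<forall>L \<in> levels C. pro_level_quotient C L Y' = X L) \<longrightarrow>
      isomorphic (pro_cat C) Y' Y)"
proof -
  obtain obj tr where sys: "level_system C obj tr"
    and X_obj: "\<And>L. L \<in> levels C \<Longrightarrow> X L = iso_class C (obj L)"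
    using ex_level_system[OF X] by blast
  interpret level_system C obj tr by fact
  interpret P: category "pro_cat C" by (rule category_pro_cat)
  let ?Y = "limit :: ('o set + 'i, ('o set \<times> 'o set) + 'j, 'o, 'm) pro_obj"
  have lim: "level_system_limit C obj tr ?Y"
    using sys epic_pro_object_limit
    unfolding level_system_limit_def level_system_limit_axioms_def by blast
  interpret Y: level_system_limit C obj tr ?Y by (rule lim)
  interpret D: diamond_small_pro_object C ?Y by (rule Y.diamond_small_pro_object_limit)
  have "isomorphic (pro_cat C) ?Y ?Y"
    using P.isomorphic_refl Y.Y.pro_object_axioms by (simp add: pro_cat_def)
  hence "small_pro_object C ?Y"
    unfolding small_pro_object_iff[OF category_axioms] using D.small_epic_pro_object_axioms by blast
  moreover have "\<forall>L \<in> levels C. pro_level_quotient C L ?Y = X L"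
    using Y.pro_level_quotient_limit X_obj by simp
  moreover have "isomorphic (pro_cat C) Y' ?Y"
    if Y': "small_pro_object C Y'" "\<forall>L \<in> levels C. pro_level_quotient C L Y' = X L"
    for Y' :: "('o set + 'i, ('o set \<times> 'o set) + 'j, 'o, 'm) pro_obj"
  proof -
    obtain Z where Z: "isomorphic (pro_cat C) Y' Z" "diamond_small_pro_object C Z"
      using small_pro_object_representative[OF Y'(1)] .
    have "two_realizations C obj tr ?Y Z"
      unfolding two_realizations_def two_realizations_axioms_def
      using lim Z(2) Y'(2) X_obj pro_level_quotient_iso[OF Z(1)] by simp
    thus ?thesis using P.isomorphic_trans[OF Z(1)] two_realizations.isomorphic_limit by blast
  qed
  ultimately show ?thesis by blast
qed

text \<open>
  This contains the existence of the maximal quotients of a small pro-object.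
\<close>

lemma small_pro_object_level_quotients:
  assumes "small_pro_object C Y"
  shows "pro_level_quotients C Y \<in> pro_iso_classes C"
proof -
  obtain Z where Z: "isomorphic (pro_cat C) Y Z" "diamond_small_pro_object C Z"
    using small_pro_object_representative[OF assms] .
  have "pro_level_quotients C Y = pro_level_quotients C Z"
    unfolding pro_level_quotients_def using pro_level_quotient_iso[OF Z(1)] by simp
  thus ?thesis
    using diamond_small_pro_object.pro_level_quotients_in_pro_iso_classes[OF Z(2)] by simp
qed

end

theorem lemma5p7:
  fixes C :: "('o, 'm) cat"
  assumes "diamond_category C"
  shows "(\<forall>X \<in> pro_iso_classes C.
      \<exists>Y :: ('o set + 'i, ('o set \<times> 'o set) + 'j, 'o, 'm) pro_obj.
        small_pro_object C Y \<and> (\<forall>L \<in> levels C. pro_level_quotient C L Y = X L) \<and>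
        (\<forall>Y' :: ('o set + 'i, ('o set \<times> 'o set) + 'j, 'o, 'm) pro_obj.
          small_pro_object C Y' \<longrightarrow> (\<forall>L \<in> levels C. pro_level_quotient C L Y' = X L) \<longrightarrow>
          isomorphic (pro_cat C) Y' Y)) \<and>
    bij_betw (\<lambda>K. the_elem (pro_level_quotients C ` K))
      (small_pro_classes C :: ('o set + 'i, ('o set \<times> 'o set) + 'j, 'o, 'm) pro_obj set set)
      (pro_iso_classes C)"
    (is "?unique \<and> bij_betw ?q ?S _")
proof
  interpret diamond_category C by fact
  interpret P: category "pro_cat C ::
    (('o set + 'i, ('o set \<times> 'o set) + 'j, 'o, 'm) pro_obj,
     ('o set + 'i, ('o set \<times> 'o set) + 'j, 'o, 'm) pro_obj \<times>
     ('o set + 'i, ('o set \<times> 'o set) + 'j, 'o, 'm) pro_obj \<times>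
     ('o set + 'i \<Rightarrow> (('o set + 'i) \<times> 'm) set)) cat"
    by (rule category_pro_cat)
  show unique: ?unique using ex_unique_realization by blast
  let ?A = "{Y :: ('o set + 'i, ('o set \<times> 'o set) + 'j, 'o, 'm) pro_obj. small_pro_object C Y}"
  let ?R = "{(Y, Z). small_pro_object C Y \<and> small_pro_object C Z \<and> isomorphic (pro_cat C) Y Z}
    :: ('o set + 'i, ('o set \<times> 'o set) + 'j, 'o, 'm) pro_obj rel"
  have refl: "isomorphic (pro_cat C) Y Y" if Y: "small_pro_object C Y"
    for Y :: "('o set + 'i, ('o set \<times> 'o set) + 'j, 'o, 'm) pro_obj"
  proof -
    obtain Z where "isomorphic (pro_cat C) Y Z" using small_pro_object_representative[OF Y] .
    thus ?thesis using P.isomorphic_refl P.isomorphic_Obj(1) by blast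
  qed
  have S: "?S = (\<lambda>Y. ?R `` {Y}) ` ?A" unfolding small_pro_classes_def quotient_def by blast
  have q: "?q (?R `` {Y}) = pro_level_quotients C Y" if Y: "small_pro_object C Y"
    for Y :: "('o set + 'i, ('o set \<times> 'o set) + 'j, 'o, 'm) pro_obj"
  proof -
    have "pro_level_quotients C Z = pro_level_quotients C Y" if "Z \<in> ?R `` {Y}" for Z
      using that pro_level_quotient_iso unfolding pro_level_quotients_def by fastforce
    moreover have "Y \<in> ?R `` {Y}" using Y refl by simp
    ultimately have "pro_level_quotients C ` (?R `` {Y}) = {pro_level_quotients C Y}" by blast
    thus ?thesis by simp
  qed
  show "bij_betw ?q ?S (pro_iso_classes C)"
    unfolding bij_betw_def
  proof
    show "inj_on ?q ?S"
      unfolding S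
    proof (rule inj_onI, elim imageE)
      fix K K' Y Z assume K: "K = ?R `` {Y}" "Y \<in> ?A" and K': "K' = ?R `` {Z}" "Z \<in> ?A"
        and "?q K = ?q K'"
      hence eq: "pro_level_quotients C Y = pro_level_quotients C Z" using q by simp
      let ?X = "pro_level_quotients C Y"
      have X: "?X \<in> pro_iso_classes C" using small_pro_object_level_quotients K(2) by blast
      have vals: "pro_level_quotient C L Y = ?X L" "pro_level_quotient C L Z = ?X L"
        if "L \<in> levels C" for L
        using that eq unfolding pro_level_quotients_def by (auto dest: fun_cong[of _ _ L])
      obtain W :: "('o set + 'i, ('o set \<times> 'o set) + 'j, 'o, 'm) pro_obj" where W:
        "\<And>Y'. small_pro_object C Y' \<Longrightarrow> \<forall>L \<in> levels C. pro_level_quotient C L Y' = ?X L \<Longrightarrow>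
          isomorphic (pro_cat C) Y' W"
        using unique X by blast
      have "isomorphic (pro_cat C) Y W" "isomorphic (pro_cat C) Z W"
        using W K(2) K'(2) vals by blast+
      hence "isomorphic (pro_cat C) Y Z" using P.isomorphic_trans P.isomorphic_sym by blast
      thus "K = K'"
        using K K' P.isomorphic_trans P.isomorphic_sym by blast
    qed
    show "?q ` ?S = pro_iso_classes C"
    proof (intro equalityI subsetI)
      fix X assume "X \<in> ?q ` ?S"
      then obtain Y where "Y \<in> ?A" "X = ?q (?R `` {Y})" unfolding S by blast
      thus "X \<in> pro_iso_classes C" using q small_pro_object_level_quotients by simp
    next
      fix X assume X: "X \<in> pro_iso_classes C"
      then obtain Y :: "('o set + 'i, ('o set \<times> 'o set) + 'j, 'o, 'm) pro_obj"
        where Y: "small_pro_object C Y" "\<forall>L \<in> levels C. pro_level_quotient C L Y = X L"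
        using unique by blast
      have "X \<in> extensional (levels C)" using X unfolding pro_iso_classes_def by (auto simp: PiE_iff)
      hence "pro_level_quotients C Y = X"
        using Y(2) unfolding pro_level_quotients_def by (intro extensionalityI[of _ "levels C"]) auto
      hence "X = ?q (?R `` {Y})" using q[OF Y(1)] by simp
      thus "X \<in> ?q ` ?S" unfolding S using Y(1) by blast
    qed
  qed
qed

end
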